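(* Let $f\colon\mathbb{B}^q\to\mathbb{B}^q$ be a holomorphic self-map of the unit ball of $\mathbb{C}^q$ with $\mathrm{type}(f)=q$, and let $(\mathbb{B}^q,\ell,\tau)$ be a canonical Kobayashi hyperbolic semi-model for $f$. Then for every $R>0$ and every $z\in\mathbb{B}^q$, both $\ell$ and $f$ are univalent on the Kobayashi ball $B(f^n(z),R)$ for all $n$ large enough.
   Context: A semi-model for $f$ is a triple $(\Lambda,h,\varphi)$ where $\Lambda$ is a complex manifold, $h\colon\mathbb{B}^q\to\Lambda$ is holomorphic, $\varphi$ is an automorphism of $\Lambda$, $h\circ f=\varphi\circ h$ and $\bigcup_{n\ge0}\varphi^{-n}(h(\mathbb{B}^q))=\Lambda$. A canonical Kobayashi hyperbolic semi-model for $f$ is a semi-model $(Z,\ell,\tau)$ with $Z$ Kobayashi hyperbolic such that for every semi-model $(\Lambda,h,\varphi)$ with $\Lambda$ Kobayashi hyperbolic there is a holomorphic $\eta\colon Z\to\Lambda$ with $\eta\circ\ell=h$ and $\eta\circ\tau=\varphi\circ\eta$. It exists, is unique up to isomorphism, and its base space is biholomorphic to a ball $\mathbb{B}^d$ with $0\le d\le q$; the type of $f$ is $d$. The Kobayashi ball is $B(p,R)=\{w\in\mathbb{B}^q: k_{\mathbb{B}^q}(w,p)<R\}$, with $k_{\mathbb{B}^q}$ the Kobayashi distance. Univalent means holomorphic and injective. *)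

theory Defs
  imports "HOL-Analysis.Analysis"
begin

section \<open>Complex Euclidean space of variable dimension\<close>

text \<open>
  Dimensions are quantified over inside formulas (the base of a semi-model may have any dimension),
  so C^n is a subset of the type of complex sequences: those supported in \<open>{..<n}\<close>. The product
  topology of the sequence type induces the Euclidean topology on it.
\<close>

type_synonym cvec = "nat \<Rightarrow> complex"

definition cspace :: "nat \<Rightarrow> cvec set"
  where "cspace n = {z. \<forall>i\<ge>n. z i = 0}"

definition cnorm :: "nat \<Rightarrow> cvec \<Rightarrow> real"
  where "cnorm n z = L2_set (\<lambda>i. cmod (z i)) {..<n}"

definition cunit_ball :: "nat \<Rightarrow> cvec set"
  where "cunit_ball n = {z \<in> cspace n. cnorm n z < 1}"

text \<open>
  Complex Frechet differentiability at every point of \<open>S\<close>; the matrix \<open>A\<close> represents the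
  complex-linear derivative. Only used for \<open>S\<close> open in C^m.
\<close>

definition cholomorphic_on :: "nat \<Rightarrow> nat \<Rightarrow> (cvec \<Rightarrow> cvec) \<Rightarrow> cvec set \<Rightarrow> bool"
  where "cholomorphic_on m n g S \<longleftrightarrow>
    g ` S \<subseteq> cspace n \<and>
    (\<forall>z\<in>S. \<exists>A :: nat \<Rightarrow> nat \<Rightarrow> complex. \<forall>e>0. \<exists>d>0. \<forall>w\<in>S.
       cnorm m (\<lambda>j. w j - z j) < d \<longrightarrow>
       cnorm n (\<lambda>i. g w i - g z i - (\<Sum>j<m. A i j * (w j - z j))) \<le> e * cnorm m (\<lambda>j. w j - z j))"

definition univalent_on :: "nat \<Rightarrow> nat \<Rightarrow> (cvec \<Rightarrow> cvec) \<Rightarrow> cvec set \<Rightarrow> bool"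
  where "univalent_on m n g S \<longleftrightarrow> cholomorphic_on m n g S \<and> inj_on g S"


section \<open>Complex manifolds and holomorphic maps\<close>

text \<open>
  The underlying set is \<open>topspace (mtop M)\<close>. A chart is a pair of its domain and its coordinate
  map; the atlas need not be maximal.
\<close>

record 'a cmfd =
  mtop :: "'a topology"
  mdim :: nat
  charts :: "('a set \<times> ('a \<Rightarrow> cvec)) set"

abbreviation mcarrier :: "'a cmfd \<Rightarrow> 'a set"
  where "mcarrier M \<equiv> topspace (mtop M)"

definition complex_manifold :: "'a cmfd \<Rightarrow> bool"
  where "complex_manifold M \<longleftrightarrow>
    Hausdorff_space (mtop M) \<and> second_countable (mtop M) \<and>
    (\<Union>(U, c)\<in>charts M. U) = mcarrier M \<and>
    (\<forall>(U, c)\<in>charts M.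
       openin (mtop M) U \<and> openin (top_of_set (cspace (mdim M))) (c ` U) \<and>
       homeomorphic_map (subtopology (mtop M) U) (top_of_set (c ` U)) c) \<and>
    (\<forall>(U, c)\<in>charts M. \<forall>(V, d)\<in>charts M.
       cholomorphic_on (mdim M) (mdim M) (d \<circ> inv_into U c) (c ` (U \<inter> V)))"

definition holomorphic_map :: "'a cmfd \<Rightarrow> 'b cmfd \<Rightarrow> ('a \<Rightarrow> 'b) \<Rightarrow> bool"
  where "holomorphic_map M N h \<longleftrightarrow>
    continuous_map (mtop M) (mtop N) h \<and>
    (\<forall>(U, c)\<in>charts M. \<forall>(V, d)\<in>charts N.
       cholomorphic_on (mdim M) (mdim N) (d \<circ> h \<circ> inv_into U c) (c ` (U \<inter> h -` V)))"

definition biholomorphic_map :: "'a cmfd \<Rightarrow> 'b cmfd \<Rightarrow> ('a \<Rightarrow> 'b) \<Rightarrow> bool"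
  where "biholomorphic_map M N h \<longleftrightarrow>
    bij_betw h (mcarrier M) (mcarrier N) \<and>
    holomorphic_map M N h \<and> holomorphic_map N M (inv_into (mcarrier M) h)"

abbreviation automorphism :: "'a cmfd \<Rightarrow> ('a \<Rightarrow> 'a) \<Rightarrow> bool"
  where "automorphism M \<equiv> biholomorphic_map M M"

definition biholomorphic :: "'a cmfd \<Rightarrow> 'b cmfd \<Rightarrow> bool"
  where "biholomorphic M N \<longleftrightarrow> (\<exists>h. biholomorphic_map M N h)"

definition ball_mfd :: "nat \<Rightarrow> cvec cmfd"
  where "ball_mfd n = \<lparr>mtop = top_of_set (cunit_ball n), mdim = n, charts = {(cunit_ball n, \<lambda>z. z)}\<rparr>"

lemma open_cunit_ball_in_cspace: "openin (top_of_set (cspace n)) (cunit_ball n)"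
proof -
  have "continuous_on UNIV (\<lambda>z :: cvec. z i)" for i
    by (simp add: continuous_on_product_coordinates)
  then have "continuous_on UNIV (cnorm n)"
    unfolding cnorm_def L2_set_def by (intro continuous_intros)
  then have "open {z. cnorm n z < 1}"
    by (rule open_Collect_less[OF _ continuous_on_const])
  moreover have "cunit_ball n = cspace n \<inter> {z. cnorm n z < 1}"
    by (auto simp: cunit_ball_def)
  ultimately show ?thesis
    unfolding openin_open by blast
qed

lemma cholomorphic_on_cong:
  assumes "cholomorphic_on m n g S" and "\<And>z. z \<in> S \<Longrightarrow> g z = g' z"
  shows "cholomorphic_on m n g' S"
  using assms(1) unfolding cholomorphic_on_def by (simp add: assms(2))

lemma cholomorphic_on_id:
  assumes "S \<subseteq> cspace n"
  shows "cholomorphic_on n n (\<lambda>z. z) S"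
proof -
  define A :: "nat \<Rightarrow> nat \<Rightarrow> complex" where "A i j = (if i = j then 1 else 0)" for i j
  have A: "(\<Sum>j<n. A i j * x j) = x i" if "i < n" for i and x :: cvec
  proof -
    have "(\<Sum>j<n. A i j * x j) = (\<Sum>j<n. if j = i then x j else 0)"
      by (rule sum.cong) (auto simp: A_def)
    then show ?thesis
      using that by simp
  qed
  have "cnorm n (\<lambda>i. w i - z i - (\<Sum>j<n. A i j * (w j - z j))) = 0" for w z
    unfolding cnorm_def by (subst L2_set_eq_0_iff) (auto simp: A)
  moreover have "0 \<le> e * cnorm n x" if "e > 0" for e x
    using that by (simp add: cnorm_def L2_set_nonneg)
  ultimately show ?thesis
    unfolding cholomorphic_on_def using assms
    by (intro conjI ballI exI[of _ A] allI impI exI[of _ 1]) auto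
qed

lemma complex_manifold_ball_mfd: "complex_manifold (ball_mfd n)"
proof -
  have inv: "inv_into (cunit_ball n) (\<lambda>z. z) w = w" if "w \<in> cunit_ball n" for w
    using that by (metis f_inv_into_f image_ident)
  have "cholomorphic_on n n (\<lambda>z. z) (cunit_ball n)"
    by (rule cholomorphic_on_id) (auto simp: cunit_ball_def)
  then have hol: "cholomorphic_on n n ((\<lambda>z. z) \<circ> inv_into (cunit_ball n) (\<lambda>z. z)) (cunit_ball n)"
    by (rule cholomorphic_on_cong) (simp add: inv)
  obtain B :: "cvec set set" where B: "countable B" "topological_basis B"
    using ex_countable_basis by blast
  have "second_countable (euclidean :: cvec topology)"
    unfolding second_countable_def
  proof (intro exI[of _ B] conjI ballI allI impI)
    fix V assume "V \<in> B"
    then show "openin euclidean V"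
      using topological_basis_open[OF B(2)] by simp
  next
    fix U and x :: cvec assume "openin euclidean U \<and> x \<in> U"
    then have U: "open U" "x \<in> U"
      by simp_all
    show "\<exists>V\<in>B. x \<in> V \<and> V \<subseteq> U"
      by (rule topological_basisE[OF B(2) U]) (rule bexI, rule conjI)
  qed (rule B(1))
  then have sc: "second_countable (top_of_set (cunit_ball n))"
    by (rule second_countable_subtopology)
  have hd: "Hausdorff_space (top_of_set (cunit_ball n))"
    by (rule Hausdorff_space_subtopology[OF Hausdorff_space_euclidean])
  have sub: "subtopology (top_of_set (cunit_ball n)) (cunit_ball n) = top_of_set (cunit_ball n)"
    by (simp add: subtopology_subtopology)
  have hm: "homeomorphic_map (top_of_set (cunit_ball n)) (top_of_set (cunit_ball n)) (\<lambda>z. z)"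
    using homeomorphic_map_id[of "top_of_set (cunit_ball n)"] by (simp add: id_def)
  have op: "openin (top_of_set (cunit_ball n)) (cunit_ball n)"
    using openin_topspace[of "top_of_set (cunit_ball n)"] by simp
  show ?thesis
    unfolding complex_manifold_def ball_mfd_def
    using hol sc hd hm op open_cunit_ball_in_cspace[of n] by (simp add: sub)
qed


section \<open>The Kobayashi distance\<close>

definition holomorphic_disc :: "'a cmfd \<Rightarrow> (complex \<Rightarrow> 'a) \<Rightarrow> bool"
  where "holomorphic_disc M u \<longleftrightarrow>
    continuous_map (top_of_set (ball 0 1)) (mtop M) u \<and>
    (\<forall>(V, d)\<in>charts M. \<forall>i<mdim M. (\<lambda>t. d (u t) i) holomorphic_on (ball 0 1 \<inter> u -` V))"

text \<open>Normalised to curvature \<open>-4\<close>.\<close>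

definition poincare_dist :: "complex \<Rightarrow> complex \<Rightarrow> real"
  where "poincare_dist a b = artanh (cmod ((a - b) / (1 - cnj a * b)))"

fun disc_chain :: "'a cmfd \<Rightarrow> 'a \<Rightarrow> ((complex \<Rightarrow> 'a) \<times> complex \<times> complex) list \<Rightarrow> 'a \<Rightarrow> bool"
  where
    "disc_chain M x [] y \<longleftrightarrow> x \<in> mcarrier M \<and> x = y"
  | "disc_chain M x ((u, a, b) # cs) y \<longleftrightarrow>
       holomorphic_disc M u \<and> a \<in> ball 0 1 \<and> b \<in> ball 0 1 \<and> u a = x \<and> disc_chain M (u b) cs y"

text \<open>The value is \<open>\<infinity>\<close> for points in different components.\<close>

definition kobayashi :: "'a cmfd \<Rightarrow> 'a \<Rightarrow> 'a \<Rightarrow> ereal"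
  where "kobayashi M x y =
    (INF cs \<in> {cs. disc_chain M x cs y}. ereal (\<Sum>(u, a, b)\<leftarrow>cs. poincare_dist a b))"

definition kobayashi_hyperbolic :: "'a cmfd \<Rightarrow> bool"
  where "kobayashi_hyperbolic M \<longleftrightarrow>
    (\<forall>x\<in>mcarrier M. \<forall>y\<in>mcarrier M. x \<noteq> y \<longrightarrow> kobayashi M x y > 0)"

definition kobayashi_ball :: "nat \<Rightarrow> cvec \<Rightarrow> real \<Rightarrow> cvec set"
  where "kobayashi_ball q p R = {w \<in> cunit_ball q. kobayashi (ball_mfd q) w p < ereal R}"


section \<open>Semi-models and the type of a self-map of the ball\<close>

text \<open>\<open>\<phi>\<^sup>-\<^sup>n (h (B))\<close> is written as a preimage, \<open>\<phi>\<close> being bijective on the carrier only.\<close>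

definition semi_model :: "nat \<Rightarrow> (cvec \<Rightarrow> cvec) \<Rightarrow> 'a cmfd \<Rightarrow> (cvec \<Rightarrow> 'a) \<Rightarrow> ('a \<Rightarrow> 'a) \<Rightarrow> bool"
  where "semi_model q f \<Lambda> h \<phi> \<longleftrightarrow>
    complex_manifold \<Lambda> \<and> holomorphic_map (ball_mfd q) \<Lambda> h \<and> automorphism \<Lambda> \<phi> \<and>
    (\<forall>z\<in>cunit_ball q. h (f z) = \<phi> (h z)) \<and>
    (\<Union>n. {x \<in> mcarrier \<Lambda>. (\<phi> ^^ n) x \<in> h ` cunit_ball q}) = mcarrier \<Lambda>"

text \<open>
  HOL cannot quantify over types, so the competing semi-models have their points in the type
  \<open>cvec\<close>. This loses nothing: the base of a semi-model is a countable union of bijective images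
  of subsets of \<open>h ` cunit_ball q\<close>, so its cardinality is at most that of the continuum, and its
  structure can be transported along an injection into \<open>cvec\<close>.
\<close>

definition canonical_kobayashi_semi_model ::
    "nat \<Rightarrow> (cvec \<Rightarrow> cvec) \<Rightarrow> 'a cmfd \<Rightarrow> (cvec \<Rightarrow> 'a) \<Rightarrow> ('a \<Rightarrow> 'a) \<Rightarrow> bool"
  where "canonical_kobayashi_semi_model q f Z l \<tau> \<longleftrightarrow>
    semi_model q f Z l \<tau> \<and> kobayashi_hyperbolic Z \<and>
    (\<forall>(\<Lambda> :: cvec cmfd) h \<phi>. semi_model q f \<Lambda> h \<phi> \<and> kobayashi_hyperbolic \<Lambda> \<longrightarrow>
       (\<exists>\<eta>. holomorphic_map Z \<Lambda> \<eta> \<and>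
            (\<forall>z\<in>cunit_ball q. \<eta> (l z) = h z) \<and>
            (\<forall>x\<in>mcarrier Z. \<eta> (\<tau> x) = \<phi> (\<eta> x))))"

definition map_type :: "nat \<Rightarrow> (cvec \<Rightarrow> cvec) \<Rightarrow> nat"
  where "map_type q f = (THE d. \<exists>(Z :: cvec cmfd) l \<tau>.
    canonical_kobayashi_semi_model q f Z l \<tau> \<and> biholomorphic Z (ball_mfd d))"

end

theory Submission
  imports Defs "HOL-Complex_Analysis.Complex_Analysis" "HOL-Library.Function_Algebras"
begin

text \<open>
  Let \<open>\<phi>\<^sub>m\<close> be the involutive automorphism of the ball \<open>B\<close> exchanging \<open>0\<close> and \<open>f\<^sup>m(z)\<close>. By Montel's theorem
  the maps \<open>\<phi>\<^sub>m \<circ> f\<^bsup>m-j\<^esup>\<close> converge, along a subsequence of any given sequence of indices, to maps \<open>\<alpha>\<^sub>j\<close>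
  with \<open>\<alpha>\<^sub>j\<^sub>+\<^sub>1 \<circ> f = \<alpha>\<^sub>j\<close>. If \<open>\<beta>\<^sub>j\<close> are self-maps of \<open>B\<close> with \<open>\<beta>\<^sub>j\<^sub>+\<^sub>1 \<circ> f = \<beta>\<^sub>j\<close>, a limit \<open>g\<close> of \<open>\<beta>\<^sub>m \<circ> \<phi>\<^sub>m\<close> satisfies
  \<open>\<beta>\<^sub>j = g \<circ> \<alpha>\<^sub>j\<close>. Taking \<open>\<beta>\<^sub>j\<close> to be \<open>\<alpha>\<^sub>j\<close>, \<open>\<alpha>\<^sub>j \<circ> f\<close>, \<open>\<alpha>\<^sub>j\<^sub>+\<^sub>1\<close> and \<open>\<tau>\<^bsup>-j\<^esup> \<circ> l\<close> gives maps \<open>\<rho>\<close>, \<open>\<sigma>\<close>, \<open>\<sigma>'\<close> and \<open>g\<close>. By the Schwarz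
  lemma the fixed point set of \<open>\<rho>\<close> is a linear slice \<open>V \<inter> B\<close>. It is the union of the images of the
  \<open>\<alpha>\<^sub>j\<close>, and \<open>\<sigma>\<close> is an automorphism of it with inverse \<open>\<sigma>'\<close>, so \<open>(V \<inter> B, \<alpha>\<^sub>0, \<sigma>)\<close> is a hyperbolic semi-model. The
  universal property yields \<open>\<theta> : B \<rightarrow> V \<inter> B\<close> with \<open>\<theta> \<circ> \<tau>\<^bsup>-j\<^esup> \<circ> l = \<alpha>\<^sub>j\<close>, hence \<open>g \<circ> \<theta>\<close> is the identity and
  \<open>V\<close> is the whole space. Therefore \<open>\<theta> \<circ> \<tau>\<^bsup>-m\<^esup> \<circ> l \<circ> \<phi>\<^sub>m = \<alpha>\<^sub>m \<circ> \<phi>\<^sub>m\<close> converges to the identity, so that \<open>l\<close> is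
  injective on the images under \<open>\<phi>\<^sub>m\<close> of compact balls, and so is \<open>f\<close> because \<open>l \<circ> f = \<tau> \<circ> l\<close>.
\<close>

section \<open>The Hermitian space of complex sequences\<close>

text \<open>The pointwise sum of sequences comes from function algebras; a named scaling by complex
  numbers makes the abstract theory of spans, bases and dimension available for subspaces of
  \<open>cspace q\<close>.\<close>

definition cscale :: "complex \<Rightarrow> cvec \<Rightarrow> cvec"
  where "cscale c x = (\<lambda>i. c * x i)"

lemma cscale_apply [simp]: "cscale c x i = c * x i"
  by (simp add: cscale_def)

interpretation cv: vector_space cscale
  by unfold_locales (auto simp: fun_eq_iff algebra_simps)

lemma sum_cvec_apply: "(\<Sum>j\<in>J. F j) i = (\<Sum>j\<in>J. (F j :: cvec) i)"
  by (induction J rule: infinite_finite_induct) auto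

definition cinner :: "nat \<Rightarrow> cvec \<Rightarrow> cvec \<Rightarrow> complex"
  where "cinner q x y = (\<Sum>i<q. x i * cnj (y i))"

lemma cnorm_nonneg [simp]: "0 \<le> cnorm q x"
  by (simp add: cnorm_def)

lemma cnorm_zero [simp]: "cnorm q 0 = 0"
  by (simp add: cnorm_def L2_set_0')

lemma cnorm_triangle: "cnorm q (x + y) \<le> cnorm q x + cnorm q y"
proof -
  have "cnorm q (x + y) \<le> L2_set (\<lambda>i. cmod (x i) + cmod (y i)) {..<q}"
    unfolding cnorm_def by (rule L2_set_mono) (auto simp: norm_triangle_ineq)
  also have "\<dots> \<le> cnorm q x + cnorm q y"
    unfolding cnorm_def by (rule L2_set_triangle_ineq)
  finally show ?thesis .
qed

lemma cnorm_cscale [simp]: "cnorm q (cscale c x) = cmod c * cnorm q x"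
  by (simp add: cnorm_def norm_mult L2_set_right_distrib)

lemma cnorm_minus [simp]: "cnorm q (- x) = cnorm q x"
  by (simp add: cnorm_def)

lemma cnorm_minus_commute: "cnorm q (x - y) = cnorm q (y - x)"
  by (simp add: cnorm_def norm_minus_commute)

lemma cnorm_triangle_diff: "cnorm q (x - y) \<le> cnorm q x + cnorm q y"
  using cnorm_triangle[of q x "- y"] by simp

lemma cnorm_triangle_mid: "cnorm q (x - z) \<le> cnorm q (x - y) + cnorm q (y - z)"
  using cnorm_triangle[of q "x - y" "y - z"] by simp

lemma cnorm_triangle_sub: "cnorm q x \<le> cnorm q (x - y) + cnorm q y"
  using cnorm_triangle[of q "x - y" y] by simp

lemma cmod_le_cnorm: "i < q \<Longrightarrow> cmod (x i) \<le> cnorm q x"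
  unfolding cnorm_def by (rule member_le_L2_set) auto

lemma cnorm_le_sum: "cnorm q x \<le> (\<Sum>i<q. cmod (x i))"
  unfolding cnorm_def by (rule L2_set_le_sum) auto

lemma cnorm_power2: "(cnorm q x)\<^sup>2 = (\<Sum>i<q. (cmod (x i))\<^sup>2)"
  by (simp add: cnorm_def L2_set_def sum_nonneg)

lemma cnorm_eq_0_iff: "x \<in> cspace q \<Longrightarrow> cnorm q x = 0 \<longleftrightarrow> x = 0"
  unfolding cnorm_def cspace_def fun_eq_iff
  by (subst L2_set_eq_0_iff) (auto simp: not_less[symmetric])

lemma cinner_self: "cinner q x x = of_real ((cnorm q x)\<^sup>2)"
  unfolding cinner_def cnorm_power2 of_real_sum complex_norm_square ..

lemma cinner_diff_left: "cinner q (x - y) z = cinner q x z - cinner q y z"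
  by (simp add: cinner_def sum_subtractf algebra_simps)

lemma cinner_diff_right: "cinner q z (x - y) = cinner q z x - cinner q z y"
  by (simp add: cinner_def sum_subtractf algebra_simps)

lemma cinner_cscale_left [simp]: "cinner q (cscale c x) z = c * cinner q x z"
  by (simp add: cinner_def sum_distrib_left algebra_simps)

lemma cinner_cscale_right [simp]: "cinner q z (cscale c x) = cnj c * cinner q z x"
  by (simp add: cinner_def sum_distrib_left algebra_simps)

lemma cinner_commute: "cinner q y x = cnj (cinner q x y)"
  by (simp add: cinner_def mult.commute)

lemma cinner_zero [simp]: "cinner q 0 x = 0" "cinner q x 0 = 0"
  by (simp_all add: cinner_def)

lemma cinner_Cauchy_Schwarz: "cmod (cinner q x y) \<le> cnorm q x * cnorm q y"
proof -
  have "cmod (cinner q x y) \<le> (\<Sum>i<q. \<bar>cmod (x i)\<bar> * \<bar>cmod (y i)\<bar>)"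
    unfolding cinner_def by (rule order_trans[OF norm_sum]) (simp add: norm_mult)
  also have "\<dots> \<le> cnorm q x * cnorm q y"
    unfolding cnorm_def by (rule L2_set_mult_ineq)
  finally show ?thesis .
qed

lemma cnorm_power2_diff:
  "(cnorm q (x - y))\<^sup>2 = (cnorm q x)\<^sup>2 - 2 * Re (cinner q x y) + (cnorm q y)\<^sup>2"
proof -
  have "complex_of_real ((cnorm q (x - y))\<^sup>2) =
      of_real ((cnorm q x)\<^sup>2) - (cinner q x y + cnj (cinner q x y)) + of_real ((cnorm q y)\<^sup>2)"
    unfolding cinner_self[symmetric] cinner_diff_left cinner_diff_right cinner_commute[of q y x]
    by simp
  also have "\<dots> = of_real ((cnorm q x)\<^sup>2 - 2 * Re (cinner q x y) + (cnorm q y)\<^sup>2)"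
    by (simp add: complex_add_cnj)
  finally show ?thesis
    using of_real_eq_iff by blast
qed

text \<open>A norming vector, through which one-variable results are applied to vector-valued maps.
  The bound is an inequality so that \<open>v = 0\<close> can serve when the norm of
  \<open>x\<close> vanishes.\<close>

lemma exists_unit_cvec:
  obtains v where "cnorm q v \<le> 1" "cinner q x v = of_real (cnorm q x)"
proof (cases "cnorm q x = 0")
  case True
  then show ?thesis
    using that[of 0] by simp
next
  case False
  define v where "v = cscale (of_real (inverse (cnorm q x))) x"
  have "cnorm q v \<le> 1"
    using False by (simp add: v_def norm_inverse)
  moreover have "cinner q x v = of_real (cnorm q x)"
    using False by (simp add: v_def cinner_self power2_eq_square)
  ultimately show ?thesis
    using that by blast
qed

lemma subspace_cspace: "cv.subspace (cspace q)"
  by (auto simp: cv.subspace_def cspace_def)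

lemmas cspace_closed [simp] =
  cv.subspace_0[OF subspace_cspace] cv.subspace_add[OF subspace_cspace]
  cv.subspace_diff[OF subspace_cspace] cv.subspace_scale[OF subspace_cspace]

lemma cunit_ballD: "x \<in> cunit_ball q \<Longrightarrow> x \<in> cspace q" "x \<in> cunit_ball q \<Longrightarrow> cnorm q x < 1"
  by (auto simp: cunit_ball_def)

lemma zero_in_cunit_ball [simp]: "0 \<in> cunit_ball q"
  by (simp add: cunit_ball_def)

lemma continuous_on_cnorm: "continuous_on UNIV (cnorm q)"
  unfolding cnorm_def L2_set_def
  by (intro continuous_intros continuous_on_product_coordinates)

section \<open>Holomorphy along curves\<close>

text \<open>A rescaled Schwarz lemma. The unscaled one asks for a strict bound, so the rescaling is
  done with every \<open>K' > K\<close>, and \<open>K'\<close> then tends to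
  \<open>K\<close>.\<close>

lemma Schwarz_bound:
  assumes hol: "\<theta> holomorphic_on ball 0 r" and "\<theta> 0 = 0"
    and le: "\<And>t. cmod t < r \<Longrightarrow> cmod (\<theta> t) \<le> K"
    and t: "cmod t < r"
  shows "cmod (\<theta> t) \<le> K * cmod t / r"
proof -
  have r: "0 < r"
    using t by (meson norm_ge_zero order_le_less_trans)
  have K: "0 \<le> K"
    using le[OF t] norm_ge_zero order_trans by blast
  have *: "cmod (\<theta> t) \<le> K' * (cmod t / r)" if "K < K'" for K'
  proof -
    have K': "0 < K'"
      using K that by simp
    define g where "g w = \<theta> (of_real r * w) / of_real K'" for w
    have small: "cmod (of_real r * w) < r" if "cmod w < 1" for w
      using that r by (simp add: norm_mult)
    have "(\<theta> \<circ> (\<lambda>w. of_real r * w)) holomorphic_on ball 0 1"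
      using small by (intro holomorphic_on_compose_gen[OF _ hol] holomorphic_intros) auto
    then have "g holomorphic_on ball 0 1"
      unfolding g_def o_def using K' by (intro holomorphic_intros) auto
    moreover have "g 0 = 0"
      by (simp add: g_def \<open>\<theta> 0 = 0\<close>)
    moreover have "cmod (g w) < 1" if "cmod w < 1" for w
      using le[OF small[OF that]] \<open>K < K'\<close> K' by (simp add: g_def norm_divide)
    moreover have "cmod (t / of_real r) < 1"
      using t r by (simp add: norm_divide)
    ultimately have "cmod (g (t / of_real r)) \<le> cmod (t / of_real r)"
      by (rule Schwarz_Lemma)
    then show ?thesis
      using r K' by (simp add: g_def norm_divide field_simps)
  qed
  have "cmod (\<theta> t) \<le> K * (cmod t / r)"
  proof (rule field_le_epsilon)
    fix e :: real assume "e > 0"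
    \<comment> \<open>The summand \<open>1\<close> keeps the denominator positive when
      \<open>t = 0\<close>.\<close>
    define d where "d = e / (cmod t / r + 1)"
    have pos: "cmod t / r + 1 > 0"
      using r by (simp add: add_nonneg_pos)
    then have "d > 0"
      using \<open>e > 0\<close> by (simp add: d_def)
    then have "cmod (\<theta> t) \<le> (K + d) * (cmod t / r)"
      using * by simp
    also have "\<dots> = K * (cmod t / r) + d * (cmod t / r)"
      by (rule distrib_right)
    also have "d * (cmod t / r) \<le> d * (cmod t / r + 1)"
      using \<open>d > 0\<close> by (intro mult_left_mono) auto
    also have "\<dots> = e"
      using pos by (simp add: d_def)
    finally show "cmod (\<theta> t) \<le> K * (cmod t / r) + e"
      by simp
  qed
  then show ?thesis by simp
qed

text \<open>
  Holomorphy tested on holomorphic curves is stable under composition by definition, and under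
  bounded pointwise limits by the one-variable Montel theorem.
\<close>

definition curve_hol :: "nat \<Rightarrow> nat \<Rightarrow> cvec set \<Rightarrow> (cvec \<Rightarrow> cvec) \<Rightarrow> bool"
  where "curve_hol m n S F \<longleftrightarrow>
    (\<forall>U c. open U \<longrightarrow> c ` U \<subseteq> S \<longrightarrow> (\<forall>i<m. (\<lambda>t. c t i) holomorphic_on U) \<longrightarrow>
       (\<forall>i<n. (\<lambda>t. F (c t) i) holomorphic_on U))"

lemma curve_holD:
  assumes "curve_hol m n S F" "open U" "\<And>t. t \<in> U \<Longrightarrow> c t \<in> S"
    "\<And>i. i < m \<Longrightarrow> (\<lambda>t. c t i) holomorphic_on U" "i < n"
  shows "(\<lambda>t. F (c t) i) holomorphic_on U"
  using assms unfolding curve_hol_def by blast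

lemma curve_holI:
  assumes "\<And>U c i. open U \<Longrightarrow> (\<And>t. t \<in> U \<Longrightarrow> c t \<in> S) \<Longrightarrow>
     (\<And>i. i < m \<Longrightarrow> (\<lambda>t. c t i) holomorphic_on U) \<Longrightarrow> i < n \<Longrightarrow> (\<lambda>t. F (c t) i) holomorphic_on U"
  shows "curve_hol m n S F"
  using assms unfolding curve_hol_def by blast

lemma curve_hol_inner:
  assumes "curve_hol m n S F" "open U" "\<And>t. t \<in> U \<Longrightarrow> c t \<in> S"
    "\<And>i. i < m \<Longrightarrow> (\<lambda>t. c t i) holomorphic_on U"
  shows "(\<lambda>t. cinner n (F (c t)) v) holomorphic_on U"
  unfolding cinner_def
  by (intro holomorphic_intros curve_holD[OF assms(1,2)]) (use assms in auto)

lemma curve_hol_id: "curve_hol m m S (\<lambda>x. x)"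
  by (auto simp: curve_hol_def)

lemma curve_hol_comp:
  assumes F: "curve_hol m n S F" and G: "curve_hol n p T G" and sub: "F ` S \<subseteq> T"
  shows "curve_hol m p S (\<lambda>x. G (F x))"
proof (rule curve_holI)
  fix U c i
  assume U: "open U" "\<And>t. t \<in> U \<Longrightarrow> c t \<in> S" "\<And>i. i < m \<Longrightarrow> (\<lambda>t. c t i) holomorphic_on U" "i < p"
  show "(\<lambda>t. G (F (c t)) i) holomorphic_on U"
    by (rule curve_holD[OF G U(1) _ _ U(4)]) (use U sub curve_holD[OF F U(1-3)] in auto)
qed

lemma curve_hol_diff:
  assumes F: "curve_hol m n S F" and G: "curve_hol m n S G"
  shows "curve_hol m n S (\<lambda>x. F x - G x)"
  by (rule curve_holI) (auto intro!: holomorphic_intros curve_holD[OF F] curve_holD[OF G])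

text \<open>The Schwarz lemma on the complex line through \<open>a\<close> and \<open>y\<close>.\<close>

lemma curve_hol_Lipschitz:
  assumes F: "curve_hol m n S F" and a: "a \<in> cspace m" and y: "y \<in> cspace m" "cnorm m (y - a) < s"
    and bd: "\<And>x. x \<in> cspace m \<Longrightarrow> cnorm m (x - a) < s \<Longrightarrow> x \<in> S \<and> cnorm n (F x) \<le> M"
  shows "cnorm n (F y - F a) \<le> 2 * M / s * cnorm m (y - a)"
proof (cases "y = a")
  case True
  then show ?thesis by simp
next
  case False
  define d where "d = cnorm m (y - a)"
  have "d \<noteq> 0"
    using False a y cnorm_eq_0_iff[of "y - a" m] by (simp add: d_def)
  then have d: "d > 0"
    by (simp add: d_def order_less_le)
  have s: "d < s"
    using y by (simp add: d_def)
  define u where "u = cscale (of_real (1 / d)) (y - a)"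
  have u: "u \<in> cspace m" "cnorm m u = 1"
    using a y d by (auto simp: u_def d_def[symmetric] norm_divide simp del: of_real_divide)
  have ya: "y = a + cscale (of_real d) u"
    using d by (auto simp: u_def fun_eq_iff)
  obtain v where v: "cnorm n v \<le> 1" "cinner n (F y - F a) v = of_real (cnorm n (F y - F a))"
    by (rule exists_unit_cvec)
  define \<theta> where "\<theta> t = cinner n (F (a + cscale t u) - F a) v" for t
  have in_ball: "a + cscale t u \<in> S \<and> cnorm n (F (a + cscale t u)) \<le> M" if "cmod t < s" for t
    using bd[of "a + cscale t u"] a u that by simp
  have "\<theta> holomorphic_on ball 0 s"
    unfolding \<theta>_def cinner_diff_left
    by (intro holomorphic_intros curve_hol_inner[OF F]) (auto simp: in_ball intro!: holomorphic_intros)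
  moreover have "\<theta> 0 = 0"
  proof -
    have "a + cscale 0 u = a"
      by (simp add: fun_eq_iff)
    then show ?thesis
      by (simp add: \<theta>_def)
  qed
  moreover have "cmod (\<theta> t) \<le> 2 * M" if "cmod t < s" for t
  proof -
    have "cmod (\<theta> t) \<le> cnorm n (F (a + cscale t u) - F a) * cnorm n v"
      unfolding \<theta>_def by (rule cinner_Cauchy_Schwarz)
    also have "\<dots> \<le> cnorm n (F (a + cscale t u) - F a)"
      using v by (simp add: mult_left_le)
    also have "\<dots> \<le> cnorm n (F (a + cscale t u)) + cnorm n (F a)"
      by (rule cnorm_triangle_diff)
    also have "\<dots> \<le> 2 * M"
      using in_ball[OF that] bd[of a] a d s by simp
    finally show ?thesis .
  qed
  moreover have "cmod (of_real d) < s"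
    using d s by simp
  ultimately have "cmod (\<theta> (of_real d)) \<le> 2 * M * cmod (of_real d) / s"
    by (rule Schwarz_bound)
  then show ?thesis
    using d v(2) unfolding \<theta>_def ya[symmetric] by (simp add: d_def[symmetric])
qed

section \<open>Holomorphy along curves versus complex Frechet differentiability\<close>

definition frechet_at :: "nat \<Rightarrow> nat \<Rightarrow> (cvec \<Rightarrow> cvec) \<Rightarrow> cvec set \<Rightarrow> cvec \<Rightarrow> (nat \<Rightarrow> nat \<Rightarrow> complex) \<Rightarrow> bool"
  where "frechet_at m n g S z A \<longleftrightarrow> (\<forall>e>0. \<exists>d>0. \<forall>w\<in>S. cnorm m (w - z) < d \<longrightarrow>
       cnorm n (\<lambda>i. g w i - g z i - (\<Sum>j<m. A i j * (w j - z j))) \<le> e * cnorm m (w - z))"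

lemma cholomorphic_on_frechet:
  "cholomorphic_on m n g S \<longleftrightarrow> g ` S \<subseteq> cspace n \<and> (\<forall>z\<in>S. \<exists>A. frechet_at m n g S z A)"
  unfolding cholomorphic_on_def frechet_at_def fun_diff_def ..

text \<open>Chain rule: the difference quotient splits into a linear part and a remainder
  \<open>R\<close>, and the remainder disappears because the difference quotients of
  \<open>c\<close> stay bounded.\<close>

lemma frechet_curve_derivative:
  assumes fr: "frechet_at m n F S (c t0) A" and U: "open U" "t0 \<in> U" "\<And>t. t \<in> U \<Longrightarrow> c t \<in> S"
    and c': "\<And>j. j < m \<Longrightarrow> ((\<lambda>t. c t j) has_field_derivative c' j) (at t0)" and i: "i < n"
  shows "((\<lambda>t. F (c t) i) has_field_derivative (\<Sum>j<m. A i j * c' j)) (at t0)"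
proof -
  define R where "R t = F (c t) i - F (c t0) i - (\<Sum>j<m. A i j * (c t j - c t0 j))" for t
  have quot: "((\<lambda>t. (c t j - c t0 j) / (t - t0)) \<longlongrightarrow> c' j) (at t0)" if "j < m" for j
    using c'[OF that] by (simp add: has_field_derivative_iff)
  have cont: "((\<lambda>t. c t j - c t0 j) \<longlongrightarrow> 0) (at t0)" if "j < m" for j
    using DERIV_isCont[OF c'[OF that]] by (simp add: isCont_def LIM_zero)
  have main: "((\<lambda>t. \<Sum>j<m. A i j * ((c t j - c t0 j) / (t - t0))) \<longlongrightarrow> (\<Sum>j<m. A i j * c' j)) (at t0)"
    by (intro tendsto_intros quot) simp
  have sum0: "((\<lambda>t. \<Sum>j<m. cmod (c t j - c t0 j)) \<longlongrightarrow> 0) (at t0)"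
    by (rule tendsto_null_sum) (use cont in \<open>auto intro: tendsto_norm_zero\<close>)
  define K where "K = (\<Sum>j<m. cmod (c' j))"
  have K: "K \<ge> 0"
    by (simp add: K_def sum_nonneg)
  have sumK: "((\<lambda>t. \<Sum>j<m. cmod ((c t j - c t0 j) / (t - t0))) \<longlongrightarrow> K) (at t0)"
    unfolding K_def by (intro tendsto_intros quot) simp
  have rem: "((\<lambda>t. R t / (t - t0)) \<longlongrightarrow> 0) (at t0)"
  proof (rule tendstoI)
    fix e :: real assume "e > 0"
    \<comment> \<open>Near \<open>t0\<close> the quotients of the curve sum to less than
      \<open>K + 1\<close>, so the remainder quotient stays below \<open>e / 2\<close>.\<close>
    define e' where "e' = e / (2 * (K + 1))"
    have "e' > 0"
      using \<open>e > 0\<close> K by (simp add: e'_def)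
    then obtain d where d: "d > 0" and dR: "\<And>w. w \<in> S \<Longrightarrow> cnorm m (w - c t0) < d \<Longrightarrow>
       cnorm n (\<lambda>i. F w i - F (c t0) i - (\<Sum>j<m. A i j * (w j - c t0 j))) \<le> e' * cnorm m (w - c t0)"
      using fr unfolding frechet_at_def by blast
    have "eventually (\<lambda>t. (\<Sum>j<m. cmod (c t j - c t0 j)) < d) (at t0)"
      using order_tendstoD(2)[OF sum0 d] .
    moreover have "eventually (\<lambda>t. (\<Sum>j<m. cmod ((c t j - c t0 j) / (t - t0))) < K + 1) (at t0)"
      by (rule order_tendstoD(2)[OF sumK]) simp
    moreover have "eventually (\<lambda>t. t \<in> U) (at t0)"
      using U(1,2) by (rule eventually_at_in_open')
    moreover have "eventually (\<lambda>t. t \<noteq> t0) (at t0)"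
      by (simp add: eventually_at_filter)
    ultimately show "eventually (\<lambda>t. dist (R t / (t - t0)) 0 < e) (at t0)"
    proof eventually_elim
      case (elim t)
      have le: "cnorm m (c t - c t0) \<le> (\<Sum>j<m. cmod (c t j - c t0 j))"
        using cnorm_le_sum[of m "c t - c t0"] by simp
      have "cmod (R t) \<le> cnorm n (\<lambda>i. F (c t) i - F (c t0) i - (\<Sum>j<m. A i j * (c t j - c t0 j)))"
        unfolding R_def by (rule cmod_le_cnorm[OF i])
      also have "\<dots> \<le> e' * cnorm m (c t - c t0)"
        by (rule dR) (use elim U le in auto)
      also have "\<dots> \<le> e' * (\<Sum>j<m. cmod (c t j - c t0 j))"
        using le \<open>e' > 0\<close> by simp
      finally have "cmod (R t) / cmod (t - t0) \<le> e' * (\<Sum>j<m. cmod (c t j - c t0 j)) / cmod (t - t0)"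
        by (simp add: divide_right_mono)
      also have "\<dots> = e' * (\<Sum>j<m. cmod ((c t j - c t0 j) / (t - t0)))"
          by (simp add: norm_divide sum_divide_distrib[symmetric])
      also have "\<dots> \<le> e' * (K + 1)"
        using elim(2) \<open>e' > 0\<close> by simp
      also have "\<dots> < e"
        using \<open>e > 0\<close> K by (simp add: e'_def field_simps add_pos_nonneg)
      finally show ?case
        by (simp add: norm_divide)
    qed
  qed
  have "((\<lambda>t. (\<Sum>j<m. A i j * ((c t j - c t0 j) / (t - t0))) + R t / (t - t0)) \<longlongrightarrow> (\<Sum>j<m. A i j * c' j) + 0) (at t0)"
    by (intro tendsto_intros main rem)
  moreover have "(\<Sum>j<m. A i j * ((c t j - c t0 j) / (t - t0))) + R t / (t - t0) =
      (F (c t) i - F (c t0) i) / (t - t0)" for t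
    by (simp add: R_def sum_divide_distrib diff_divide_distrib[of _ "sum _ _"])
  ultimately show ?thesis
    by (simp add: has_field_derivative_iff)
qed

lemma cholomorphic_on_imp_curve_hol:
  assumes "cholomorphic_on m n F S"
  shows "curve_hol m n S F"
proof (rule curve_holI)
  fix U c i
  assume U: "open U" "\<And>t. t \<in> U \<Longrightarrow> c t \<in> S" "\<And>i. i < m \<Longrightarrow> (\<lambda>t. c t i) holomorphic_on U" "i < n"
  show "(\<lambda>t. F (c t) i) holomorphic_on U"
    unfolding holomorphic_on_open[OF U(1)]
  proof
    fix t0 assume t0: "t0 \<in> U"
    obtain A where A: "frechet_at m n F S (c t0) A"
      using assms U(2)[OF t0] unfolding cholomorphic_on_frechet by blast
    have "((\<lambda>t. c t j) has_field_derivative deriv (\<lambda>t. c t j) t0) (at t0)" if "j < m" for j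
      using U(3)[OF that] U(1) t0 by (rule holomorphic_derivI)
    from frechet_curve_derivative[OF A U(1) t0 U(2) this U(4)]
    show "\<exists>f'. ((\<lambda>t. F (c t) i) has_field_derivative f') (at t0)"
      by blast
  qed
qed

definition cunit :: "nat \<Rightarrow> cvec"
  where "cunit j = (\<lambda>i. if i = j then 1 else 0)"

lemma cunit_in_cspace: "j < m \<Longrightarrow> cunit j \<in> cspace m"
  by (auto simp: cunit_def cspace_def)

lemma cnorm_cunit: "j < m \<Longrightarrow> cnorm m (cunit j) = 1"
proof -
  assume "j < m"
  then have "(cnorm m (cunit j))\<^sup>2 = 1"
    unfolding cnorm_power2 cunit_def by (simp add: if_distrib[of cmod] if_distrib[of "\<lambda>x. x\<^sup>2"] cong: if_cong)
  then show ?thesis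
    by (simp add: power2_eq_1_iff) (metis cnorm_nonneg neg_0_le_iff_le not_one_le_zero)
qed

text \<open>
  The increment along \<open>x\<close> is split into increments along the coordinate axes; the partial
  derivatives at the intermediate points are compared with those at \<open>a\<close> by the Schwarz lemma.
\<close>

lemma curve_hol_frechet_component:
  assumes F: "curve_hol m n S F" and a: "a \<in> cspace m" and i: "i < n" and s: "s > 0"
    and bd: "\<And>x. x \<in> cspace m \<Longrightarrow> cnorm m (x - a) < s \<Longrightarrow> x \<in> S \<and> cnorm n (F x) \<le> M"
    and e: "e > 0"
  defines "D \<equiv> \<lambda>k. deriv (\<lambda>t. F (a + cscale t (cunit k)) i) 0"
  shows "\<exists>d>0. \<forall>x\<in>cspace m. cnorm m x < d \<longrightarrow>
    cmod (F (a + x) i - F a i - (\<Sum>k<m. D k * x k)) \<le> e * cnorm m x"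
proof -
  \<comment> \<open>This is the Lipschitz constant \<open>2 * M / (s/2)\<close>, valid on balls of
    radius \<open>s/2\<close> about points within \<open>s/2\<close> of \<open>a\<close>.\<close>
  define L where "L = 4 * M / s"
  have M: "0 \<le> M"
    using bd[OF a] s order_trans[OF cnorm_nonneg] by auto
  have L: "0 \<le> L"
    using M s by (simp add: L_def)
  have Lip: "cmod (F y i - F b i) \<le> L * cnorm m (y - b)"
    if b: "b \<in> cspace m" "cnorm m (b - a) < s/2" and y: "y \<in> cspace m" "cnorm m (y - b) < s/2" for b y
  proof -
    have "cnorm n (F y - F b) \<le> 2 * M / (s/2) * cnorm m (y - b)"
    proof (rule curve_hol_Lipschitz[OF F b(1) y])
      fix x assume x: "x \<in> cspace m" "cnorm m (x - b) < s / 2"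
      have "cnorm m (x - a) < s"
        using cnorm_triangle_mid[of m x a b] b x by simp
      then show "x \<in> S \<and> cnorm n (F x) \<le> M"
        using bd x by simp
    qed
    then show ?thesis
      using cmod_le_cnorm[OF i, of "F y - F b"] by (simp add: L_def)
  qed
  have slice: "(\<lambda>t. F (b + cscale t (cunit k)) i) holomorphic_on ball 0 (s/2)"
    if b: "b \<in> cspace m" "cnorm m (b - a) < s/2" and k: "k < m" for b k
  proof (rule curve_holD[OF F _ _ _ i])
    fix t :: complex assume "t \<in> ball 0 (s/2)"
    then have "cnorm m (b + cscale t (cunit k) - a) < s"
      using cnorm_triangle[of m "b - a" "cscale t (cunit k)"] b k
      by (simp add: cnorm_cunit algebra_simps)
    then show "b + cscale t (cunit k) \<in> S"
      using bd b k by (simp add: cunit_in_cspace)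
  qed (auto intro!: holomorphic_intros)
  have "\<exists>d>0. \<forall>t. cmod t < d \<longrightarrow> cmod (F (a + cscale t (cunit k)) i - F a i - t * D k) \<le> e / (2 * (real m + 1)) * cmod t"
    if k: "k < m" for k
  proof -
    have "((\<lambda>t. F (a + cscale t (cunit k)) i) has_field_derivative D k) (at 0)"
      unfolding D_def by (rule holomorphic_derivI[OF slice[OF a _ k]]) (use s in auto)
    then have "((\<lambda>t. F (a + cscale t (cunit k)) i) has_derivative (\<lambda>t. t * D k)) (at 0)"
      by (simp add: has_field_derivative_def mult.commute[of _ "D k"])
    moreover have "e / (2 * (real m + 1)) > 0"
      using e by simp
    moreover have "a + cscale 0 (cunit k) = a"
      by (simp add: fun_eq_iff)
    ultimately show ?thesis
      unfolding has_derivative_at_alt by (metis diff_zero)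
  qed
  then obtain \<delta> where \<delta>: "\<And>k. k < m \<Longrightarrow> \<delta> k > 0"
    "\<And>k t. k < m \<Longrightarrow> cmod t < \<delta> k \<Longrightarrow>
       cmod (F (a + cscale t (cunit k)) i - F a i - t * D k) \<le> e / (2 * (real m + 1)) * cmod t"
    by metis
  \<comment> \<open>\<open>m\<close> steps produce a quadratic error of at most
    \<open>K * N * N\<close>, where \<open>N\<close> is the norm of the increment; it is at most
    \<open>e / 2 * N\<close> once \<open>N\<close> is below \<open>e / (2 * K)\<close>.\<close>
  define K where "K = (real m + 1) * (8 * L / s) + 1"
  have K: "K > 0"
    using L s by (simp add: K_def add_nonneg_pos)
  define d where "d = Min (insert (s/4) (insert (e / (2 * K)) (\<delta> ` {..<m})))"
  have d: "d > 0" "d \<le> s/4" "d \<le> e / (2 * K)" "\<And>k. k < m \<Longrightarrow> d \<le> \<delta> k"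
    unfolding d_def using \<delta>(1) s e K
    by (subst Min_gr_iff; force) (rule Min_le; force)+
  show ?thesis
  proof (intro exI[of _ d] conjI ballI impI d(1))
    fix x assume x: "x \<in> cspace m" "cnorm m x < d"
    define N where "N = cnorm m x"
    have N: "0 \<le> N" "N < d"
      using x by (auto simp: N_def)
    define X where "X k = (\<lambda>j. if j < k then x j else 0)" for k
    have XS: "X k \<in> cspace m" for k
      using x by (auto simp: X_def cspace_def)
    have XN: "cnorm m (X k) \<le> N" for k
      unfolding N_def cnorm_def by (rule L2_set_mono) (auto simp: X_def)
    have step: "cmod (F (a + X (Suc k)) i - F (a + X k) i - x k * D k)
        \<le> 8 * L / s * N * N + e / (2 * (real m + 1)) * N" if k: "k < m" for k
    proof -
      define b where "b = a + X k"
      have b: "b \<in> cspace m" "cnorm m (b - a) \<le> N" "cnorm m (b - a) < s/2"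
        using a XS XN[of k] N d(2) s by (auto simp: b_def)
      \<comment> \<open>\<open>\<theta>\<close> compares the increments in direction
        \<open>k\<close> from \<open>b\<close> and from \<open>a\<close>. Its bound
        \<open>2 * L * N\<close> already contains one factor \<open>N\<close>; the Schwarz lemma on
        the disc of radius \<open>s/4\<close> supplies a second one.\<close>
      define \<theta> where "\<theta> t = (F (b + cscale t (cunit k)) i - F b i) - (F (a + cscale t (cunit k)) i - F a i)" for t
      have xk: "cmod (x k) \<le> N"
        unfolding N_def by (rule cmod_le_cnorm[OF k])
      have "\<theta> holomorphic_on ball 0 (s/4)"
        unfolding \<theta>_def using slice[OF b(1,3) k] slice[OF a _ k] s
        by (intro holomorphic_intros) (auto elim!: holomorphic_on_subset)
      moreover have "\<theta> 0 = 0"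
      proof -
        have "y + cscale 0 (cunit k) = y" for y
          by (simp add: fun_eq_iff)
        then show ?thesis
          by (simp add: \<theta>_def)
      qed
      moreover have "cmod (\<theta> t) \<le> 2 * L * N" if "cmod t < s/4" for t
      proof -
        have eq: "b + cscale t (cunit k) - (a + cscale t (cunit k)) = b - a"
          by (simp add: algebra_simps)
        have "cmod (F (b + cscale t (cunit k)) i - F (a + cscale t (cunit k)) i) \<le> L * cnorm m (b - a)"
          using Lip[of "a + cscale t (cunit k)" "b + cscale t (cunit k)"] a b k that s
          by (simp add: cunit_in_cspace cnorm_cunit eq)
        moreover have "cmod (F b i - F a i) \<le> L * cnorm m (b - a)"
          using Lip[of a b] a b s by simp
        moreover have "L * cnorm m (b - a) \<le> L * N"
          using b L by (simp add: mult_left_mono)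
        moreover have "cmod (\<theta> t) \<le> cmod (F (b + cscale t (cunit k)) i - F (a + cscale t (cunit k)) i) + cmod (F b i - F a i)"
          using norm_triangle_ineq4[of "F (b + cscale t (cunit k)) i - F (a + cscale t (cunit k)) i" "F b i - F a i"]
          by (simp add: \<theta>_def algebra_simps)
        ultimately show ?thesis
          by simp
      qed
      moreover have "cmod (x k) < s/4"
        using xk N d(2) by simp
      ultimately have "cmod (\<theta> (x k)) \<le> 2 * L * N * cmod (x k) / (s/4)"
        by (rule Schwarz_bound)
      also have "\<dots> \<le> 2 * L * N * N / (s/4)"
        using xk L N s by (intro divide_right_mono mult_left_mono) auto
      finally have 1: "cmod (\<theta> (x k)) \<le> 8 * L / s * N * N"
        by (simp add: mult_ac)
      have "cmod (F (a + cscale (x k) (cunit k)) i - F a i - x k * D k) \<le> e / (2 * (real m + 1)) * cmod (x k)"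
        using \<delta>(2)[OF k] xk N d(4)[OF k] by simp
      also have "\<dots> \<le> e / (2 * (real m + 1)) * N"
        using xk e by (intro mult_left_mono) auto
      finally have 2: "cmod (F (a + cscale (x k) (cunit k)) i - F a i - x k * D k) \<le> e / (2 * (real m + 1)) * N" .
      have "X (Suc k) = X k + cscale (x k) (cunit k)"
        by (auto simp: X_def cunit_def fun_eq_iff less_Suc_eq)
      then have bX: "a + X (Suc k) = b + cscale (x k) (cunit k)"
        by (simp add: b_def add.assoc)
      have "F (a + X (Suc k)) i - F (a + X k) i - x k * D k =
         \<theta> (x k) + (F (a + cscale (x k) (cunit k)) i - F a i - x k * D k)"
        unfolding \<theta>_def bX b_def[symmetric] by simp
      then show ?thesis
        using 1 2 norm_triangle_mono by metis
    qed
    define G where "G k = F (a + X k) i" for k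
    have "cmod (G k - F a i - (\<Sum>j<k. D j * x j)) \<le> real k * (8 * L / s * N * N + e / (2 * (real m + 1)) * N)"
      if "k \<le> m" for k :: nat
      using that
    proof (induction k)
      case 0
      have "a + X 0 = a"
        by (simp add: X_def fun_eq_iff)
      then show ?case by (simp add: G_def)
    next
      case (Suc k)
      have "cmod ((G k - F a i - (\<Sum>j<k. D j * x j)) + (G (Suc k) - G k - x k * D k))
        \<le> real k * (8 * L / s * N * N + e / (2 * (real m + 1)) * N) + (8 * L / s * N * N + e / (2 * (real m + 1)) * N)"
        by (rule norm_triangle_mono[OF Suc.IH step[folded G_def]]) (use Suc.prems in auto)
      moreover have "real k * c + c = real (Suc k) * c" for c
        by (simp add: distrib_right)
      moreover have "(G k - F a i - (\<Sum>j<k. D j * x j)) + (G (Suc k) - G k - x k * D k)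
          = G (Suc k) - F a i - (\<Sum>j<Suc k. D j * x j)"
        by simp
      ultimately show ?case
        by metis
    qed
    from this[of m] have "cmod (G m - F a i - (\<Sum>j<m. D j * x j)) \<le> real m * (8 * L / s * N * N + e / (2 * (real m + 1)) * N)"
      by simp
    also have "\<dots> = (real m * (8 * L / s) * N) * N + real m * (e / (2 * (real m + 1))) * N"
      by (simp add: algebra_simps)
    also have "\<dots> \<le> (e / 2) * N + (e / 2) * N"
    proof (intro add_mono mult_right_mono N(1))
      have "real m * (8 * L / s) \<le> K"
        using L s mult_right_mono[of "real m" "real m + 1" "8 * L / s"] unfolding K_def by simp
      then have "real m * (8 * L / s) * N \<le> K * N"
        using N by (intro mult_right_mono) auto
      also have "\<dots> \<le> K * (e / (2 * K))"
        using N d(3) K by (intro mult_left_mono) auto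
      finally show "real m * (8 * L / s) * N \<le> e / 2"
        using K by simp
      show "real m * (e / (2 * (real m + 1))) \<le> e / 2"
        using e by (simp add: field_simps)
    qed
    also have "\<dots> = e * N"
      by simp
    also have "G m = F (a + x) i"
    proof -
      have "X m = x"
        using x by (auto simp: X_def cspace_def fun_eq_iff)
      then show ?thesis
        by (simp add: G_def)
    qed
    finally show "cmod (F (a + x) i - F a i - (\<Sum>k<m. D k * x k)) \<le> e * cnorm m x"
      by (simp add: N_def)
  qed
qed

text \<open>Local boundedness makes the Schwarz estimates uniform, so that the partial derivatives
  assemble to a Frechet derivative. The hypothesis \<open>bd\<close> also expresses that
  \<open>S\<close> is open in \<open>cspace m\<close>.\<close>

lemma curve_hol_imp_cholomorphic_on:
  assumes F: "curve_hol m n S F" and S: "S \<subseteq> cspace m" and Fn: "F ` S \<subseteq> cspace n"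
    and bd: "\<And>a. a \<in> S \<Longrightarrow> \<exists>s>0. \<exists>M. \<forall>x\<in>cspace m. cnorm m (x - a) < s \<longrightarrow> x \<in> S \<and> cnorm n (F x) \<le> M"
  shows "cholomorphic_on m n F S"
  unfolding cholomorphic_on_frechet
proof (intro conjI ballI Fn)
  fix a assume a: "a \<in> S"
  obtain s M where s: "s > 0" and M: "\<And>x. x \<in> cspace m \<Longrightarrow> cnorm m (x - a) < s \<Longrightarrow> x \<in> S \<and> cnorm n (F x) \<le> M"
    using bd[OF a] by blast
  have am: "a \<in> cspace m"
    using a S by blast
  define A where "A i k = deriv (\<lambda>t. F (a + cscale t (cunit k)) i) 0" for i k
  have "frechet_at m n F S a A"
    unfolding frechet_at_def
  proof (intro allI impI)
    fix e :: real assume e: "e > 0"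
    \<comment> \<open>The errors of the \<open>n\<close> components are summed;
      \<open>real n + 1\<close> is nonzero also for \<open>n = 0\<close>.\<close>
    have "e / (real n + 1) > 0"
      using e by simp
    from curve_hol_frechet_component[OF F am _ s M this]
    have "\<exists>d>0. \<forall>x\<in>cspace m. cnorm m x < d \<longrightarrow>
      cmod (F (a + x) i - F a i - (\<Sum>k<m. A i k * x k)) \<le> e / (real n + 1) * cnorm m x" if "i < n" for i
      using that unfolding A_def by blast
    then obtain \<delta> where \<delta>: "\<And>i. i < n \<Longrightarrow> \<delta> i > 0"
      "\<And>i x. i < n \<Longrightarrow> x \<in> cspace m \<Longrightarrow> cnorm m x < \<delta> i \<Longrightarrow>
        cmod (F (a + x) i - F a i - (\<Sum>k<m. A i k * x k)) \<le> e / (real n + 1) * cnorm m x"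
      by metis
    define d where "d = Min (insert 1 (\<delta> ` {..<n}))"
    have d: "d > 0" "\<And>i. i < n \<Longrightarrow> d \<le> \<delta> i"
      using \<delta>(1) by (auto simp: d_def intro!: Min_le simp del: Min_insert)
    show "\<exists>d>0. \<forall>w\<in>S. cnorm m (w - a) < d \<longrightarrow>
       cnorm n (\<lambda>i. F w i - F a i - (\<Sum>j<m. A i j * (w j - a j))) \<le> e * cnorm m (w - a)"
    proof (intro exI[of _ d] conjI ballI impI d(1))
      fix w assume w: "w \<in> S" "cnorm m (w - a) < d"
      have "w - a \<in> cspace m"
        using w S am by auto
      then have "cmod (F w i - F a i - (\<Sum>j<m. A i j * (w j - a j))) \<le> e / (real n + 1) * cnorm m (w - a)" if "i < n" for i
        using \<delta>(2)[OF that, of "w - a"] d(2)[OF that] w by simp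
      then have "(\<Sum>i<n. cmod (F w i - F a i - (\<Sum>j<m. A i j * (w j - a j)))) \<le> (\<Sum>i<n. e / (real n + 1) * cnorm m (w - a))"
        by (intro sum_mono) auto
      also have "\<dots> = real n / (real n + 1) * (e * cnorm m (w - a))"
        by simp
      also have "\<dots> \<le> 1 * (e * cnorm m (w - a))"
        using e by (intro mult_right_mono) auto
      finally show "cnorm n (\<lambda>i. F w i - F a i - (\<Sum>j<m. A i j * (w j - a j))) \<le> e * cnorm m (w - a)"
        using order_trans[OF cnorm_le_sum] by simp
    qed
  qed
  then show "\<exists>A. frechet_at m n F S a A"
    by (intro exI[of _ "A :: nat \<Rightarrow> nat \<Rightarrow> complex"])
qed

section \<open>Self-maps of the ball\<close>

text \<open>Testing holomorphy along curves makes compositions and limits easy to handle;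
  \<open>ball_map_imp_cholomorphic_on\<close> leads back to Frechet differentiability.\<close>

definition ball_map :: "nat \<Rightarrow> (cvec \<Rightarrow> cvec) \<Rightarrow> bool"
  where "ball_map q F \<longleftrightarrow> F ` cunit_ball q \<subseteq> cunit_ball q \<and> curve_hol q q (cunit_ball q) F"

lemma ball_mapD: "ball_map q F \<Longrightarrow> x \<in> cunit_ball q \<Longrightarrow> F x \<in> cunit_ball q"
  by (auto simp: ball_map_def)

lemma ball_map_id: "ball_map q (\<lambda>x. x)"
  by (simp add: ball_map_def curve_hol_id)

lemma ball_map_comp: "ball_map q F \<Longrightarrow> ball_map q G \<Longrightarrow> ball_map q (\<lambda>x. G (F x))"
  unfolding ball_map_def by (auto intro: curve_hol_comp)

lemma ball_map_funpow: "ball_map q F \<Longrightarrow> ball_map q (F ^^ n)"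
proof (induction n)
  case 0
  then show ?case by (simp add: ball_map_id[unfolded] id_def)
next
  case (Suc n)
  then show ?case
    using ball_map_comp[of q "F ^^ n" F] by (simp add: o_def)
qed

text \<open>The standard involution \<open>(p - P z - s * Q z) / (1 - w)\<close>, with
  \<open>P\<close> the orthogonal projection onto the line of \<open>p\<close> and \<open>Q\<close>
  its complement. Since the squared norm of \<open>p\<close> is \<open>(1 - s) * (1 + s)\<close>,
  the combination \<open>(1 - s) * P z\<close> equals \<open>w / (1 + s)\<close> times
  \<open>p\<close>; this form also makes sense for \<open>p = 0\<close>.\<close>

definition ball_mob :: "nat \<Rightarrow> cvec \<Rightarrow> cvec \<Rightarrow> cvec"
  where "ball_mob q p z =
    (let s = complex_of_real (sqrt (1 - (cnorm q p)\<^sup>2)); w = cinner q z p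
     in cscale (inverse (1 - w)) (cscale (1 - w / (1 + s)) p - cscale s z))"

context
  fixes q :: nat and p :: cvec and s :: real
  assumes p: "p \<in> cunit_ball q"
  defines "s \<equiv> sqrt (1 - (cnorm q p)\<^sup>2)"
begin

lemma mob_s: "0 < s" "(cnorm q p)\<^sup>2 = 1 - s\<^sup>2" "1 + complex_of_real s \<noteq> 0"
proof -
  have "(cnorm q p)\<^sup>2 < 1"
    using cunit_ballD(2)[OF p] by (simp add: power_less_one_iff abs_square_less_1)
  then show s: "0 < s" and "(cnorm q p)\<^sup>2 = 1 - s\<^sup>2"
    by (auto simp: s_def)
  have "1 + complex_of_real s = of_real (1 + s)"
    by simp
  then show "1 + complex_of_real s \<noteq> 0"
    using s by (simp only: of_real_eq_0_iff)
qed

lemma mob_w: "z \<in> cunit_ball q \<Longrightarrow> 1 - cinner q z p \<noteq> 0"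
proof
  assume z: "z \<in> cunit_ball q" and "1 - cinner q z p = 0"
  then have "1 \<le> cnorm q z * cnorm q p"
    using cinner_Cauchy_Schwarz[of q z p] by simp
  moreover have "cnorm q z * cnorm q p \<le> cnorm q z"
    using cunit_ballD[OF p] by (simp add: mult_left_le)
  ultimately show False
    using cunit_ballD[OF z] by simp
qed

lemma ball_mob_eq: "ball_mob q p z = cscale (inverse (1 - cinner q z p))
    (cscale (1 - cinner q z p / (1 + of_real s)) p - cscale (of_real s) z)"
  by (simp add: ball_mob_def s_def Let_def)

text \<open>Expanding the norm of the numerator leaves a polynomial identity in \<open>s\<close>,
  \<open>k\<close> and the real and imaginary parts of \<open>w\<close>, where
  \<open>k * (1 + s) = 1\<close> replaces the division. The formula shows that the ball is
  preserved.\<close>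

lemma cnorm_ball_mob:
  assumes z: "z \<in> cunit_ball q"
  shows "(cnorm q (ball_mob q p z))\<^sup>2 = 1 - s\<^sup>2 * (1 - (cnorm q z)\<^sup>2) / (cmod (1 - cinner q z p))\<^sup>2"
proof -
  define w where "w = cinner q z p"
  have w: "1 - w \<noteq> 0"
    using mob_w[OF z] by (simp add: w_def)
  have pz: "cinner q p z = cnj w"
    by (simp add: w_def cinner_commute[of q p z])
  define c where "c = 1 - w / (1 + of_real s)"
  define k where "k = 1 / (1 + s)"
  have k: "k * (1 + s) = 1"
    using mob_s(1) by (simp add: k_def)
  have "c = 1 - w * of_real k"
    by (simp add: c_def k_def)
  then have c: "Re c = 1 - Re w * k" "Im c = - (Im w * k)"
    by simp_all
  have "(cnorm q (cscale c p - cscale (of_real s) z))\<^sup>2 =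
      (cmod c)\<^sup>2 * (1 - s\<^sup>2) - 2 * Re (c * (s * cnj w)) + s\<^sup>2 * (cnorm q z)\<^sup>2"
    unfolding cnorm_power2_diff by (simp add: power_mult_distrib mob_s(2) pz mult_ac)
  also have "\<dots> = (cmod (1 - w))\<^sup>2 - s\<^sup>2 * (1 - (cnorm q z)\<^sup>2)"
  proof -
    have "(cmod c)\<^sup>2 * (1 - s\<^sup>2) - 2 * Re (c * (s * cnj w)) = (cmod (1 - w))\<^sup>2 - s\<^sup>2"
    proof -
      have "((1 - x * k)\<^sup>2 + (- (y * k))\<^sup>2) * (1 - s\<^sup>2) - 2 * ((1 - x * k) * (s * x) + y * k * (s * - y))
          = (1 - x)\<^sup>2 + (- y)\<^sup>2 - s\<^sup>2" for x y
        using k by algebra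
      from this[of "Re w" "Im w"] show ?thesis
        unfolding cmod_power2 by (simp add: c algebra_simps)
    qed
    then show ?thesis
      by (simp add: algebra_simps)
  qed
  finally show ?thesis
  proof -
    assume *: "(cnorm q (cscale c p - cscale (of_real s) z))\<^sup>2 = (cmod (1 - w))\<^sup>2 - s\<^sup>2 * (1 - (cnorm q z)\<^sup>2)"
    have "(cnorm q (ball_mob q p z))\<^sup>2 = (cnorm q (cscale c p - cscale (of_real s) z))\<^sup>2 / (cmod (1 - w))\<^sup>2"
      unfolding ball_mob_eq w_def[symmetric] c_def[symmetric] cnorm_cscale
      by (simp add: power_mult_distrib norm_inverse power_inverse divide_inverse mult.commute)
    also have "\<dots> = 1 - s\<^sup>2 * (1 - (cnorm q z)\<^sup>2) / (cmod (1 - w))\<^sup>2"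
      unfolding * using w by (simp add: diff_divide_distrib)
    finally show ?thesis
      by (simp add: w_def)
  qed

qed

lemma ball_mob_in_ball: "z \<in> cunit_ball q \<Longrightarrow> ball_mob q p z \<in> cunit_ball q"
proof -
  assume z: "z \<in> cunit_ball q"
  have "ball_mob q p z \<in> cspace q"
    using cunit_ballD[OF z] cunit_ballD[OF p] by (simp add: ball_mob_eq)
  moreover have "(cnorm q z)\<^sup>2 < 1"
    using cunit_ballD(2)[OF z] by (simp add: abs_square_less_1)
  then have "s\<^sup>2 * (1 - (cnorm q z)\<^sup>2) / (cmod (1 - cinner q z p))\<^sup>2 > 0"
    using mob_s(1) mob_w[OF z] by (intro divide_pos_pos mult_pos_pos) auto
  then have "(cnorm q (ball_mob q p z))\<^sup>2 < 1"
    unfolding cnorm_ball_mob[OF z] by linarith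
  ultimately show ?thesis
    by (simp add: cunit_ball_def abs_square_less_1)
qed

text \<open>The inner product with \<open>p\<close> transforms by a one-variable rule:
  \<open>1 - w'\<close> equals \<open>\<sigma>\<^sup>2 / (1 - w)\<close>. Inserting this reduces the
  claim to a scalar identity in each coordinate.\<close>

lemma ball_mob_involution: "z \<in> cunit_ball q \<Longrightarrow> ball_mob q p (ball_mob q p z) = z"
proof -
  assume z: "z \<in> cunit_ball q"
  define w where "w = cinner q z p"
  define \<sigma> where "\<sigma> = complex_of_real s"
  have w: "1 - w \<noteq> 0"
    using mob_w[OF z] by (simp add: w_def)
  have \<sigma>: "\<sigma> \<noteq> 0" "1 + \<sigma> \<noteq> 0"
    using mob_s by (auto simp: \<sigma>_def)
  have pp: "cinner q p p = 1 - \<sigma>\<^sup>2"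
    by (simp add: cinner_self mob_s(2) \<sigma>_def)
  define w' where "w' = cinner q (ball_mob q p z) p"
  have "w' = inverse (1 - w) * ((1 - w / (1 + \<sigma>)) * (1 - \<sigma>\<^sup>2) - \<sigma> * w)"
    unfolding w'_def ball_mob_eq w_def[symmetric] \<sigma>_def[symmetric] cinner_cscale_left cinner_diff_left pp by simp
  also have "(1 - w / (1 + \<sigma>)) * (1 - \<sigma>\<^sup>2) = (1 + \<sigma> - w) * (1 - \<sigma>)"
    using \<sigma> by (simp add: field_simps power2_eq_square)
  also have "inverse (1 - w) * ((1 + \<sigma> - w) * (1 - \<sigma>) - \<sigma> * w) = 1 - \<sigma>\<^sup>2 / (1 - w)"
    using w by (simp add: field_simps power2_eq_square)
  finally have w': "w' = 1 - \<sigma>\<^sup>2 / (1 - w)" .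
  show ?thesis
  proof
    fix i
    have "ball_mob q p (ball_mob q p z) i = inverse (1 - w') *
       ((1 - w' / (1 + \<sigma>)) * p i - \<sigma> * (inverse (1 - w) * ((1 - w / (1 + \<sigma>)) * p i - \<sigma> * z i)))"
      unfolding ball_mob_eq[of "ball_mob q p z"] w'_def[symmetric] \<sigma>_def[symmetric]
      by (simp add: ball_mob_eq w_def[symmetric] \<sigma>_def[symmetric])
    also have "inverse (1 - w') = (1 - w) / \<sigma>\<^sup>2"
      by (simp add: w')
    also have "1 - w' / (1 + \<sigma>) = \<sigma> * (1 - w + \<sigma>) / ((1 + \<sigma>) * (1 - w))"
    proof -
      have "1 - (1 - \<sigma>\<^sup>2 / X) / T = \<sigma> * (X + \<sigma>) / (T * X)" if "X \<noteq> 0" "T \<noteq> 0" "T = 1 + \<sigma>" for X T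
        using that(1,2) by (simp add: field_simps power2_eq_square) (simp add: that(3) algebra_simps)
      then show ?thesis
        unfolding w' using w \<sigma> by blast
    qed
    also have "1 - w / (1 + \<sigma>) = (1 - w + \<sigma>) / (1 + \<sigma>)"
      using \<sigma> by (simp add: field_simps)
    also have "(1 - w) / \<sigma>\<^sup>2 * (\<sigma> * (1 - w + \<sigma>) / ((1 + \<sigma>) * (1 - w)) * p i
        - \<sigma> * (inverse (1 - w) * ((1 - w + \<sigma>) / (1 + \<sigma>) * p i - \<sigma> * z i))) = z i"
    proof -
      have "X / \<sigma>\<^sup>2 * (\<sigma> * Y / (T * X) * c - \<sigma> * (inverse X * (Y / T * c - \<sigma> * d))) = d"
        if "X \<noteq> 0" "T \<noteq> 0" for X Y T c d :: complex
      proof -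
        have "\<sigma> * Y / (T * X) * c = \<sigma> * (inverse X * (Y / T * c))"
          by (simp add: divide_inverse)
        then have "X / \<sigma>\<^sup>2 * (\<sigma> * Y / (T * X) * c - \<sigma> * (inverse X * (Y / T * c - \<sigma> * d)))
            = X / \<sigma>\<^sup>2 * (\<sigma> * (inverse X * (\<sigma> * d)))"
          by (simp add: algebra_simps)
        also have "\<dots> = d"
          using that \<sigma>(1) by (simp add: power2_eq_square)
        finally show ?thesis .
      qed
      then show ?thesis
        using w \<sigma>(2) by blast
    qed
    finally show "ball_mob q p (ball_mob q p z) i = z i" .
  qed
qed

lemma ball_mob_0: "ball_mob q p 0 = p"
  by (simp add: ball_mob_eq fun_eq_iff)

lemma ball_mob_self: "ball_mob q p p = 0"
  using ball_mob_involution[of 0] by (simp add: ball_mob_0)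

lemma ball_map_ball_mob: "ball_map q (ball_mob q p)"
  unfolding ball_map_def
proof (intro conjI curve_holI)
  fix U c i
  assume U: "open U" "\<And>t. t \<in> U \<Longrightarrow> c t \<in> cunit_ball q"
     "\<And>i. i < q \<Longrightarrow> (\<lambda>t. c t i) holomorphic_on U" "i < q"
  have w: "(\<lambda>t. cinner q (c t) p) holomorphic_on U"
    by (rule curve_hol_inner[OF curve_hol_id U(1-3)])
  show "(\<lambda>t. ball_mob q p (c t) i) holomorphic_on U"
    unfolding ball_mob_eq using mob_w U mob_s(3)
    by (auto intro!: holomorphic_intros w)
qed (use ball_mob_in_ball in auto)

end

section \<open>Pointwise convergence of self-maps and Montel's theorem\<close>

abbreviation cconv :: "nat \<Rightarrow> (nat \<Rightarrow> cvec) \<Rightarrow> cvec \<Rightarrow> bool"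
  where "cconv q X x \<equiv> (\<lambda>k. cnorm q (X k - x)) \<longlonglongrightarrow> 0"

lemma cconv_iff: "cconv q X x \<longleftrightarrow> (\<forall>i<q. (\<lambda>k. X k i) \<longlonglongrightarrow> x i)"
proof
  assume X: "cconv q X x"
  show "\<forall>i<q. (\<lambda>k. X k i) \<longlonglongrightarrow> x i"
  proof (intro allI impI)
    fix i assume "i < q"
    then have "cmod (X k i - x i) \<le> cnorm q (X k - x)" for k
      using cmod_le_cnorm[of i q "X k - x"] by simp
    then have "(\<lambda>k. X k i - x i) \<longlonglongrightarrow> 0"
      by (intro tendsto_0_le[OF X, of _ 1]) simp
    then show "(\<lambda>k. X k i) \<longlonglongrightarrow> x i"
      by (simp add: LIM_zero_iff)
  qed
next
  assume "\<forall>i<q. (\<lambda>k. X k i) \<longlonglongrightarrow> x i"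
  then have "(\<lambda>k. \<Sum>i<q. cmod ((X k - x) i)) \<longlonglongrightarrow> 0"
    by (intro tendsto_null_sum tendsto_norm_zero) (simp add: LIM_zero_iff)
  then show "cconv q X x"
    by (rule tendsto_sandwich[OF _ _ tendsto_const, rotated 2]) (auto simp: cnorm_le_sum simp del: minus_apply)
qed

lemma cconv_const [simp]: "cconv q (\<lambda>k. x) x"
  by simp

lemma cconv_unique:
  assumes "cconv q X x" "cconv q X y" "x \<in> cspace q" "y \<in> cspace q"
  shows "x = y"
proof
  fix i
  show "x i = y i"
  proof (cases "i < q")
    case True
    then show ?thesis
      using assms(1,2) unfolding cconv_iff by (blast intro: LIMSEQ_unique)
  next
    case False
    then show ?thesis
      using assms(3,4) by (simp add: cspace_def)
  qed
qed

lemma cconv_cnorm: "cconv q X x \<Longrightarrow> (\<lambda>k. cnorm q (X k)) \<longlonglongrightarrow> cnorm q x"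
  unfolding cconv_iff unfolding cnorm_def L2_set_def by (intro tendsto_intros) auto

lemma cconv_subseq: "cconv q X x \<Longrightarrow> strict_mono r \<Longrightarrow> cconv q (\<lambda>k. X (r k)) x"
  using LIMSEQ_subseq_LIMSEQ[of "\<lambda>k. cnorm q (X k - x)" 0 r] by (simp add: o_def)

lemma cconv_eventually_eq:
  assumes "cconv q X x" "eventually (\<lambda>k. X k = Y k) sequentially"
  shows "cconv q Y x"
  by (rule Lim_transform_eventually[OF assms(1)]) (use assms(2) in \<open>auto elim: eventually_mono\<close>)

text \<open>The constant depends on \<open>a\<close> but not on \<open>F\<close>: the self-maps of
  the ball are locally equicontinuous.\<close>

lemma ball_map_Lipschitz:
  assumes F: "ball_map q F" and a: "a \<in> cunit_ball q" and y: "y \<in> cspace q" "cnorm q (y - a) < 1 - cnorm q a"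
  shows "cnorm q (F y - F a) \<le> 2 / (1 - cnorm q a) * cnorm q (y - a)"
proof -
  have "cnorm q (F y - F a) \<le> 2 * 1 / (1 - cnorm q a) * cnorm q (y - a)"
  proof (rule curve_hol_Lipschitz)
    show "curve_hol q q (cunit_ball q) F"
      using F by (simp add: ball_map_def)
    fix x assume x: "x \<in> cspace q" "cnorm q (x - a) < 1 - cnorm q a"
    then have "x \<in> cunit_ball q"
      using cnorm_triangle_sub[of q x a] by (simp add: cunit_ball_def)
    then show "x \<in> cunit_ball q \<and> cnorm q (F x) \<le> 1"
      using cunit_ballD(2)[OF ball_mapD[OF F]] by fastforce
  qed (use a y cunit_ballD in auto)
  then show ?thesis by simp
qed

text \<open>By equicontinuity, replacing \<open>x\<close> by \<open>X k\<close> changes the value by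
  at most a fixed multiple of their distance, uniformly in the map.\<close>

lemma cconv_ball_map:
  assumes F: "\<And>k. ball_map q (F k)" and x: "x \<in> cunit_ball q" and X: "\<And>k. X k \<in> cunit_ball q" "cconv q X x"
    and y: "cconv q (\<lambda>k. F k x) y"
  shows "cconv q (\<lambda>k. F k (X k)) y"
proof -
  have x1: "1 - cnorm q x > 0"
    using cunit_ballD[OF x] by simp
  have "eventually (\<lambda>k. cnorm q (X k - x) < 1 - cnorm q x) sequentially"
    using order_tendstoD(2)[OF X(2) x1] .
  then have "eventually (\<lambda>k. cnorm q (F k (X k) - y) \<le> 2 / (1 - cnorm q x) * cnorm q (X k - x) + cnorm q (F k x - y)) sequentially"
  proof eventually_elim
    case (elim k)
    show ?case
      using ball_map_Lipschitz[OF F[of k] x cunit_ballD(1)[OF X(1)] elim]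
        cnorm_triangle_mid[of q "F k (X k)" y "F k x"] by linarith
  qed
  moreover have "(\<lambda>k. 2 / (1 - cnorm q x) * cnorm q (X k - x) + cnorm q (F k x - y)) \<longlonglongrightarrow> 2 / (1 - cnorm q x) * 0 + 0"
    by (intro tendsto_intros X y)
  ultimately show ?thesis
    by (auto intro: Lim_null_comparison[rotated])
qed

lemma curve_hol_limit:
  assumes F: "\<And>k. ball_map q (F k)" and G: "\<And>x. x \<in> cunit_ball q \<Longrightarrow> cconv q (\<lambda>k. F k x) (G x)"
  shows "curve_hol q q (cunit_ball q) G"
proof (rule curve_holI)
  fix U c i
  assume U: "open U" "\<And>t. t \<in> U \<Longrightarrow> c t \<in> cunit_ball q"
     "\<And>i. i < q \<Longrightarrow> (\<lambda>t. c t i) holomorphic_on U" "i < q"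
  define \<F> where "\<F> k t = F k (c t) i" for k t
  have hol: "\<F> k holomorphic_on U" for k
    unfolding \<F>_def by (rule curve_holD[OF F[unfolded ball_map_def, THEN conjunct2] U])
  have bd: "cmod (\<F> k t) \<le> 1" if "t \<in> U" for k t
    using cmod_le_cnorm[OF U(4), of "F k (c t)"] cunit_ballD(2)[OF ball_mapD[OF F U(2)[OF that]]]
    unfolding \<F>_def by (meson less_eq_real_def order_trans)
  obtain g r where g: "g holomorphic_on U" "strict_mono (r :: nat \<Rightarrow> nat)" "\<And>t. t \<in> U \<Longrightarrow> (\<lambda>n. \<F> (r n) t) \<longlonglongrightarrow> g t"
  proof (rule Montel[OF U(1), of "range \<F>" \<F>])
    show "\<exists>B. \<forall>h\<in>range \<F>. \<forall>z\<in>K. cmod (h z) \<le> B" if "compact K" "K \<subseteq> U" for K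
      using bd that by (intro exI[of _ 1]) auto
  qed (use hol in auto)
  have "(\<lambda>n. \<F> (r n) t) \<longlonglongrightarrow> G (c t) i" if "t \<in> U" for t
    using cconv_subseq[OF G[OF U(2)[OF that]] g(2)] U(4) unfolding cconv_iff \<F>_def by blast
  then have "g t = G (c t) i" if "t \<in> U" for t
    using LIMSEQ_unique g(3) that by blast
  then show "(\<lambda>t. G (c t) i) holomorphic_on U"
    by (rule holomorphic_transform[OF g(1)])
qed

text \<open>A limit might reach the boundary sphere. If it did at \<open>x\<close>, its product with
  a norming vector would attain its maximum modulus on the slice of the ball by the complex line
  through \<open>x0\<close> and \<open>x\<close>; it would be constant there, against the strict
  bound at \<open>x0\<close>.\<close>

lemma ball_map_limit:
  assumes F: "\<And>k. ball_map q (F k)" and G: "\<And>x. x \<in> cunit_ball q \<Longrightarrow> cconv q (\<lambda>k. F k x) (G x)"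
    and Gq: "\<And>x. x \<in> cunit_ball q \<Longrightarrow> G x \<in> cspace q"
    and x0: "x0 \<in> cunit_ball q" "cnorm q (G x0) < 1"
  shows "ball_map q G"
proof -
  have hol: "curve_hol q q (cunit_ball q) G"
    by (rule curve_hol_limit[OF F G])
  have le1: "cnorm q (G x) \<le> 1" if "x \<in> cunit_ball q" for x
  proof (rule LIMSEQ_le_const2[OF cconv_cnorm[OF G[OF that]]])
    show "\<exists>N. \<forall>n\<ge>N. cnorm q (F n x) \<le> 1"
      using cunit_ballD(2)[OF ball_mapD[OF F that]] less_imp_le by blast
  qed
  have "cnorm q (G x) < 1" if x: "x \<in> cunit_ball q" for x
  proof (rule ccontr)
    assume "\<not> cnorm q (G x) < 1"
    then have Gx: "cnorm q (G x) = 1"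
      using le1[OF x] by simp
    obtain v where v: "cnorm q v \<le> 1" "cinner q (G x) v = of_real (cnorm q (G x))"
      by (rule exists_unit_cvec)
    define c where "c t = x0 + cscale t (x - x0)" for t
    define T where "T = {t. cnorm q (c t) < 1}"
    have cB: "c t \<in> cunit_ball q \<longleftrightarrow> t \<in> T" for t
      using x x0 by (auto simp: c_def T_def cunit_ball_def)
    have "continuous_on UNIV (\<lambda>t. cnorm q (c t))"
      unfolding cnorm_def L2_set_def c_def by (auto intro!: continuous_intros)
    then have opT: "open T"
      unfolding T_def by (rule open_Collect_less[OF _ continuous_on_const])
    have "convex T"
    proof (rule convexI)
      fix t1 t2 :: complex and u v :: real
      assume t: "t1 \<in> T" "t2 \<in> T" "0 \<le> u" "0 \<le> v" "u + v = 1"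
      have v: "v = 1 - u"
        using t by simp
      have "c (u *\<^sub>R t1 + v *\<^sub>R t2) = cscale (of_real u) (c t1) + cscale (of_real v) (c t2)"
        unfolding v c_def by (auto simp: fun_eq_iff scaleR_conv_of_real algebra_simps)
      then have "cnorm q (c (u *\<^sub>R t1 + v *\<^sub>R t2)) \<le> u * cnorm q (c t1) + v * cnorm q (c t2)"
        using cnorm_triangle[of q "cscale (of_real u) (c t1)" "cscale (of_real v) (c t2)"] t by simp
      also have "\<dots> < 1"
        using t convex_bound_lt[of "cnorm q (c t1)" 1 "cnorm q (c t2)" u v] by (simp add: T_def)
      finally show "u *\<^sub>R t1 + v *\<^sub>R t2 \<in> T"
        by (simp add: T_def)
    qed
    then have conT: "connected T"
      by (rule convex_connected)
    have T01: "0 \<in> T" "1 \<in> T"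
      using x x0 cB[of 0] cB[of 1] by (simp_all add: c_def cv.scale_zero_left)
    define \<psi> where "\<psi> t = cinner q (G (c t)) v" for t
    have "\<psi> holomorphic_on T"
      unfolding \<psi>_def
    proof (rule curve_hol_inner[OF hol opT])
      show "(\<lambda>t. c t i) holomorphic_on T" for i
        unfolding c_def by (auto intro!: holomorphic_intros)
    qed (simp add: cB)
    moreover have "\<psi> 1 = 1"
      using v Gx by (simp add: \<psi>_def c_def)
    moreover have "cmod (\<psi> t) \<le> cnorm q (G (c t))" for t
      using order_trans[OF cinner_Cauchy_Schwarz] v unfolding \<psi>_def by (simp add: mult_left_le)
    then have "cmod (\<psi> t) \<le> 1" if "t \<in> T" for t
      using le1[of "c t"] cB that by (meson order_trans)
    ultimately have "\<psi> constant_on T"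
      by (intro maximum_modulus_principle[OF _ opT conT opT, of _ 1]) (auto simp: T01)
    then have "\<psi> 0 = \<psi> 1"
      using T01 by (auto simp: constant_on_def)
    moreover have "cmod (\<psi> 0) < 1"
      using \<open>cmod (\<psi> 0) \<le> cnorm q (G (c 0))\<close> x0 by (simp add: c_def cv.scale_zero_left)
    ultimately show False
      using \<open>\<psi> 1 = 1\<close> by simp
  qed
  then show ?thesis
    using hol Gq by (auto simp: ball_map_def cunit_ball_def)
qed

lemma countable_dense_cunit_ball:
  obtains T where "countable T" "T \<subseteq> cunit_ball q"
    "\<And>x e. x \<in> cunit_ball q \<Longrightarrow> e > 0 \<Longrightarrow> \<exists>t\<in>T. cnorm q (t - x) < e"
proof -
  obtain D :: "cvec set" where D: "countable D" "\<And>X. open X \<Longrightarrow> X \<noteq> {} \<Longrightarrow> \<exists>d\<in>D. d \<in> X"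
    using countable_dense_setE by metis
  \<comment> \<open>Truncation moves a dense set of the whole sequence space into
    \<open>cspace q\<close> without changing distances measured by \<open>cnorm q\<close>.\<close>
  define tr where "tr x = (\<lambda>i. if i < q then x i else 0)" for x :: cvec
  have tr: "tr x \<in> cspace q" "cnorm q (tr x) = cnorm q x" "cnorm q (tr x - y) = cnorm q (x - y)" for x y
    unfolding cnorm_def by (auto simp: tr_def cspace_def intro!: L2_set_cong)
  show ?thesis
  proof (rule that[of "tr ` D \<inter> cunit_ball q"])
    fix x and e :: real assume x: "x \<in> cunit_ball q" "e > 0"
    define X where "X = {y. cnorm q y < 1} \<inter> {y. cnorm q (y - x) < e}"
    have "continuous_on UNIV (\<lambda>y. cnorm q (y - x))"
      unfolding cnorm_def L2_set_def minus_apply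
      by (intro continuous_intros continuous_on_product_coordinates)
    then have "open X"
      unfolding X_def by (intro open_Int open_Collect_less continuous_on_const continuous_on_cnorm)
    moreover have "x \<in> X"
      using x by (simp add: X_def cunit_ball_def)
    ultimately obtain d where "d \<in> D" "d \<in> X"
      using D(2) by blast
    then show "\<exists>t\<in>tr ` D \<inter> cunit_ball q. cnorm q (t - x) < e"
      using tr by (intro bexI[of _ "tr d"]) (auto simp: X_def cunit_ball_def simp del: minus_apply)
  qed (use D in auto)
qed

text \<open>One subsequence serves all \<open>j\<close>: the diagonal argument runs over the
  countable set of triples of an index, a point of a dense set and a coordinate, and equicontinuity
  extends the convergence to the whole ball.\<close>

lemma ball_map_convergent_subsequence:
  fixes F :: "nat \<Rightarrow> nat \<Rightarrow> cvec \<Rightarrow> cvec"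
  assumes F: "\<And>j k. ball_map q (F j k)"
  obtains r G where "strict_mono (r :: nat \<Rightarrow> nat)"
    "\<forall>j. \<forall>x\<in>cunit_ball q. G j x \<in> cspace q \<and> cconv q (\<lambda>k. F j (r k) x) (G j x)"
proof -
  obtain T where T: "countable T" "T \<subseteq> cunit_ball q"
    "\<And>x e. x \<in> cunit_ball q \<Longrightarrow> e > 0 \<Longrightarrow> \<exists>t\<in>T. cnorm q (t - x) < e"
    using countable_dense_cunit_ball by blast
  define S where "S = (UNIV :: nat set) \<times> T \<times> {..<q}"
  have "countable S"
    using T by (simp add: S_def)
  then obtain r where r: "strict_mono (r :: nat \<Rightarrow> nat)"
    and lim: "\<And>s. s \<in> S \<Longrightarrow> \<exists>l. (\<lambda>n. case s of (j, x, i) \<Rightarrow> F j (r n) x i) \<longlonglongrightarrow> l"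
  proof (rule function_convergent_subsequence[where f = "\<lambda>n s. case s of (j, x, i) \<Rightarrow> F j n x i" and M = 1])
    fix n s assume "s \<in> S"
    then obtain j x i where s: "s = (j, x, i)" "x \<in> T" "i < q"
      by (auto simp: S_def)
    then have "F j n x \<in> cunit_ball q"
      using ball_mapD[OF F] T(2) by blast
    then show "cmod (case s of (j, x, i) \<Rightarrow> F j n x i) \<le> 1"
      using cunit_ballD(2)[of "F j n x" q] cmod_le_cnorm[OF s(3), of "F j n x"] s(1) by simp
  qed (use \<open>countable S\<close> in auto)
  have conv: "convergent (\<lambda>k. F j (r k) x i)" if x: "x \<in> cunit_ball q" and i: "i < q" for j x i
  proof -
    have "Cauchy (\<lambda>k. F j (r k) x i)"
    proof (rule metric_CauchyI)
      fix e :: real assume e: "e > 0"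
      define d where "d = 1 - cnorm q x"
      have d: "d > 0"
        using cunit_ballD(2)[OF x] by (simp add: d_def)
      \<comment> \<open>Within distance \<open>d\<close> of \<open>x\<close> the Lipschitz constant
        \<open>2 / d\<close> applies, and it turns \<open>e * d / 8\<close> into
        \<open>e / 4\<close>.\<close>
      have "min d (e * d / 8) > 0"
        using d e by simp
      then obtain t where t: "t \<in> T" "cnorm q (t - x) < min d (e * d / 8)"
        using T(3)[OF x] by metis
      have near: "cmod (F j k t i - F j k x i) < e / 4" for k
      proof -
        have "cmod (F j k t i - F j k x i) \<le> cnorm q (F j k t - F j k x)"
          using cmod_le_cnorm[OF i, of "F j k t - F j k x"] by simp
        also have "\<dots> \<le> 2 / d * cnorm q (t - x)"
          unfolding d_def using t T(2) cunit_ballD(1) by (intro ball_map_Lipschitz[OF F x]) (auto simp: d_def)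
        also have "\<dots> < 2 / d * (e * d / 8)"
          using t d by (intro mult_strict_left_mono) auto
        finally show ?thesis
          using d by simp
      qed
      have "\<exists>l. (\<lambda>n. F j (r n) t i) \<longlonglongrightarrow> l"
        using lim[of "(j, t, i)"] t i by (simp add: S_def)
      then have "Cauchy (\<lambda>n. F j (r n) t i)"
        using convergent_def convergent_Cauchy by blast
      then obtain N where N: "\<And>m n. m \<ge> N \<Longrightarrow> n \<ge> N \<Longrightarrow> dist (F j (r m) t i) (F j (r n) t i) < e / 4"
        using metric_CauchyD[of _ "e/4"] e by (metis zero_less_divide_iff zero_less_numeral)
      show "\<exists>M. \<forall>m\<ge>M. \<forall>n\<ge>M. dist (F j (r m) x i) (F j (r n) x i) < e"
      proof (intro exI[of _ N] allI impI)
        fix m n assume "m \<ge> N" "n \<ge> N"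
        then show "dist (F j (r m) x i) (F j (r n) x i) < e"
          using N[of m n] near[of "r m"] near[of "r n"] e
            dist_triangle[of "F j (r m) x i" "F j (r n) x i" "F j (r m) t i"]
            dist_triangle[of "F j (r m) t i" "F j (r n) x i" "F j (r n) t i"]
          by (simp add: dist_norm norm_minus_commute)
      qed
    qed
    then show ?thesis
      by (rule Cauchy_convergent)
  qed
  \<comment> \<open>The value \<open>0\<close> beyond \<open>q\<close> places the limit in
    \<open>cspace q\<close>.\<close>
  define G where "G j x = (\<lambda>i. if i < q then lim (\<lambda>k. F j (r k) x i) else 0)" for j x
  show ?thesis
  proof (rule that[OF r], intro allI ballI)
    fix j x assume x: "x \<in> cunit_ball q"
    show "G j x \<in> cspace q \<and> cconv q (\<lambda>k. F j (r k) x) (G j x)"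
      using conv[OF x] by (auto simp: G_def cspace_def cconv_iff convergent_LIMSEQ_iff)
  qed
qed

section \<open>Locally uniform convergence of self-maps\<close>

lemma bounded_cvec_subsequence:
  assumes X: "\<And>k. X k \<in> cspace q" "\<And>k. cnorm q (X k) \<le> r"
  obtains x s where "x \<in> cspace q" "cnorm q x \<le> r" "strict_mono (s :: nat \<Rightarrow> nat)" "cconv q (\<lambda>k. X (s k)) x"
proof -
  obtain s where s: "strict_mono (s :: nat \<Rightarrow> nat)" "\<And>i. i \<in> {..<q} \<Longrightarrow> \<exists>l. (\<lambda>k. X (s k) i) \<longlonglongrightarrow> l"
  proof (rule function_convergent_subsequence[of "{..<q}" X r])
    show "cmod (X n i) \<le> r" if "i \<in> {..<q}" for n i
      using cmod_le_cnorm[of i q "X n"] that X(2)[of n] by simp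
  qed auto
  define x where "x = (\<lambda>i. if i < q then lim (\<lambda>k. X (s k) i) else 0)"
  have conv: "cconv q (\<lambda>k. X (s k)) x"
    using s(2) unfolding cconv_iff x_def
    by (auto simp: convergent_def[symmetric] convergent_LIMSEQ_iff[symmetric])
  show ?thesis
  proof (rule that[OF _ _ s(1) conv])
    show "x \<in> cspace q"
      by (auto simp: x_def cspace_def)
    show "cnorm q x \<le> r"
      using LIMSEQ_le_const2[OF cconv_cnorm[OF conv]] X(2) by blast
  qed
qed

text \<open>If uniformity failed, points where it fails for infinitely many indices would accumulate
  inside the ball, and there \<open>cconv_ball_map\<close> forces both maps to the same
  limit.\<close>

lemma ball_map_uniform_limit:
  assumes F: "\<And>k. ball_map q (F k)" and G: "ball_map q G"
    and lim: "\<And>x. x \<in> cunit_ball q \<Longrightarrow> cconv q (\<lambda>k. F k x) (G x)"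
    and r: "r < 1" and e: "e > 0"
  shows "eventually (\<lambda>k. \<forall>x\<in>cspace q. cnorm q x \<le> r \<longrightarrow> cnorm q (F k x - G x) < e) sequentially"
proof (rule ccontr)
  assume "\<not> ?thesis"
  then have "infinite {k. \<exists>x\<in>cspace q. cnorm q x \<le> r \<and> e \<le> cnorm q (F k x - G x)}"
    unfolding infinite_nat_iff_unbounded_le eventually_sequentially by (auto simp: not_less)
  from infinite_enumerate[OF this] obtain b where b: "strict_mono (b :: nat \<Rightarrow> nat)"
    "\<And>n. \<exists>x\<in>cspace q. cnorm q x \<le> r \<and> e \<le> cnorm q (F (b n) x - G x)"
    by auto
  then obtain X where X: "\<And>n. X n \<in> cspace q" "\<And>n. cnorm q (X n) \<le> r"
    "\<And>n. e \<le> cnorm q (F (b n) (X n) - G (X n))"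
    by metis
  obtain x s where x: "x \<in> cspace q" "cnorm q x \<le> r" "strict_mono (s :: nat \<Rightarrow> nat)" "cconv q (\<lambda>k. X (s k)) x"
    using bounded_cvec_subsequence[of X, OF X(1,2)] by blast
  have xB: "x \<in> cunit_ball q" and XB: "\<And>k. X k \<in> cunit_ball q"
    using x r X(1) order_le_less_trans[OF X(2) r] by (auto simp: cunit_ball_def)
  have "strict_mono (\<lambda>k. b (s k))"
    using strict_mono_o[OF b(1) x(3)] by (simp add: o_def)
  from cconv_subseq[OF lim[OF xB] this]
  have 1: "cconv q (\<lambda>k. F (b (s k)) (X (s k))) (G x)"
    by (intro cconv_ball_map[OF F xB XB x(4)])
  have 2: "cconv q (\<lambda>k. G (X (s k))) (G x)"
    by (intro cconv_ball_map[OF G xB XB x(4)]) simp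
  have "(\<lambda>k. cnorm q (F (b (s k)) (X (s k)) - G x) + cnorm q (G (X (s k)) - G x)) \<longlonglongrightarrow> 0 + 0"
    by (intro tendsto_add 1 2)
  moreover have "e \<le> cnorm q (F (b (s k)) (X (s k)) - G x) + cnorm q (G (X (s k)) - G x)" for k
    using X(3)[of "s k"] cnorm_triangle_mid[of q "F (b (s k)) (X (s k))" "G (X (s k))" "G x"]
    by (simp add: cnorm_minus_commute[of q "G x"] del: minus_apply)
  ultimately have "e \<le> 0"
    using LIMSEQ_le_const by fastforce
  then show False
    using e by simp
qed

text \<open>The difference of the maps is below \<open>e * s / 2\<close> on a slightly larger ball.
  For points closer than \<open>s\<close> the Schwarz estimate turns this into the Lipschitz
  constant \<open>e\<close>; for points further apart the bound itself is enough.\<close>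

lemma ball_map_uniform_limit_Lipschitz:
  assumes F: "\<And>k. ball_map q (F k)" and G: "ball_map q G"
    and lim: "\<And>x. x \<in> cunit_ball q \<Longrightarrow> cconv q (\<lambda>k. F k x) (G x)"
    and r: "r < 1" and e: "e > 0"
  shows "eventually (\<lambda>k. \<forall>x\<in>cspace q. \<forall>y\<in>cspace q. cnorm q x \<le> r \<longrightarrow> cnorm q y \<le> r \<longrightarrow>
    cnorm q ((F k y - G y) - (F k x - G x)) \<le> e * cnorm q (y - x)) sequentially"
proof -
  define s where "s = (1 - r) / 2"
  have s: "s > 0" "r + s < 1"
    using r by (auto simp: s_def field_simps)
  have "e * s / 2 > 0"
    using e s by simp
  with F G lim s(2)
  have "eventually (\<lambda>k. \<forall>x\<in>cspace q. cnorm q x \<le> r + s \<longrightarrow> cnorm q (F k x - G x) < e * s / 2) sequentially"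
    by (rule ball_map_uniform_limit)
  then show ?thesis
  proof (eventually_elim, intro ballI impI)
    fix k x y
    assume unif: "\<forall>x\<in>cspace q. cnorm q x \<le> r + s \<longrightarrow> cnorm q (F k x - G x) < e * s / 2"
      and x: "x \<in> cspace q" "cnorm q x \<le> r" and y: "y \<in> cspace q" "cnorm q y \<le> r"
    show "cnorm q ((F k y - G y) - (F k x - G x)) \<le> e * cnorm q (y - x)"
    proof (cases "cnorm q (y - x) < s")
      case True
      have "cnorm q ((F k y - G y) - (F k x - G x)) \<le> 2 * (e * s / 2) / s * cnorm q (y - x)"
      proof (rule curve_hol_Lipschitz[where F = "\<lambda>x. F k x - G x" and S = "cunit_ball q" and n = q, OF _ x(1) y(1) True])
        show "curve_hol q q (cunit_ball q) (\<lambda>x. F k x - G x)"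
          using F[of k] G by (intro curve_hol_diff) (auto simp: ball_map_def)
        fix z assume z: "z \<in> cspace q" "cnorm q (z - x) < s"
        then have "cnorm q z < r + s"
          using cnorm_triangle_sub[of q z x] x by simp
        then show "z \<in> cunit_ball q \<and> cnorm q (F k z - G z) \<le> e * s / 2"
          using unif z s by (auto simp: cunit_ball_def less_imp_le simp del: minus_apply)
      qed
      then show ?thesis
        using s by simp
    next
      case False
      have "cnorm q ((F k y - G y) - (F k x - G x)) \<le> cnorm q (F k y - G y) + cnorm q (F k x - G x)"
        by (rule cnorm_triangle_diff)
      also have "\<dots> \<le> e * s / 2 + e * s / 2"
        using unif x y s by (intro add_mono) (auto simp: less_imp_le simp del: minus_apply)
      also have "\<dots> = e * s"
        by simp
      also have "\<dots> \<le> e * cnorm q (y - x)"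
        using False e by (intro mult_left_mono) auto
      finally show ?thesis .
    qed
  qed
qed

section \<open>Perturbations of the identity on a subspace\<close>

lemma cspace_geometric_convergent:
  assumes X: "\<And>n. X n \<in> cspace q" and step: "\<And>n. cnorm q (X (Suc n) - X n) \<le> C * (1/2)^n"
  obtains x where "x \<in> cspace q" "cconv q X x"
proof -
  have "convergent (\<lambda>n. X n i)" if "i < q" for i
  proof -
    have "summable (\<lambda>n. X (Suc n) i - X n i)"
    proof (rule summable_comparison_test)
      have "cmod (X (Suc n) i - X n i) \<le> C * (1/2)^n" for n
        using cmod_le_cnorm[OF that, of "X (Suc n) - X n"] step[of n] by simp
      then show "\<exists>N. \<forall>n\<ge>N. cmod (X (Suc n) i - X n i) \<le> C * (1/2)^n"
        by blast
      show "summable (\<lambda>n. C * (1 / 2) ^ n)"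
        by (intro summable_mult summable_geometric) simp
    qed
    then have "convergent (\<lambda>n. (\<Sum>k<n. X (Suc k) i - X k i) + X 0 i)"
      by (intro convergent_add convergent_const) (simp add: summable_iff_convergent)
    then show ?thesis
      using sum_lessThan_telescope[of "\<lambda>n. X n i"] by simp
  qed
  then show ?thesis
    by (intro that[of "\<lambda>i. if i < q then lim (\<lambda>n. X n i) else 0"])
      (auto simp: cspace_def cconv_iff convergent_LIMSEQ_iff)
qed

text \<open>Solving \<open>F x = y\<close> as a fixed point of \<open>x \<mapsto> y - (F x - x)\<close>.\<close>

lemma near_identity_hits:
  assumes V: "cv.subspace V" "V \<subseteq> cspace q" and FV: "\<And>x. x \<in> V \<Longrightarrow> cnorm q x \<le> r \<Longrightarrow> F x \<in> V"
    and closed: "\<And>X x. (\<And>k. X k \<in> V) \<Longrightarrow> (\<And>k. cnorm q (X k) \<le> r) \<Longrightarrow> x \<in> cspace q \<Longrightarrow> cconv q X x \<Longrightarrow> x \<in> V"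
    and y: "y \<in> V" "cnorm q y \<le> r"
    and near: "\<And>x. x \<in> V \<Longrightarrow> cnorm q x \<le> r \<Longrightarrow> cnorm q (F x - x) \<le> r - cnorm q y"
    and lip: "\<And>x x'. x \<in> V \<Longrightarrow> x' \<in> V \<Longrightarrow> cnorm q x \<le> r \<Longrightarrow> cnorm q x' \<le> r \<Longrightarrow>
       cnorm q ((F x' - x') - (F x - x)) \<le> 1/2 * cnorm q (x' - x)"
  obtains x where "x \<in> V" "cnorm q x \<le> r" "F x = y"
proof -
  define T where "T x = y - (F x - x)" for x
  define X where "X n = (T ^^ n) y" for n
  have XS: "X (Suc n) = T (X n)" for n
    by (simp add: X_def)
  have T: "T x \<in> V \<and> cnorm q (T x) \<le> r" if "x \<in> V" "cnorm q x \<le> r" for x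
  proof
    show "T x \<in> V"
      unfolding T_def using that y FV by (intro cv.subspace_diff[OF V(1)]) auto
    show "cnorm q (T x) \<le> r"
      using cnorm_triangle_diff[of q y "F x - x"] near[OF that] by (simp add: T_def)
  qed
  have X: "X n \<in> V \<and> cnorm q (X n) \<le> r" for n
    by (induction n) (auto simp: X_def y T)
  have Tlip: "cnorm q (T x' - T x) \<le> 1/2 * cnorm q (x' - x)"
    if "x \<in> V" "x' \<in> V" "cnorm q x \<le> r" "cnorm q x' \<le> r" for x x'
  proof -
    have "T x' - T x = (F x - x) - (F x' - x')"
      by (simp add: T_def)
    then show ?thesis
      using lip[OF that] cnorm_minus_commute by metis
  qed
  define \<delta> where "\<delta> n = cnorm q (X (Suc n) - X n)" for n
  have \<delta>: "\<delta> (Suc n) \<le> 1/2 * \<delta> n" for n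
    unfolding \<delta>_def XS[of "Suc n"] using Tlip[of "X n" "X (Suc n)"] X[of n] X[of "Suc n"]
    by (simp add: XS[of n, symmetric] del: minus_apply)
  have "\<delta> n \<le> \<delta> 0 * (1/2)^n" for n
  proof (induction n)
    case (Suc n)
    then show ?case
      using \<delta>[of n] by simp
  qed simp
  then obtain x where x: "x \<in> cspace q" "cconv q X x"
    using cspace_geometric_convergent[of X q "\<delta> 0"] X V(2) unfolding \<delta>_def by blast
  have xr: "cnorm q x \<le> r"
    using LIMSEQ_le_const2[OF cconv_cnorm[OF x(2)]] X by blast
  have xV: "x \<in> V"
    using closed[of X x] X x by blast
  have "cnorm q (X (Suc n) - T x) \<le> 1/2 * cnorm q (X n - x)" for n
    using Tlip[of x "X n"] X[of n] xV xr by (simp add: XS del: minus_apply)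
  moreover have "(\<lambda>n. 1/2 * cnorm q (X n - x)) \<longlonglongrightarrow> 1/2 * 0"
    by (intro tendsto_intros x(2))
  ultimately have "cconv q (\<lambda>n. X (Suc n)) (T x)"
    by (intro Lim_null_comparison[where g = "\<lambda>n. 1/2 * cnorm q (X n - x)" and f = "\<lambda>n. cnorm q (X (Suc n) - T x)"])
      (simp_all del: minus_apply)
  moreover have "cconv q (\<lambda>n. X (Suc n)) x"
    using LIMSEQ_Suc[OF x(2)] .
  ultimately have "T x = x"
    using cconv_unique[of q "\<lambda>n. X (Suc n)" "T x" x] x(1) T[OF xV xr] V(2) by blast
  then have "F x = y"
    by (simp add: T_def fun_eq_iff)
  then show ?thesis
    using that xV xr by blast
qed

section \<open>Self-maps fixing the origin: the Schwarz lemma and the fixed point set\<close>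

context
  fixes q :: nat and F :: "cvec \<Rightarrow> cvec"
  assumes F: "ball_map q F" and F0: "F 0 = 0"
begin

lemma ball_line: "u \<in> cspace q \<Longrightarrow> cnorm q u \<le> 1 \<Longrightarrow> cmod t < 1 \<Longrightarrow> cscale t u \<in> cunit_ball q"
  using mult_right_le_one_le[of "cmod t" "cnorm q u"] by (auto simp: cunit_ball_def)

lemma line_inner_holomorphic:
  assumes u: "u \<in> cspace q" "cnorm q u = 1"
  shows "(\<lambda>t. cinner q (F (cscale t u)) v) holomorphic_on ball 0 1"
  by (rule curve_hol_inner[where c = "\<lambda>t. cscale t u", OF F[unfolded ball_map_def, THEN conjunct2]])
    (use u in \<open>auto intro!: holomorphic_intros ball_line\<close>)

lemma ball_Schwarz:
  assumes u: "u \<in> cspace q" "cnorm q u = 1" and t: "cmod t < 1"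
  shows "cnorm q (F (cscale t u)) \<le> cmod t"
proof -
  obtain v where v: "cnorm q v \<le> 1" "cinner q (F (cscale t u)) v = of_real (cnorm q (F (cscale t u)))"
    by (rule exists_unit_cvec)
  have "cmod (cinner q (F (cscale t' u)) v) \<le> 1" if "cmod t' < 1" for t'
  proof -
    have "cmod (cinner q (F (cscale t' u)) v) \<le> cnorm q (F (cscale t' u)) * cnorm q v"
      by (rule cinner_Cauchy_Schwarz)
    also have "\<dots> \<le> 1 * 1"
      using cunit_ballD(2)[OF ball_mapD[OF F ball_line[OF u(1) _ that]]] u v by (intro mult_mono) auto
    finally show ?thesis by simp
  qed
  from Schwarz_bound[OF line_inner_holomorphic[OF u] _ this t]
  show ?thesis
    using v F0 by simp
qed

text \<open>Equality in the one-dimensional Schwarz lemma along the line through \<open>u\<close>.\<close>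

lemma ball_Schwarz_equality:
  assumes u: "u \<in> cspace q" "cnorm q u = 1"
    and eq: "(\<exists>t. t \<noteq> 0 \<and> cmod t < 1 \<and> F (cscale t u) = cscale t u) \<or>
       deriv (\<lambda>t. cinner q (F (cscale t u)) u) 0 = 1"
    and t: "cmod t < 1"
  shows "F (cscale t u) = cscale t u"
proof -
  define \<psi> where "\<psi> t = cinner q (F (cscale t u)) u" for t
  have hol: "\<psi> holomorphic_on ball 0 1"
    unfolding \<psi>_def by (rule line_inner_holomorphic[OF u])
  have \<psi>0: "\<psi> 0 = 0"
    by (simp add: \<psi>_def F0)
  have \<psi>1: "cmod (\<psi> t) < 1" if "cmod t < 1" for t
  proof -
    have "cmod (\<psi> t) \<le> cnorm q (F (cscale t u)) * cnorm q u"
      unfolding \<psi>_def by (rule cinner_Cauchy_Schwarz)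
    also have "\<dots> < 1"
      using cunit_ballD(2)[OF ball_mapD[OF F ball_line[OF u(1) _ that]]] u by simp
    finally show ?thesis .
  qed
  have uu: "cinner q u u = 1"
    using u by (simp add: cinner_self)
  have "\<exists>\<alpha>. (\<forall>z. cmod z < 1 \<longrightarrow> \<psi> z = \<alpha> * z) \<and> cmod \<alpha> = 1"
  proof (rule Schwarz_Lemma(3)[OF hol \<psi>0 \<psi>1, of 0])
    show "(\<exists>z. cmod z < 1 \<and> z \<noteq> 0 \<and> cmod (\<psi> z) = cmod z) \<or> cmod (deriv \<psi> 0) = 1"
      using eq uu unfolding \<psi>_def by auto
  qed auto
  then obtain \<alpha> where \<alpha>: "\<And>z. cmod z < 1 \<Longrightarrow> \<psi> z = \<alpha> * z"
    by blast
  have "\<alpha> = 1"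
    using eq
  proof
    assume "\<exists>t. t \<noteq> 0 \<and> cmod t < 1 \<and> F (cscale t u) = cscale t u"
    then obtain t where t: "t \<noteq> 0" "cmod t < 1" "F (cscale t u) = cscale t u"
      by blast
    have "\<alpha> * t = t"
      using \<alpha>[OF t(2)] uu by (simp add: \<psi>_def t(3))
    then show ?thesis
      using t(1) by simp
  next
    assume d: "deriv (\<lambda>t. cinner q (F (cscale t u)) u) 0 = 1"
    have "((\<lambda>z. \<alpha> * z) has_field_derivative \<alpha>) (at 0)"
      by (auto intro!: derivative_eq_intros)
    then have "(\<psi> has_field_derivative \<alpha>) (at 0)"
      by (rule has_field_derivative_transform_within[where d = 1]) (auto simp: \<alpha>)
    then show ?thesis
      using d DERIV_imp_deriv unfolding \<psi>_def by blast
  qed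
  \<comment> \<open>The component of \<open>F (cscale t u)\<close> along \<open>u\<close> already
    has length \<open>cmod t\<close>, the maximal norm of the whole vector, so nothing orthogonal to
    \<open>u\<close> remains.\<close>
  then have "cinner q (F (cscale t u)) (cscale t u) = t * cnj t"
    using \<alpha>[OF t] by (simp add: \<psi>_def)
  then have "Re (cinner q (F (cscale t u)) (cscale t u)) = (cmod t)\<^sup>2"
    by (metis Re_complex_of_real complex_norm_square)
  then have "(cnorm q (F (cscale t u) - cscale t u))\<^sup>2 = (cnorm q (F (cscale t u)))\<^sup>2 - (cmod t)\<^sup>2"
    unfolding cnorm_power2_diff using u by simp
  also have "\<dots> \<le> 0"
    using ball_Schwarz[OF u t] by (simp add: power_mono)
  finally have "cnorm q (F (cscale t u) - cscale t u) = 0"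
    by (simp only: power2_less_eq_zero_iff)
  moreover have "F (cscale t u) - cscale t u \<in> cspace q"
    using ball_mapD[OF F ball_line[OF u(1) _ t]] cunit_ballD(1) u by simp
  ultimately show ?thesis
    by (simp add: cnorm_eq_0_iff del: minus_apply)
qed

text \<open>On each complex line through the origin, fixing one nonzero point and having a
  derivative that fixes the direction are both equivalent to fixing the whole line within the ball,
  by the equality case. So the fixed points form a slice by an eigenspace of
  \<open>P\<close>.\<close>

lemma fixed_points_linear:
  assumes P: "frechet_at q q F (cunit_ball q) 0 P"
  shows "{x \<in> cunit_ball q. F x = x} = {x \<in> cunit_ball q. \<forall>i<q. (\<Sum>j<q. P i j * x j) = x i}"
proof -
  have "F x = x \<longleftrightarrow> (\<forall>i<q. (\<Sum>j<q. P i j * x j) = x i)" if x: "x \<in> cunit_ball q" for x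
  proof (cases "x = 0")
    case True
    then show ?thesis
      using F0 by simp
  next
    case False
    define d where "d = cnorm q x"
    have d: "0 < d" "d < 1"
      using cunit_ballD[OF x] cnorm_eq_0_iff[of x q] False unfolding d_def by (auto simp: order_less_le)
    define u where "u = cscale (of_real (1 / d)) x"
    have u: "u \<in> cspace q" "cnorm q u = 1"
      using d cunit_ballD[OF x] by (auto simp: u_def norm_divide d_def[symmetric] simp del: of_real_divide)
    have xu: "x = cscale (of_real d) u"
      using d by (simp add: u_def fun_eq_iff)
    have Pu: "(\<Sum>j<q. P i j * x j) = d * (\<Sum>j<q. P i j * u j)" for i
      by (simp add: xu sum_distrib_left mult_ac)
    have fr: "frechet_at q q F (cunit_ball q) (cscale 0 u) P"
      using P by (simp add: cv.scale_zero_left)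
    have der: "((\<lambda>t. F (cscale t u) i) has_field_derivative (\<Sum>j<q. P i j * u j)) (at 0)" if "i < q" for i
      by (rule frechet_curve_derivative[where c = "\<lambda>t. cscale t u", OF fr open_ball[of 0 1] _ _ _ that])
        (use u in \<open>auto intro!: ball_line derivative_eq_intros\<close>)
    show ?thesis
    proof
      assume "F x = x"
      then have *: "F (cscale t u) = cscale t u" if "cmod t < 1" for t
        using d that by (intro ball_Schwarz_equality[OF u _ that] disjI1 exI[of _ "of_real d"]) (simp add: xu[symmetric])
      have "(\<Sum>j<q. P i j * u j) = u i" if "i < q" for i
      proof (rule DERIV_unique[OF der[OF that]])
        have "((\<lambda>t. t * u i) has_field_derivative u i) (at 0)"
          by (auto intro!: derivative_eq_intros)
        then show "((\<lambda>t. F (cscale t u) i) has_field_derivative u i) (at 0)"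
          by (rule has_field_derivative_transform_within[where d = 1]) (auto simp: *)
      qed
      then show "\<forall>i<q. (\<Sum>j<q. P i j * x j) = x i"
        unfolding Pu by (simp add: xu)
    next
      assume "\<forall>i<q. (\<Sum>j<q. P i j * x j) = x i"
      then have Pu': "(\<Sum>j<q. P i j * u j) = u i" if "i < q" for i
        unfolding Pu using d that by (simp add: xu)
      have "((\<lambda>t. cinner q (F (cscale t u)) u) has_field_derivative (\<Sum>i<q. u i * cnj (u i))) (at 0)"
        unfolding cinner_def by (intro DERIV_sum DERIV_cmult_right) (use der Pu' in auto)
      then have "deriv (\<lambda>t. cinner q (F (cscale t u)) u) 0 = cinner q u u"
        by (simp add: DERIV_imp_deriv cinner_def)
      then have "F (cscale t u) = cscale t u" if "cmod t < 1" for t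
        using that u by (intro ball_Schwarz_equality[OF u _ that] disjI2) (simp add: cinner_self)
      then show "F x = x"
        using d by (simp add: xu)
    qed
  qed
  then show ?thesis
    by blast
qed

end

section \<open>Linear subspaces\<close>

lemma cvec_eq_sum_cunit: "x \<in> cspace m \<Longrightarrow> x = (\<Sum>j<m. cscale (x j) (cunit j))"
proof
  fix i assume x: "x \<in> cspace m"
  have "(\<Sum>j<m. cscale (x j) (cunit j)) i = (\<Sum>j<m. if j = i then x i else 0)"
    unfolding sum_cvec_apply by (rule sum.cong) (auto simp: cunit_def)
  also have "\<dots> = x i"
    using x by (auto simp: cspace_def)
  finally show "x i = (\<Sum>j<m. cscale (x j) (cunit j)) i" ..
qed

lemma cspace_eq_span: "cspace m = cv.span (cunit ` {..<m})"
proof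
  show "cspace m \<subseteq> cv.span (cunit ` {..<m})"
  proof
    fix x assume "x \<in> cspace m"
    from cvec_eq_sum_cunit[OF this] show "x \<in> cv.span (cunit ` {..<m})"
      by (metis (no_types, lifting) cv.span_base cv.span_scale cv.span_sum imageI)
  qed
  show "cv.span (cunit ` {..<m}) \<subseteq> cspace m"
    by (intro cv.span_minimal subspace_cspace) (auto simp: cunit_in_cspace)
qed

abbreviation clinear :: "(cvec \<Rightarrow> cvec) \<Rightarrow> bool"
  where "clinear \<equiv> Vector_Spaces.linear cscale cscale"

lemma clinear_sum_cunit:
  assumes "clinear f" "x \<in> cspace m"
  shows "f x = (\<Sum>j<m. cscale (x j) (f (cunit j)))"
proof -
  interpret f: Vector_Spaces.linear cscale cscale f by fact
  show ?thesis
    using arg_cong[OF cvec_eq_sum_cunit[OF assms(2)], of f] by (simp add: f.sum f.scale)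
qed

lemma clinear_curve_hol:
  assumes "clinear f" "S \<subseteq> cspace m"
  shows "curve_hol m n S f"
proof (rule curve_holI)
  fix U c i
  assume U: "open U" "\<And>t. t \<in> U \<Longrightarrow> c t \<in> S" "\<And>i. i < m \<Longrightarrow> (\<lambda>t. c t i) holomorphic_on U" "i < n"
  have "(\<lambda>t. \<Sum>j<m. c t j * f (cunit j) i) holomorphic_on U"
    using U by (intro holomorphic_intros) auto
  then show "(\<lambda>t. f (c t) i) holomorphic_on U"
  proof (rule holomorphic_transform)
    fix t assume "t \<in> U"
    then have "c t \<in> cspace m"
      using U(2) assms(2) by blast
    then show "(\<Sum>j<m. c t j * f (cunit j) i) = f (c t) i"
      by (simp add: clinear_sum_cunit[OF assms(1)] sum_cvec_apply)
  qed
qed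

lemma clinear_bounded:
  assumes "clinear f"
  obtains K where "K > 0" "\<And>x. x \<in> cspace m \<Longrightarrow> cnorm n (f x) \<le> K * cnorm m x"
proof -
  define K where "K = 1 + (\<Sum>j<m. cnorm n (f (cunit j)))"
  have K: "K > 0"
    unfolding K_def by (simp add: add_pos_nonneg sum_nonneg)
  have "cnorm n (f x) \<le> K * cnorm m x" if x: "x \<in> cspace m" for x
  proof -
    have "cnorm n (\<Sum>j\<in>J. cscale (x j) (f (cunit j))) \<le> (\<Sum>j\<in>J. cnorm n (cscale (x j) (f (cunit j))))" for J
    proof (induction J rule: infinite_finite_induct)
      case (insert a J)
      then show ?case
        using cnorm_triangle[of n "cscale (x a) (f (cunit a))" "\<Sum>j\<in>J. cscale (x j) (f (cunit j))"]
        by (simp del: cnorm_cscale cscale_apply plus_fun_apply)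
    qed (simp_all del: zero_fun_apply)
    then have "cnorm n (f x) \<le> (\<Sum>j<m. cmod (x j) * cnorm n (f (cunit j)))"
      unfolding clinear_sum_cunit[OF assms x] by simp
    also have "\<dots> \<le> (\<Sum>j<m. cnorm m x * cnorm n (f (cunit j)))"
      by (intro sum_mono mult_right_mono cmod_le_cnorm) auto
    also have "\<dots> \<le> K * cnorm m x"
      by (simp add: K_def sum_distrib_left[symmetric] algebra_simps)
    finally show ?thesis .
  qed
  with K show ?thesis
    using that by blast
qed

text \<open>\<open>S\<close> forms combinations of a basis of \<open>V\<close>, and independence
  makes it injective. Its left inverse \<open>C\<close> is linear on all sequences, hence
  holomorphic along curves in the whole ball.\<close>

lemma subspace_coordinates:
  assumes V: "cv.subspace V" "V \<subseteq> cspace q"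
  obtains d S C where "clinear S" "clinear C" "\<And>w. S w \<in> V" "\<And>x. C x \<in> cspace d"
    "\<And>x. x \<in> V \<Longrightarrow> S (C x) = x" "\<And>w. w \<in> cspace d \<Longrightarrow> C (S w) = w"
proof -
  obtain B where B: "B \<subseteq> V" "cv.independent B" "V \<subseteq> cv.span B"
    using cv.maximal_independent_subset by blast
  have "finite B"
    using cv.independent_span_bound[OF _ B(2), of "cunit ` {..<q}"] B(1) V(2) cspace_eq_span[of q] by blast
  define d where "d = card B"
  obtain b where b: "bij_betw b {..<d} B"
    using ex_bij_betw_nat_finite[OF \<open>finite B\<close>] by (auto simp: d_def atLeast0LessThan)
  define S where "S w = (\<Sum>j<d. cscale (w j) (b j))" for w :: cvec
  have S: "clinear S"
    by unfold_locales (auto simp: S_def cv.scale_left_distrib sum.distrib cv.scale_sum_right)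
  interpret S: Vector_Spaces.linear cscale cscale S by fact
  have SV: "S w \<in> V" for w
    unfolding S_def using b B(1) by (intro cv.subspace_sum[OF V(1)] cv.subspace_scale[OF V(1)]) (auto simp: bij_betw_def)
  have "inj_on S (cspace d)"
  proof (subst S.inj_on_iff_eq_0[OF subspace_cspace], intro ballI impI)
    fix w assume w: "w \<in> cspace d" "S w = 0"
    define g where "g = the_inv_into {..<d} b"
    have g: "g (b j) = j" "b j \<in> B" if "j < d" for j
      using b that unfolding g_def by (auto simp: bij_betw_def the_inv_into_f_f)
    have "(\<Sum>v\<in>B. cscale (w (g v)) v) = (\<Sum>j<d. cscale (w (g (b j))) (b j))"
      by (rule sum.reindex_bij_betw[OF b, symmetric])
    also have "\<dots> = S w"
      unfolding S_def using g by (intro sum.cong) auto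
    also have "\<dots> = 0"
      by (rule w(2))
    finally have "\<forall>v\<in>B. w (g v) = 0"
      using B(2)[unfolded cv.independent_explicit_finite_subsets, rule_format, OF subset_refl \<open>finite B\<close>, of "\<lambda>v. w (g v)"]
      by blast
    then have "w j = 0" if "j < d" for j
      using g[OF that] by force
    then show "w = 0"
      using w(1) by (auto simp: cspace_def fun_eq_iff not_less[symmetric])
  qed
  note inj_S = this
  interpret pr: vector_space_pair cscale cscale ..
  obtain C where C: "range C \<subseteq> cspace d" "clinear C" "\<And>w. w \<in> cspace d \<Longrightarrow> C (S w) = w"
    using pr.linear_exists_left_inverse_on[OF S subspace_cspace inj_S] by blast
  have "S (C x) = x" if "x \<in> V" for x
  proof -
    have "V \<subseteq> S ` cspace d"
    proof -
      have "B \<subseteq> S ` cspace d"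
      proof
        fix v assume "v \<in> B"
        then obtain j where j: "j < d" "v = b j"
          using b by (auto simp: bij_betw_def)
        have "S (cunit j) = (\<Sum>k<d. if k = j then b j else 0)"
          unfolding S_def by (rule sum.cong) (auto simp: cunit_def)
        then have "S (cunit j) = v"
          using j by simp
        then show "v \<in> S ` cspace d"
          using cunit_in_cspace[OF j(1)] by blast
      qed
      then have "cv.span B \<subseteq> S ` cspace d"
        by (intro cv.span_minimal S.subspace_image subspace_cspace)
      then show ?thesis
        using B(3) by blast
    qed
    then show ?thesis
      using that C(3) by force
  qed
  then show ?thesis
    using that S C SV by blast
qed

text \<open>The rows of \<open>A\<close> are dual to the vectors \<open>E j\<close>, which are therefore independent.\<close>

lemma subspace_eq_cspace:
  assumes V: "cv.subspace V" "V \<subseteq> cspace q" and E: "\<And>j. j < q \<Longrightarrow> E j \<in> V"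
    and A: "\<And>i j. i < q \<Longrightarrow> j < q \<Longrightarrow> (\<Sum>k<q. A i k * E j k) = (if i = j then 1 else 0 :: complex)"
  shows "V = cspace q"
proof -
  have inj: "inj_on E {..<q}"
  proof (rule inj_onI)
    fix i j assume ij: "i \<in> {..<q}" "j \<in> {..<q}" "E i = E j"
    then show "i = j"
      using A[of i i] A[of i j] by (auto split: if_splits)
  qed
  have ind: "cv.independent (E ` {..<q})"
  proof (rule cv.independent_if_scalars_zero)
    fix f x assume 0: "(\<Sum>x\<in>E ` {..<q}. cscale (f x) x) = 0" and "x \<in> E ` {..<q}"
    then obtain i where i: "i < q" "x = E i"
      by auto
    have sum0: "(\<Sum>j<q. cscale (f (E j)) (E j)) = 0"
      using 0 unfolding sum.reindex[OF inj] o_def .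
    have z: "(\<Sum>j<q. f (E j) * E j k) = 0" for k
      using arg_cong[OF sum0, of "\<lambda>x. x k"] unfolding sum_cvec_apply cscale_apply zero_fun_apply .
    \<comment> \<open>Pairing the vanishing combination with row \<open>i\<close> of
      \<open>A\<close> isolates the coefficient of \<open>E i\<close>.\<close>
    have "0 = (\<Sum>k<q. A i k * (\<Sum>j<q. f (E j) * E j k))"
      by (simp add: z)
    also have "\<dots> = (\<Sum>j<q. f (E j) * (\<Sum>k<q. A i k * E j k))"
      unfolding sum_distrib_left by (rule trans[OF sum.swap]) (simp add: mult_ac)
    also have "\<dots> = (\<Sum>j<q. if j = i then f (E i) else 0)"
      using A i by (intro sum.cong) auto
    also have "\<dots> = f x"
      using i by simp
    finally show "f x = 0" ..
  qed simp
  have Eq: "E ` {..<q} \<subseteq> cspace q"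
    using E V(2) by auto
  have cardE: "card (E ` {..<q}) = q"
    using inj by (simp add: card_image)
  \<comment> \<open>There are already \<open>q\<close> independent vectors, the largest possible
    number in \<open>cspace q\<close>, so no unit vector can be adjoined to them.\<close>
  have "cunit j \<in> cv.span (E ` {..<q})" if j: "j < q" for j
  proof (rule ccontr)
    assume notin: "cunit j \<notin> cv.span (E ` {..<q})"
    then have "cv.independent (insert (cunit j) (E ` {..<q}))"
      using ind by (rule cv.independent_insertI)
    moreover have "insert (cunit j) (E ` {..<q}) \<subseteq> cspace q"
      using Eq cunit_in_cspace[OF j] by simp
    then have "insert (cunit j) (E ` {..<q}) \<subseteq> cv.span (cunit ` {..<q})"
      by (simp only: cspace_eq_span)
    ultimately have "card (insert (cunit j) (E ` {..<q})) \<le> card (cunit ` {..<q})"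
      using cv.independent_span_bound[OF finite_imageI[OF finite_lessThan]] by blast
    also have "\<dots> \<le> q"
      using card_image_le[of "{..<q}" cunit] by simp
    finally have "card (insert (cunit j) (E ` {..<q})) \<le> q" .
    moreover have "cunit j \<notin> E ` {..<q}"
      using notin by (rule contrapos_nn[OF _ cv.span_base])
    ultimately show False
      using cardE by simp
  qed
  then have "cspace q \<subseteq> cv.span (E ` {..<q})"
    unfolding cspace_eq_span by (intro cv.span_minimal cv.subspace_span) auto
  also have "\<dots> \<subseteq> V"
    using E by (intro cv.span_minimal V(1)) auto
  finally show ?thesis
    using V(2) by blast
qed

section \<open>The Kobayashi distance of the ball\<close>

text \<open>Moebius maps of the disc move \<open>a\<close> and \<open>\<psi> a\<close> to the
  origin, where the Schwarz lemma applies.\<close>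

lemma Schwarz_Pick:
  assumes hol: "\<psi> holomorphic_on ball 0 1" and \<psi>: "\<And>t. cmod t < 1 \<Longrightarrow> cmod (\<psi> t) < 1"
    and a: "cmod a < 1" and b: "cmod b < 1"
  shows "cmod ((\<psi> a - \<psi> b) / (1 - cnj (\<psi> a) * \<psi> b)) \<le> cmod ((a - b) / (1 - cnj a * b))"
proof -
  define h where "h = (\<lambda>t. Moebius_function 0 (\<psi> a) (\<psi> (Moebius_function 0 (- a) t)))"
  have ma: "cmod (- a) < 1"
    using a by simp
  have "Moebius_function 0 (- a) ` ball 0 1 \<subseteq> ball 0 1"
    using Moebius_function_norm_lt_1[OF ma] by auto
  then have "(\<psi> \<circ> Moebius_function 0 (- a)) holomorphic_on ball 0 1"
    by (rule holomorphic_on_compose_gen[OF Moebius_function_holomorphic[OF ma] hol])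
  moreover have "(\<psi> \<circ> Moebius_function 0 (- a)) ` ball 0 1 \<subseteq> ball 0 1"
    using Moebius_function_norm_lt_1[OF ma] \<psi> by auto
  ultimately have "(Moebius_function 0 (\<psi> a) \<circ> (\<psi> \<circ> Moebius_function 0 (- a))) holomorphic_on ball 0 1"
    by (intro holomorphic_on_compose_gen[OF _ Moebius_function_holomorphic[OF \<psi>[OF a]]])
  then have "h holomorphic_on ball 0 1"
    by (simp add: h_def o_def)
  moreover have "h 0 = 0"
    by (simp add: h_def Moebius_function_of_zero Moebius_function_eq_zero)
  moreover have "cmod (h z) < 1" if "cmod z < 1" for z
    unfolding h_def by (intro Moebius_function_norm_lt_1 \<psi> a ma that)
  moreover have "cmod (Moebius_function 0 a b) < 1"
    by (rule Moebius_function_norm_lt_1[OF a b])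
  ultimately have "cmod (h (Moebius_function 0 a b)) \<le> cmod (Moebius_function 0 a b)"
    by (rule Schwarz_Lemma)
  moreover have "Moebius_function 0 (- a) (Moebius_function 0 a b) = b"
    by (rule Moebius_function_compose) (use a b in auto)
  ultimately have "cmod (Moebius_function 0 (\<psi> a) (\<psi> b)) \<le> cmod (Moebius_function 0 a b)"
    by (simp add: h_def)
  then show ?thesis
    by (simp add: Moebius_function_simple norm_divide norm_minus_commute)
qed

lemma pseudo_hyperbolic_less_1:
  assumes "cmod a < 1" "cmod b < 1"
  shows "cmod ((a - b) / (1 - cnj a * b)) < 1"
  using Moebius_function_norm_lt_1[OF assms, of 0]
  by (simp add: Moebius_function_simple norm_divide norm_minus_commute)

lemma artanh_real_eq:
  "-1 < x \<Longrightarrow> x < 1 \<Longrightarrow> artanh (x :: real) = (ln (1 + x) - ln (1 - x)) / 2"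
  by (simp add: artanh_def ln_div)

lemma artanh_ge_half:
  assumes "0 \<le> x" "x < 1"
  shows "x / 2 \<le> artanh (x :: real)"
proof -
  have "ln (1 - x) \<le> - x"
    using ln_le_minus_one[of "1 - x"] assms by simp
  moreover have "0 \<le> ln (1 + x)"
    using assms by simp
  ultimately have "x \<le> ln (1 + x) - ln (1 - x)"
    by linarith
  then show ?thesis
    using assms by (simp add: artanh_real_eq)
qed

lemma artanh_mono:
  assumes "-1 < x" "x \<le> y" "y < 1"
  shows "artanh x \<le> artanh (y :: real)"
proof -
  have "ln (1 + x) \<le> ln (1 + y)" "ln (1 - y) \<le> ln (1 - x)"
    using assms by (simp_all add: ln_mono)
  then have "ln (1 + x) - ln (1 - x) \<le> ln (1 + y) - ln (1 - y)"
    by linarith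
  then show ?thesis
    using assms by (simp add: artanh_real_eq)
qed

text \<open>The denominator in the pseudo-hyperbolic distance has modulus at most \<open>2\<close>,
  and \<open>artanh x\<close> is at least \<open>x / 2\<close>. This crude bound adds up along
  chains of discs and so separates points.\<close>

lemma dist_le_poincare_dist:
  assumes hol: "\<psi> holomorphic_on ball 0 1" and \<psi>: "\<And>t. cmod t < 1 \<Longrightarrow> cmod (\<psi> t) < 1"
    and a: "cmod a < 1" and b: "cmod b < 1"
  shows "cmod (\<psi> a - \<psi> b) \<le> 4 * poincare_dist a b"
proof -
  define D where "D = 1 - cnj (\<psi> a) * \<psi> b"
  have 1: "cmod (cnj (\<psi> a) * \<psi> b) < 1"
    using norm_mult_less[of "cnj (\<psi> a)" 1 "\<psi> b" 1] \<psi>[OF a] \<psi>[OF b] by simp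
  then have "D \<noteq> 0" "cmod D \<le> 2"
    using norm_triangle_ineq4[of 1 "cnj (\<psi> a) * \<psi> b"] by (auto simp: D_def)
  then have "cmod (\<psi> a - \<psi> b) = cmod ((\<psi> a - \<psi> b) / D) * cmod D"
    by (simp add: norm_divide)
  also have "\<dots> \<le> cmod ((\<psi> a - \<psi> b) / D) * 2"
    using \<open>cmod D \<le> 2\<close> by (intro mult_left_mono) auto
  also have "\<dots> \<le> cmod ((a - b) / (1 - cnj a * b)) * 2"
    unfolding D_def by (intro mult_right_mono Schwarz_Pick assms) auto
  also have "\<dots> \<le> 4 * poincare_dist a b"
    unfolding poincare_dist_def using artanh_ge_half[OF norm_ge_zero pseudo_hyperbolic_less_1[OF a b]] by simp
  finally show ?thesis .
qed

text \<open>\<open>artanh\<close> of the modulus is the Poincare distance from the origin, so this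
  is the triangle inequality combined with the contraction property of
  \<open>\<psi>\<close>.\<close>

lemma artanh_norm_le_poincare:
  assumes hol: "\<psi> holomorphic_on ball 0 1" and \<psi>: "\<And>t. cmod t < 1 \<Longrightarrow> cmod (\<psi> t) < 1"
    and a: "cmod a < 1" and b: "cmod b < 1" and \<alpha>: "\<psi> a = of_real \<alpha>" "0 \<le> \<alpha>"
  shows "artanh \<alpha> \<le> artanh (cmod (\<psi> b)) + poincare_dist a b"
proof -
  define \<beta> where "\<beta> = cmod (\<psi> b)"
  define \<delta> where "\<delta> = cmod ((a - b) / (1 - cnj a * b))"
  have \<alpha>1: "\<alpha> < 1" and \<beta>1: "0 \<le> \<beta>" "\<beta> < 1" and \<delta>1: "0 \<le> \<delta>" "\<delta> < 1"
    using \<psi>[OF a] \<psi>[OF b] \<alpha> pseudo_hyperbolic_less_1[OF a b] by (auto simp: \<beta>_def \<delta>_def)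
  have ab: "\<alpha> * \<beta> < 1"
    using mult_left_le[of \<beta> \<alpha>] \<alpha>1 \<alpha>(2) \<beta>1 by linarith
  \<comment> \<open>For \<open>\<beta> < \<alpha>\<close>, the point of modulus
    \<open>\<beta>\<close> that is pseudo-hyperbolically nearest to \<open>\<alpha>\<close> is
    \<open>\<beta>\<close> itself; the distance from \<open>\<alpha>\<close> to
    \<open>\<psi> b\<close> is at most \<open>\<delta>\<close> by Schwarz-Pick.\<close>
  have key: "\<alpha> - \<beta> \<le> \<delta> * (1 - \<alpha> * \<beta>)"
  proof (cases "\<alpha> \<le> \<beta>")
    case True
    then show ?thesis
      using \<delta>1 ab by (auto intro: order_trans[of _ 0])
  next
    case False
    define z where "z = \<psi> b"
    have z: "(Re z)\<^sup>2 + (Im z)\<^sup>2 = \<beta>\<^sup>2" "Re z \<le> \<beta>"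
      using complex_Re_le_cmod[of z] by (simp_all add: \<beta>_def z_def cmod_power2[symmetric])
    have nz: "cmod (1 - of_real \<alpha> * z) > 0"
    proof -
      have "cmod (of_real \<alpha> * z) < 1"
        using ab \<alpha>(2) by (simp add: norm_mult \<beta>_def z_def)
      then show ?thesis
        by auto
    qed
    have n1: "(cmod (1 - of_real \<alpha> * z))\<^sup>2 = 1 - 2 * \<alpha> * Re z + \<alpha>\<^sup>2 * \<beta>\<^sup>2"
      unfolding cmod_power2 z(1)[symmetric] by (simp add: power2_eq_square algebra_simps)
    have n2: "(cmod (of_real \<alpha> - z))\<^sup>2 = \<alpha>\<^sup>2 - 2 * \<alpha> * Re z + \<beta>\<^sup>2"
      unfolding cmod_power2 z(1)[symmetric] by (simp add: power2_eq_square algebra_simps)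
    have "((\<alpha> - \<beta>) * cmod (1 - of_real \<alpha> * z))\<^sup>2 \<le> (cmod (of_real \<alpha> - z) * (1 - \<alpha> * \<beta>))\<^sup>2"
    proof -
      have "((\<alpha> - \<beta>) * cmod (1 - of_real \<alpha> * z))\<^sup>2 - (cmod (of_real \<alpha> - z) * (1 - \<alpha> * \<beta>))\<^sup>2
        = 2 * \<alpha> * (1 - \<alpha>\<^sup>2) * (1 - \<beta>\<^sup>2) * (Re z - \<beta>)"
        unfolding power_mult_distrib n1 n2 by (simp add: power2_eq_square algebra_simps)
      also have "\<dots> \<le> 0"
        using \<alpha> \<alpha>1 \<beta>1 z(2) by (intro mult_nonneg_nonpos mult_nonneg_nonneg) (auto simp: power_le_one)
      finally show ?thesis by simp
    qed
    then have "(\<alpha> - \<beta>) * cmod (1 - of_real \<alpha> * z) \<le> cmod (of_real \<alpha> - z) * (1 - \<alpha> * \<beta>)"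
      by (rule power2_le_imp_le) (use ab in auto)
    then have "\<alpha> - \<beta> \<le> cmod ((of_real \<alpha> - z) / (1 - of_real \<alpha> * z)) * (1 - \<alpha> * \<beta>)"
      using nz by (simp add: norm_divide field_simps)
    also have "cmod ((of_real \<alpha> - z) / (1 - of_real \<alpha> * z)) \<le> \<delta>"
      using Schwarz_Pick[OF hol \<psi> a b] by (simp add: \<alpha> z_def \<delta>_def)
    then have "cmod ((of_real \<alpha> - z) / (1 - of_real \<alpha> * z)) * (1 - \<alpha> * \<beta>) \<le> \<delta> * (1 - \<alpha> * \<beta>)"
      using ab by (intro mult_right_mono) auto
    finally show ?thesis .
  qed
  \<comment> \<open>The inequality
    \<open>artanh \<alpha> \<le> artanh \<beta> + artanh \<delta>\<close>, exponentiated and cleared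
    of denominators.\<close>
  have "(1 + \<alpha>) * ((1 - \<beta>) * (1 - \<delta>)) \<le> ((1 + \<beta>) * (1 + \<delta>)) * (1 - \<alpha>)"
  proof -
    have "((1 + \<beta>) * (1 + \<delta>)) * (1 - \<alpha>) - (1 + \<alpha>) * ((1 - \<beta>) * (1 - \<delta>)) = 2 * (\<delta> * (1 - \<alpha> * \<beta>) - (\<alpha> - \<beta>))"
      by (simp add: algebra_simps)
    then show ?thesis
      using key by simp
  qed
  then have "ln ((1 + \<alpha>) * ((1 - \<beta>) * (1 - \<delta>))) \<le> ln (((1 + \<beta>) * (1 + \<delta>)) * (1 - \<alpha>))"
    using \<alpha>(2) \<alpha>1 \<beta>1 \<delta>1 by (intro ln_mono mult_pos_pos) auto
  then have "ln (1 + \<alpha>) + (ln (1 - \<beta>) + ln (1 - \<delta>)) \<le> (ln (1 + \<beta>) + ln (1 + \<delta>)) + ln (1 - \<alpha>)"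
    using \<alpha>(2) \<alpha>1 \<beta>1 \<delta>1 by (simp add: ln_mult)
  moreover have "2 * artanh x = ln (1 + x) - ln (1 - x)" if "0 \<le> x" "x < 1" for x :: real
    using that by (simp add: artanh_real_eq)
  note this[OF \<alpha>(2) \<alpha>1] this[OF \<beta>1] this[OF \<delta>1]
  ultimately have "artanh \<alpha> \<le> artanh \<beta> + artanh \<delta>"
    by linarith
  then show ?thesis
    by (simp add: poincare_dist_def \<beta>_def \<delta>_def)
qed

section \<open>Domains as complex manifolds\<close>

text \<open>The common form of the ball and of the coordinate domain of a slice, so that one
  description of holomorphic maps covers both.\<close>

definition dom_mfd :: "nat \<Rightarrow> cvec set \<Rightarrow> cvec cmfd"
  where "dom_mfd n W = \<lparr>mtop = top_of_set W, mdim = n, charts = {(W, \<lambda>z. z)}\<rparr>"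

lemma ball_mfd_eq: "ball_mfd n = dom_mfd n (cunit_ball n)"
  by (simp add: ball_mfd_def dom_mfd_def)

lemma mcarrier_dom_mfd [simp]: "mcarrier (dom_mfd n W) = W"
  by (simp add: dom_mfd_def)

lemma inv_into_id: "w \<in> W \<Longrightarrow> inv_into W (\<lambda>z. z) w = w"
  by (metis f_inv_into_f image_ident)

lemma holomorphic_map_dom_iff:
  "holomorphic_map (dom_mfd m W) (dom_mfd n W') F \<longleftrightarrow>
    F ` W \<subseteq> W' \<and> continuous_on W F \<and> cholomorphic_on m n F W"
proof -
  have eq: "cholomorphic_on m n ((\<lambda>z. z) \<circ> F \<circ> inv_into W (\<lambda>z. z)) W \<longleftrightarrow> cholomorphic_on m n F W"
    by (rule iffI; erule cholomorphic_on_cong) (simp_all add: inv_into_id)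
  have "continuous_map (top_of_set W) (top_of_set W') F \<longleftrightarrow> F ` W \<subseteq> W' \<and> continuous_on W F"
    by (auto simp: continuous_map_in_subtopology)
  moreover have "W \<inter> F -` W' = W" if "F ` W \<subseteq> W'"
    using that by blast
  ultimately show ?thesis
    unfolding holomorphic_map_def dom_mfd_def using eq by auto
qed

lemma complex_manifold_dom_mfd:
  assumes W: "openin (top_of_set (cspace n)) W"
  shows "complex_manifold (dom_mfd n W)"
proof -
  have "W \<subseteq> cspace n"
    using openin_imp_subset[OF W] by simp
  then have hol: "cholomorphic_on n n ((\<lambda>z. z) \<circ> inv_into W (\<lambda>z. z)) W"
    by (intro cholomorphic_on_cong[OF cholomorphic_on_id]) (auto simp: inv_into_id)
  obtain B :: "cvec set set" where B: "countable B" "topological_basis B"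
    using ex_countable_basis by blast
  have "second_countable (euclidean :: cvec topology)"
    unfolding second_countable_def using B topological_basis_open[OF B(2)] topological_basisE[OF B(2)]
    by (intro exI[of _ B]) (metis open_openin)
  then have sc: "second_countable (top_of_set W)"
    by (rule second_countable_subtopology)
  have hd: "Hausdorff_space (top_of_set W)"
    by (rule Hausdorff_space_subtopology[OF Hausdorff_space_euclidean])
  have hm: "homeomorphic_map (top_of_set W) (top_of_set W) (\<lambda>z. z)"
    using homeomorphic_map_id[of "top_of_set W"] by (simp add: id_def)
  have op: "openin (top_of_set W) W"
    using openin_topspace[of "top_of_set W"] by simp
  show ?thesis
    unfolding complex_manifold_def dom_mfd_def
    using hol sc hd hm op W by (simp add: subtopology_subtopology)
qed

lemma curve_hol_continuous_on:
  assumes F: "curve_hol m n W F" and W: "W \<subseteq> cspace m" and Fn: "F ` W \<subseteq> cspace n"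
    and bd: "\<And>a. a \<in> W \<Longrightarrow> \<exists>s>0. \<exists>M. \<forall>x\<in>cspace m. cnorm m (x - a) < s \<longrightarrow> x \<in> W \<and> cnorm n (F x) \<le> M"
  shows "continuous_on W F"
proof (rule continuous_on_coordinatewise_then_product)
  fix i
  show "continuous_on W (\<lambda>x. F x i)"
  proof (cases "i < n")
    case True
    show ?thesis
      unfolding continuous_on
    proof
      fix a assume a: "a \<in> W"
      obtain s M where s: "s > 0" and M: "\<And>x. x \<in> cspace m \<Longrightarrow> cnorm m (x - a) < s \<Longrightarrow> x \<in> W \<and> cnorm n (F x) \<le> M"
        using bd[OF a] by blast
      have "continuous_on UNIV (\<lambda>x. cnorm m (x - a))"
        unfolding cnorm_def L2_set_def minus_apply
        by (intro continuous_intros continuous_on_product_coordinates)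
      then have "((\<lambda>x. cnorm m (x - a)) \<longlongrightarrow> cnorm m (a - a)) (at a within W)"
        using continuous_on_subset[of UNIV _ W] a unfolding continuous_on by blast
      then have lim: "((\<lambda>x. cnorm m (x - a)) \<longlongrightarrow> 0) (at a within W)"
        by (simp del: minus_apply zero_fun_apply)
      have "eventually (\<lambda>x. x \<in> W) (at a within W)"
        by (simp add: eventually_at_filter)
      moreover have "eventually (\<lambda>x. cnorm m (x - a) < s) (at a within W)"
        by (rule order_tendstoD(2)[OF lim s])
      ultimately have "eventually (\<lambda>x. norm (F x i - F a i) \<le> 2 * M / s * cnorm m (x - a)) (at a within W)"
      proof eventually_elim
        case (elim x)
        have "cnorm n (F x - F a) \<le> 2 * M / s * cnorm m (x - a)"
          by (rule curve_hol_Lipschitz[OF F _ _ elim(2) M]) (use a W elim in auto)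
        then show ?case
          using cmod_le_cnorm[OF True, of "F x - F a"] by simp
      qed
      moreover have "((\<lambda>x. 2 * M / s * cnorm m (x - a)) \<longlongrightarrow> 2 * M / s * 0) (at a within W)"
        by (intro tendsto_intros lim)
      ultimately have "((\<lambda>x. F x i - F a i) \<longlongrightarrow> 0) (at a within W)"
        by (intro Lim_null_comparison[where f = "\<lambda>x. F x i - F a i"]) simp_all
      then show "((\<lambda>x. F x i) \<longlongrightarrow> F a i) (at a within W)"
        by (rule LIM_zero_cancel)
    qed
  next
    case False
    then have "F x i = 0" if "x \<in> W" for x
      using Fn that by (auto simp: cspace_def)
    then show ?thesis
      using continuous_on_cong[of W W "\<lambda>x. F x i" "\<lambda>x. 0"] by simp
  qed
qed

lemma holomorphic_map_domI:
  assumes F: "curve_hol m n W F" and W: "W \<subseteq> cspace m" and W': "F ` W \<subseteq> W'" "W' \<subseteq> cspace n"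
    and op: "\<And>a. a \<in> W \<Longrightarrow> \<exists>s>0. \<forall>x\<in>cspace m. cnorm m (x - a) < s \<longrightarrow> x \<in> W"
    and bd: "\<And>x. x \<in> W' \<Longrightarrow> cnorm n x \<le> M"
  shows "holomorphic_map (dom_mfd m W) (dom_mfd n W') F"
proof -
  have loc: "\<exists>s>0. \<exists>M. \<forall>x\<in>cspace m. cnorm m (x - a) < s \<longrightarrow> x \<in> W \<and> cnorm n (F x) \<le> M" if a: "a \<in> W" for a
  proof -
    obtain s where "s > 0" "\<forall>x\<in>cspace m. cnorm m (x - a) < s \<longrightarrow> x \<in> W"
      using op[OF a] by blast
    then show ?thesis
      using bd W'(1) by (intro exI[of _ s] conjI exI[of _ M]) auto
  qed
  have Fn: "F ` W \<subseteq> cspace n"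
    using W' by (rule order_trans)
  show ?thesis
    unfolding holomorphic_map_dom_iff
    by (intro conjI W'(1) curve_hol_continuous_on[OF F W Fn loc] curve_hol_imp_cholomorphic_on[OF F W Fn loc])
qed

section \<open>Kobayashi hyperbolicity and Kobayashi balls\<close>

lemma holomorphic_disc_dom:
  assumes "holomorphic_disc (dom_mfd n W) u"
  shows "\<And>t. t \<in> ball 0 1 \<Longrightarrow> u t \<in> W" "\<And>i. i < n \<Longrightarrow> (\<lambda>t. u t i) holomorphic_on ball 0 1"
proof -
  have c: "continuous_map (top_of_set (ball 0 1)) (top_of_set W) u"
    using assms by (simp add: holomorphic_disc_def dom_mfd_def)
  then show u: "u t \<in> W" if "t \<in> ball 0 1" for t
    using that by (auto simp: continuous_map_in_subtopology)
  then have "ball 0 1 \<inter> u -` W = ball 0 1"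
    by blast
  then show "(\<lambda>t. u t i) holomorphic_on ball 0 1" if "i < n" for i
    using assms that by (auto simp: holomorphic_disc_def dom_mfd_def)
qed

text \<open>A coordinate of \<open>S\<close> that separates \<open>x\<close> and \<open>y\<close>
  sends every holomorphic disc in \<open>W\<close> into the unit disc, so its variation along a
  chain is controlled by the Poincare lengths.\<close>

lemma kobayashi_hyperbolic_dom_mfd:
  assumes S: "curve_hol d q W S" "S ` W \<subseteq> cunit_ball q" "inj_on S W"
  shows "kobayashi_hyperbolic (dom_mfd d W)"
  unfolding kobayashi_hyperbolic_def
proof (intro ballI impI)
  fix x y assume xy: "x \<in> mcarrier (dom_mfd d W)" "y \<in> mcarrier (dom_mfd d W)" "x \<noteq> y"
  then have "S x \<noteq> S y" "S x \<in> cspace q" "S y \<in> cspace q"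
    using S(2,3) cunit_ballD(1) by (auto simp: inj_on_def)
  then obtain i where i: "i < q" "S x i \<noteq> S y i"
    by (auto simp: cspace_def fun_eq_iff) (metis not_less)
  have "cmod (S x i - S y i) \<le> 4 * sum_list (map (\<lambda>(u, a, b). poincare_dist a b) cs)"
    if "disc_chain (dom_mfd d W) x cs y" for cs
    using that
  proof (induction cs arbitrary: x)
    case (Cons c cs)
    obtain u a b where c: "c = (u, a, b)"
      by (cases c)
    have u: "holomorphic_disc (dom_mfd d W) u" "cmod a < 1" "cmod b < 1" "u a = x" "disc_chain (dom_mfd d W) (u b) cs y"
      using Cons.prems by (auto simp: c)
    have hol: "(\<lambda>t. S (u t) i) holomorphic_on ball 0 1"
      by (rule curve_holD[OF S(1) open_ball _ _ i(1)]) (use holomorphic_disc_dom[OF u(1)] in auto)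
    have "cmod (S (u t) i) < 1" if "cmod t < 1" for t
      using cmod_le_cnorm[OF i(1), of "S (u t)"] S(2) holomorphic_disc_dom(1)[OF u(1), of t] cunit_ballD(2) that
      by (auto simp: image_subset_iff intro: order_le_less_trans)
    from dist_le_poincare_dist[OF hol this u(2,3)] Cons.IH[OF u(5)]
    show ?case
      using dist_triangle[of "S x i" "S y i" "S (u b) i"] by (simp add: c u(4) dist_norm)
  qed simp
  then have "ereal (cmod (S x i - S y i) / 4) \<le> kobayashi (dom_mfd d W) x y"
    unfolding kobayashi_def by (intro INF_greatest) (simp add: mult.commute)
  moreover have "0 < ereal (cmod (S x i - S y i) / 4)"
    using i by simp
  ultimately show "0 < kobayashi (dom_mfd d W) x y"
    by (rule less_le_trans[rotated])
qed

text \<open>The involution moves a chain from \<open>w\<close> to \<open>p\<close> so that it ends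
  at the origin. Projecting each disc on a norming vector at its starting point reduces the estimate
  to \<open>artanh_norm_le_poincare\<close>.\<close>

lemma kobayashi_ball_subset:
  assumes p: "p \<in> cunit_ball q"
  shows "kobayashi_ball q p R \<subseteq> {w \<in> cunit_ball q. artanh (cnorm q (ball_mob q p w)) < R}"
proof (rule subsetI, rule CollectI, rule conjI)
  fix w assume w: "w \<in> kobayashi_ball q p R"
  then show "w \<in> cunit_ball q"
    by (simp add: kobayashi_ball_def)
  define \<Phi> where "\<Phi> = ball_mob q p"
  have \<Phi>: "ball_map q \<Phi>"
    unfolding \<Phi>_def by (rule ball_map_ball_mob[OF p])
  have chain: "artanh (cnorm q (\<Phi> x)) \<le> artanh (cnorm q (\<Phi> y)) + (\<Sum>(u, a, b)\<leftarrow>cs. poincare_dist a b)"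
    if "disc_chain (ball_mfd q) x cs y" for x y cs
    using that
  proof (induction cs arbitrary: x)
    case (Cons c cs)
    obtain u a b where c: "c = (u, a, b)"
      by (cases c)
    have u: "holomorphic_disc (dom_mfd q (cunit_ball q)) u" "cmod a < 1" "cmod b < 1" "u a = x" "disc_chain (ball_mfd q) (u b) cs y"
      using Cons.prems by (auto simp: c ball_mfd_eq)
    have uB: "\<Phi> (u t) \<in> cunit_ball q" if "cmod t < 1" for t
      using holomorphic_disc_dom(1)[OF u(1), of t] that by (simp add: ball_mapD[OF \<Phi>])
    obtain v where v: "cnorm q v \<le> 1" "cinner q (\<Phi> (u a)) v = of_real (cnorm q (\<Phi> (u a)))"
      by (rule exists_unit_cvec)
    define \<psi> where "\<psi> t = cinner q (\<Phi> (u t)) v" for t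
    have "\<psi> holomorphic_on ball 0 1"
      unfolding \<psi>_def
      by (rule curve_hol_inner[where c = u, OF \<Phi>[unfolded ball_map_def, THEN conjunct2] open_ball])
        (use holomorphic_disc_dom[OF u(1)] in auto)
    moreover have le: "cmod (\<psi> t) \<le> cnorm q (\<Phi> (u t))" for t
      using order_trans[OF cinner_Cauchy_Schwarz] v(1) unfolding \<psi>_def by (simp add: mult_left_le)
    moreover have "cmod (\<psi> t) < 1" if "cmod t < 1" for t
      using le[of t] cunit_ballD(2)[OF uB[OF that]] by simp
    ultimately have "artanh (cnorm q (\<Phi> (u a))) \<le> artanh (cmod (\<psi> b)) + poincare_dist a b"
      using u(2,3) v(2)[folded \<psi>_def] by (intro artanh_norm_le_poincare) auto
    also have "artanh (cmod (\<psi> b)) \<le> artanh (cnorm q (\<Phi> (u b)))"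
      using le[of b] cunit_ballD(2)[OF uB[OF u(3)]] norm_ge_zero[of "\<psi> b"] cnorm_nonneg[of q "\<Phi> (u b)"]
      by (intro artanh_mono) linarith+
    finally show ?case
      using Cons.IH[OF u(5)] by (simp add: c u(4))
  qed (simp add: ball_mfd_eq)
  obtain cs where "disc_chain (ball_mfd q) w cs p" "(\<Sum>(u, a, b)\<leftarrow>cs. poincare_dist a b) < R"
    using w unfolding kobayashi_ball_def kobayashi_def by (auto simp: INF_less_iff)
  then show "artanh (cnorm q (ball_mob q p w)) < R"
    using chain[of w cs p] ball_mob_self[OF p] by (simp add: \<Phi>_def)
qed

lemma artanh_less_bound:
  obtains r :: real where "r < 1" "\<And>c. 0 \<le> c \<Longrightarrow> c < 1 \<Longrightarrow> artanh c < R \<Longrightarrow> c \<le> r"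
proof
  \<comment> \<open>The radius \<open>(E - 1) / (E + 1)\<close> is the hyperbolic tangent of
    \<open>R\<close>.\<close>
  define E where "E = exp (2 * R)"
  have E: "E > 0"
    by (simp add: E_def)
  then show "(E - 1) / (E + 1) < 1"
    by simp
  fix c :: real assume c: "0 \<le> c" "c < 1" "artanh c < R"
  then have "ln ((1 + c) / (1 - c)) < 2 * R"
    by (simp add: artanh_def)
  then have "exp (ln ((1 + c) / (1 - c))) < E"
    unfolding E_def by (simp only: exp_less_mono)
  then have "(1 + c) / (1 - c) < E"
    using c by simp
  then show "c \<le> (E - 1) / (E + 1)"
    using c E by (simp add: field_simps)
qed

section \<open>The universal property for slices of the ball\<close>

lemma ball_map_curve_hol: "ball_map q F \<Longrightarrow> curve_hol q q (cunit_ball q) F"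
  by (simp add: ball_map_def)

lemma holomorphic_map_imp_ball_map:
  "holomorphic_map (ball_mfd q) (ball_mfd q) F \<Longrightarrow> ball_map q F"
  unfolding ball_mfd_eq holomorphic_map_dom_iff ball_map_def
  using cholomorphic_on_imp_curve_hol by blast

lemma ball_map_imp_cholomorphic_on:
  assumes "ball_map q F"
  shows "cholomorphic_on q q F (cunit_ball q)"
proof (rule curve_hol_imp_cholomorphic_on[OF ball_map_curve_hol[OF assms]])
  show "F ` cunit_ball q \<subseteq> cspace q"
    using ball_mapD[OF assms] cunit_ballD(1) by blast
  fix a assume a: "a \<in> cunit_ball q"
  show "\<exists>s>0. \<exists>M. \<forall>x\<in>cspace q. cnorm q (x - a) < s \<longrightarrow> x \<in> cunit_ball q \<and> cnorm q (F x) \<le> M"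
  proof (rule exI[of _ "1 - cnorm q a"], intro conjI, goal_cases)
    case 1
    then show ?case
      using cunit_ballD(2)[OF a] by simp
  next
    case 2
    have "x \<in> cunit_ball q \<and> cnorm q (F x) \<le> 1" if x: "x \<in> cspace q" "cnorm q (x - a) < 1 - cnorm q a" for x
    proof -
      have "x \<in> cunit_ball q"
        using x cnorm_triangle_sub[of q x a] by (simp add: cunit_ball_def)
      then show ?thesis
        using cunit_ballD(2)[OF ball_mapD[OF assms]] less_imp_le by blast
    qed
    then show ?case
      by blast
  qed
qed (auto simp: cunit_ball_def)

text \<open>
  The universal property is applied to the semi-model with base \<open>V \<inter> B\<close>. Since a chart must map onto
  an open subset of some C^d, the slice is replaced by its preimage \<open>W\<close> under a linear
  parametrisation \<open>S\<close> of \<open>V\<close>.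
\<close>

lemma canonical_semi_model_slice:
  assumes can: "canonical_kobayashi_semi_model q f (ball_mfd q) l \<tau>"
    and V: "cv.subspace V" "V \<subseteq> cspace q"
    and h: "ball_map q h" "\<And>x. x \<in> cunit_ball q \<Longrightarrow> h x \<in> V"
    and \<sigma>: "ball_map q \<sigma>" "\<And>x. x \<in> V \<inter> cunit_ball q \<Longrightarrow> \<sigma> x \<in> V"
    and \<sigma>': "ball_map q \<sigma>'" "\<And>x. x \<in> V \<inter> cunit_ball q \<Longrightarrow> \<sigma>' x \<in> V"
    and inv: "\<And>x. x \<in> V \<inter> cunit_ball q \<Longrightarrow> \<sigma> (\<sigma>' x) = x" "\<And>x. x \<in> V \<inter> cunit_ball q \<Longrightarrow> \<sigma>' (\<sigma> x) = x"
    and hf: "\<And>x. x \<in> cunit_ball q \<Longrightarrow> h (f x) = \<sigma> (h x)"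
    and cover: "\<And>y. y \<in> V \<inter> cunit_ball q \<Longrightarrow> \<exists>n. \<exists>x\<in>cunit_ball q. (\<sigma> ^^ n) y = h x"
  obtains \<theta> where "ball_map q \<theta>" "\<And>x. x \<in> cunit_ball q \<Longrightarrow> \<theta> x \<in> V"
    "\<And>x. x \<in> cunit_ball q \<Longrightarrow> \<theta> (l x) = h x" "\<And>x. x \<in> cunit_ball q \<Longrightarrow> \<theta> (\<tau> x) = \<sigma> (\<theta> x)"
proof -
  obtain d S C where S: "clinear S" "\<And>w. S w \<in> V" and C: "clinear C" "\<And>x. C x \<in> cspace d"
    and SC: "\<And>x. x \<in> V \<Longrightarrow> S (C x) = x" "\<And>w. w \<in> cspace d \<Longrightarrow> C (S w) = w"
    by (rule subspace_coordinates[OF V]) blast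
  define B where "B = cunit_ball q"
  define W where "W = {w \<in> cspace d. S w \<in> B}"
  have Bq: "B \<subseteq> cspace q"
    by (auto simp: B_def cunit_ball_def)
  have Wd: "W \<subseteq> cspace d" and SW: "S ` W \<subseteq> B"
    by (auto simp: W_def)
  have CW: "C x \<in> W" if "x \<in> V" "x \<in> B" for x
    using that SC C by (simp add: W_def)
  obtain KS where KS: "KS > 0" "\<And>w. w \<in> cspace d \<Longrightarrow> cnorm q (S w) \<le> KS * cnorm d w"
    using clinear_bounded[OF S(1), of d q] by blast
  obtain KC where KC: "KC > 0" "\<And>x. x \<in> cspace q \<Longrightarrow> cnorm d (C x) \<le> KC * cnorm q x"
    using clinear_bounded[OF C(1), of q d] by blast
  \<comment> \<open>Boundedness in coordinates is what \<open>holomorphic_map_domI\<close> asks of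
    the target domain.\<close>
  have Wbd: "cnorm d w \<le> KC" if w: "w \<in> W" for w
  proof -
    have "cnorm d w = cnorm d (C (S w))"
      using w SC(2) by (simp add: W_def)
    also have "\<dots> \<le> KC * cnorm q (S w)"
      using w Bq by (intro KC(2)) (auto simp: W_def)
    also have "\<dots> \<le> KC * 1"
      using w KC(1) cunit_ballD(2)[of "S w" q] by (intro mult_left_mono) (auto simp: W_def B_def)
    finally show ?thesis by simp
  qed
  interpret S: Vector_Spaces.linear cscale cscale S by fact
  have Wop: "\<exists>s>0. \<forall>x\<in>cspace d. cnorm d (x - a) < s \<longrightarrow> x \<in> W" if a: "a \<in> W" for a
  proof (intro exI[of _ "(1 - cnorm q (S a)) / KS"] conjI ballI impI)
    have a1: "cnorm q (S a) < 1"
      using a cunit_ballD(2) by (auto simp: W_def B_def)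
    then show "0 < (1 - cnorm q (S a)) / KS"
      using KS(1) by simp
    fix x assume x: "x \<in> cspace d" "cnorm d (x - a) < (1 - cnorm q (S a)) / KS"
    have "x - a \<in> cspace d"
      using x a Wd by auto
    then have "cnorm q (S (x - a)) \<le> KS * cnorm d (x - a)"
      by (rule KS(2))
    also have "\<dots> < 1 - cnorm q (S a)"
      using x(2) KS(1) by (simp add: pos_less_divide_eq mult.commute)
    finally have "cnorm q (S x) < 1"
      using cnorm_triangle_sub[of q "S x" "S a"] by (simp add: S.diff)
    then show "x \<in> W"
      using x S(2) V(2) by (auto simp: W_def B_def cunit_ball_def)
  qed
  have Bop: "\<exists>s>0. \<forall>x\<in>cspace q. cnorm q (x - a) < s \<longrightarrow> x \<in> B" if a: "a \<in> B" for a
  proof (intro exI[of _ "1 - cnorm q a"] conjI ballI impI)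
    show "0 < 1 - cnorm q a"
      using a by (simp add: B_def cunit_ball_def)
    fix x assume "x \<in> cspace q" "cnorm q (x - a) < 1 - cnorm q a"
    then show "x \<in> B"
      using cnorm_triangle_sub[of q x a] by (simp add: B_def cunit_ball_def)
  qed
  \<comment> \<open>Openness in the topology, as required of a chart; \<open>Wop\<close> expresses
    it by norm balls for the differentiability lemmas.\<close>
  have openW: "openin (top_of_set (cspace d)) W"
  proof -
    have "continuous_on (cspace d) S"
    proof (rule curve_hol_continuous_on[OF clinear_curve_hol[OF S(1) order_refl] order_refl])
      show "S ` cspace d \<subseteq> cspace q"
        using S(2) V(2) by blast
      fix a assume "a \<in> cspace d"
      then show "\<exists>s>0. \<exists>M. \<forall>x\<in>cspace d. cnorm d (x - a) < s \<longrightarrow> x \<in> cspace d \<and> cnorm q (S x) \<le> M"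
      proof -
        have "cnorm q (S x) \<le> KS * (1 + cnorm d a)" if x: "x \<in> cspace d" "cnorm d (x - a) < 1" for x
        proof -
          have "cnorm q (S x) \<le> KS * cnorm d x"
            by (rule KS(2)[OF x(1)])
          also have "\<dots> \<le> KS * (1 + cnorm d a)"
            using cnorm_triangle_sub[of d x a] x(2) KS(1) by (intro mult_left_mono) auto
          finally show ?thesis .
        qed
        then show ?thesis
          using zero_less_one by blast
      qed
    qed
    moreover have "S \<in> cspace d \<rightarrow> cspace q"
      using S(2) V(2) by blast
    ultimately have "openin (top_of_set (cspace d)) (cspace d \<inter> S -` B)"
      unfolding B_def using open_cunit_ball_in_cspace continuous_openin_preimage by blast
    moreover have "cspace d \<inter> S -` B = W"
      by (auto simp: W_def)
    ultimately show ?thesis by simp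
  qed
  have Shol: "curve_hol d q W S"
    by (rule clinear_curve_hol[OF S(1) Wd])
  have Chol: "curve_hol q d B C"
    by (rule clinear_curve_hol[OF C(1) Bq])
  have VB: "S w \<in> V \<inter> B" if "w \<in> W" for w
    using that S(2) by (auto simp: W_def)
  have lift: "holomorphic_map (dom_mfd d W) (dom_mfd d W) (\<lambda>w. C (F (S w)))"
    if F: "ball_map q F" "\<And>x. x \<in> V \<inter> cunit_ball q \<Longrightarrow> F x \<in> V" for F
  proof (rule holomorphic_map_domI[OF _ Wd _ Wd Wop Wbd])
    have F': "F ` B \<subseteq> B" "curve_hol q q B F"
      using F(1) by (auto simp: ball_map_def B_def)
    have "curve_hol d q W (\<lambda>w. F (S w))"
      by (rule curve_hol_comp[OF Shol F'(2) SW])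
    moreover have "(\<lambda>w. F (S w)) ` W \<subseteq> B"
      using F'(1) SW by blast
    ultimately show "curve_hol d d W (\<lambda>w. C (F (S w)))"
      by (rule curve_hol_comp[OF _ Chol])
    show "(\<lambda>w. C (F (S w))) ` W \<subseteq> W"
    proof (rule image_subsetI)
      fix w assume "w \<in> W"
      from VB[OF this] show "C (F (S w)) \<in> W"
        using F(2) F'(1) by (intro CW) (auto simp: B_def)
    qed
  qed
  define \<phi> where "\<phi> w = C (\<sigma> (S w))" for w
  define \<phi>' where "\<phi>' w = C (\<sigma>' (S w))" for w
  have \<phi>W: "\<phi> w \<in> W" "\<phi>' w \<in> W" "\<phi> (\<phi>' w) = w" "\<phi>' (\<phi> w) = w" and S\<phi>: "S (\<phi> w) = \<sigma> (S w)" if w: "w \<in> W" for w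
  proof -
    have Sw: "S w \<in> V \<inter> cunit_ball q"
      using VB[OF w] by (simp add: B_def)
    have 1: "\<sigma> (S w) \<in> V" "\<sigma> (S w) \<in> B" "\<sigma>' (S w) \<in> V" "\<sigma>' (S w) \<in> B"
      using Sw \<sigma>(2) \<sigma>'(2) ball_mapD[OF \<sigma>(1)] ball_mapD[OF \<sigma>'(1)] unfolding B_def by blast+
    show "\<phi> w \<in> W" "\<phi>' w \<in> W"
      unfolding \<phi>_def \<phi>'_def by (intro CW 1)+
    show "S (\<phi> w) = \<sigma> (S w)"
      unfolding \<phi>_def by (rule SC(1)[OF 1(1)])
    have "C (S w) = w"
      using w Wd by (intro SC(2)) blast
    then show "\<phi> (\<phi>' w) = w" "\<phi>' (\<phi> w) = w"
      unfolding \<phi>_def \<phi>'_def SC(1)[OF 1(1)] SC(1)[OF 1(3)] inv(1)[OF Sw] inv(2)[OF Sw] by assumption+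
  qed
  have bij: "bij_betw \<phi> W W"
    by (rule bij_betw_byWitness[of _ \<phi>']) (use \<phi>W(1-4) in \<open>simp_all add: image_subset_iff\<close>)
  \<comment> \<open>\<open>biholomorphic_map\<close> refers to \<open>inv_into\<close>, which is
    identified with \<open>\<phi>'\<close> on \<open>W\<close> only; holomorphy is therefore
    transferred by congruence.\<close>
  have inv_eq: "\<phi>' w = inv_into W \<phi> w" if "w \<in> W" for w
    by (rule inv_into_f_eq[of \<phi> W "\<phi>' w" w, OF bij_betw_imp_inj_on[OF bij] \<phi>W(2)[OF that] \<phi>W(3)[OF that], symmetric])
  have "holomorphic_map (dom_mfd d W) (dom_mfd d W) \<phi>'"
    unfolding \<phi>'_def by (rule lift[OF \<sigma>'])
  then have "continuous_on W \<phi>'" "cholomorphic_on d d \<phi>' W"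
    by (simp_all only: holomorphic_map_dom_iff)
  note continuous_on_eq[OF this(1) inv_eq] cholomorphic_on_cong[OF this(2) inv_eq]
  moreover have "inv_into W \<phi> ` W \<subseteq> W"
    by (simp add: image_subset_iff inv_eq[symmetric] \<phi>W(2))
  ultimately have "holomorphic_map (dom_mfd d W) (dom_mfd d W) (inv_into W \<phi>)"
    by (simp only: holomorphic_map_dom_iff)
  moreover have "holomorphic_map (dom_mfd d W) (dom_mfd d W) \<phi>"
    unfolding \<phi>_def by (rule lift[OF \<sigma>])
  ultimately have aut: "automorphism (dom_mfd d W) \<phi>"
    using bij by (simp add: biholomorphic_map_def)
  define H where "H x = C (h x)" for x
  have hB: "h ` B \<subseteq> B" "curve_hol q q B h"
    using h(1) by (auto simp: ball_map_def B_def)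
  have HW: "H x \<in> W" "S (H x) = h x" if "x \<in> B" for x
    using h that hB CW SC(1) by (auto simp: H_def B_def)
  have Hhol: "holomorphic_map (dom_mfd q B) (dom_mfd d W) H"
  proof (rule holomorphic_map_domI[OF _ Bq _ Wd Bop Wbd])
    show "curve_hol q d B H"
      unfolding H_def by (rule curve_hol_comp[OF hB(2) Chol hB(1)])
  qed (use HW in auto)
  have S\<phi>n: "(\<phi> ^^ n) w \<in> W \<and> S ((\<phi> ^^ n) w) = (\<sigma> ^^ n) (S w)" if "w \<in> W" for n w
    using that by (induction n) (auto simp: \<phi>W S\<phi>)
  have cov: "w \<in> (\<Union>n. {x \<in> W. (\<phi> ^^ n) x \<in> H ` B})" if w: "w \<in> W" for w
  proof -
    obtain n x where nx: "x \<in> B" "(\<sigma> ^^ n) (S w) = h x"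
      using cover[OF VB[OF w, unfolded B_def]] unfolding B_def by blast
    have "(\<phi> ^^ n) w \<in> cspace d"
      using S\<phi>n[OF w] Wd by blast
    from SC(2)[OF this, symmetric] have "(\<phi> ^^ n) w = C (S ((\<phi> ^^ n) w))" .
    also have "\<dots> = H x"
      using S\<phi>n[OF w] nx by (simp add: H_def)
    finally show ?thesis
      using w nx(1) by auto
  qed
  have "semi_model q f (dom_mfd d W) H \<phi>"
    unfolding semi_model_def ball_mfd_eq
  proof (intro conjI ballI)
    show "complex_manifold (dom_mfd d W)"
      by (rule complex_manifold_dom_mfd[OF openW])
    show "holomorphic_map (dom_mfd q (cunit_ball q)) (dom_mfd d W) H"
      using Hhol by (simp add: B_def)
    show "H (f x) = \<phi> (H x)" if "x \<in> cunit_ball q" for x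
      using hf[OF that] HW that by (simp add: \<phi>_def B_def) (simp add: H_def)
    show "(\<Union>n. {x \<in> mcarrier (dom_mfd d W). (\<phi> ^^ n) x \<in> H ` cunit_ball q}) = mcarrier (dom_mfd d W)"
      using cov by (auto simp: B_def)
  qed (rule aut)
  moreover have "inj_on S W"
    using SC(2) Wd by (intro inj_on_inverseI[of _ C]) auto
  then have "kobayashi_hyperbolic (dom_mfd d W)"
    using Shol SW by (intro kobayashi_hyperbolic_dom_mfd) (simp_all add: B_def)
  ultimately obtain \<eta> where \<eta>: "holomorphic_map (dom_mfd q B) (dom_mfd d W) \<eta>"
      "\<And>x. x \<in> B \<Longrightarrow> \<eta> (l x) = H x" "\<And>x. x \<in> B \<Longrightarrow> \<eta> (\<tau> x) = \<phi> (\<eta> x)"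
    using can unfolding canonical_kobayashi_semi_model_def ball_mfd_eq mcarrier_dom_mfd B_def by blast
  have \<eta>W: "\<eta> ` B \<subseteq> W" and "curve_hol q d B \<eta>"
    using \<eta>(1) cholomorphic_on_imp_curve_hol unfolding holomorphic_map_dom_iff by auto
  from curve_hol_comp[OF this(2) Shol \<eta>W]
  have "ball_map q (\<lambda>x. S (\<eta> x))"
    unfolding ball_map_def B_def[symmetric] using \<eta>W SW by (simp add: image_subset_iff)
  moreover have "S (\<eta> (\<tau> x)) = \<sigma> (S (\<eta> x))" if "x \<in> B" for x
    using \<eta>(3)[OF that] S\<phi> \<eta>W that by (simp add: image_subset_iff)
  moreover have "S (\<eta> (l x)) = h x" if "x \<in> B" for x
    using \<eta>(2)[OF that] HW(2)[OF that] by simp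
  ultimately show ?thesis
    using that[of "\<lambda>x. S (\<eta> x)"] S(2) by (simp add: B_def)
qed

text \<open>Differentiating \<open>g (\<theta> y) = y\<close> at the origin gives \<open>q\<close> independent vectors in \<open>V\<close>.\<close>

lemma section_in_subspace_imp_full:
  assumes \<theta>: "ball_map q \<theta>" and g: "ball_map q g" and g\<theta>: "\<And>y. y \<in> cunit_ball q \<Longrightarrow> g (\<theta> y) = y"
    and V: "V = {x \<in> cspace q. \<forall>i<q. (\<Sum>k<q. P i k * x k) = x i}" "cv.subspace V"
    and \<theta>V: "\<And>y. y \<in> cunit_ball q \<Longrightarrow> \<theta> y \<in> V"
  shows "V = cspace q"
proof -
  \<comment> \<open>The columns of the derivative of \<open>\<theta>\<close> at the origin, set to
    \<open>0\<close> beyond \<open>q\<close> so that they lie in \<open>cspace q\<close>.\<close>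
  define E where "E j = (\<lambda>i. if i < q then deriv (\<lambda>t. \<theta> (cscale t (cunit j)) i) 0 else 0)" for j
  have line: "cscale t (cunit j) \<in> cunit_ball q" if "t \<in> ball 0 1" "j < q" for t j
    using that by (simp add: cunit_ball_def cnorm_cunit cunit_in_cspace)
  have E: "((\<lambda>t. \<theta> (cscale t (cunit j)) i) has_field_derivative E j i) (at 0)" if "j < q" "i < q" for i j
  proof -
    have "(\<lambda>t. \<theta> (cscale t (cunit j)) i) holomorphic_on ball 0 1"
      by (rule curve_holD[where c = "\<lambda>t. cscale t (cunit j)", OF ball_map_curve_hol[OF \<theta>] open_ball line[OF _ that(1)] _ that(2)])
        (auto intro!: holomorphic_intros)
    from holomorphic_derivI[OF this open_ball, of 0] show ?thesis
      using that by (simp add: E_def)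
  qed
  have EV: "E j \<in> V" if j: "j < q" for j
  proof -
    have "(\<Sum>k<q. P i k * E j k) = E j i" if i: "i < q" for i
    proof (rule DERIV_unique)
      show "((\<lambda>t. \<Sum>k<q. P i k * \<theta> (cscale t (cunit j)) k) has_field_derivative (\<Sum>k<q. P i k * E j k)) (at 0)"
        by (intro DERIV_sum DERIV_cmult) (use E j in auto)
      show "((\<lambda>t. \<Sum>k<q. P i k * \<theta> (cscale t (cunit j)) k) has_field_derivative E j i) (at 0)"
        by (rule has_field_derivative_transform_within[OF E[OF j i], of 1])
          (use \<theta>V line[OF _ j] i in \<open>auto simp: V(1)\<close>)
    qed
    then show ?thesis
      by (simp add: V(1)) (simp add: E_def cspace_def)
  qed
  have "\<theta> 0 \<in> cunit_ball q"
    using ball_mapD[OF \<theta>] by simp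
  then obtain A where A: "frechet_at q q g (cunit_ball q) (\<theta> 0) A"
    using ball_map_imp_cholomorphic_on[OF g] unfolding cholomorphic_on_frechet by blast
  show ?thesis
  proof (rule subspace_eq_cspace[OF V(2) _ EV])
    fix i j assume ij: "i < q" "j < q"
    \<comment> \<open>Chain rule for \<open>g (\<theta> y) = y\<close>: the derivative of
      \<open>g\<close> at \<open>\<theta> 0\<close> sends the columns \<open>E j\<close> to the unit
      vectors.\<close>
    show "(\<Sum>k<q. A i k * E j k) = (if i = j then 1 else 0)"
    proof (rule DERIV_unique)
      have c0: "cscale 0 (cunit j) = 0"
        by (rule cv.scale_zero_left)
      show "((\<lambda>t. g (\<theta> (cscale t (cunit j))) i) has_field_derivative (\<Sum>k<q. A i k * E j k)) (at 0)"
        by (rule frechet_curve_derivative[where c = "\<lambda>t. \<theta> (cscale t (cunit j))" and U = "ball 0 1", OF _ open_ball _ _ E[OF ij(2)] ij(1)])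
          (use A ball_mapD[OF \<theta> line[OF _ ij(2)]] in \<open>simp_all only: c0 centre_in_ball zero_less_one\<close>)
      have "((\<lambda>t. t * cunit j i) has_field_derivative cunit j i) (at 0)"
        by (auto intro!: derivative_eq_intros)
      then show "((\<lambda>t. g (\<theta> (cscale t (cunit j))) i) has_field_derivative (if i = j then 1 else 0)) (at 0)"
        by (rule has_field_derivative_transform_within[where d = 1, THEN DERIV_cong])
          (use g\<theta> line[OF _ ij(2)] in \<open>auto simp: cunit_def\<close>)
    qed
  qed (use V(1) in auto)
qed

section \<open>Limits along an orbit\<close>

context
  fixes q :: nat and f :: "cvec \<Rightarrow> cvec" and z :: cvec
  assumes f: "ball_map q f" and z: "z \<in> cunit_ball q"
begin

definition recentre :: "nat \<Rightarrow> cvec \<Rightarrow> cvec"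
  where "recentre m = ball_mob q ((f ^^ m) z)"

lemma orbit_in_ball: "x \<in> cunit_ball q \<Longrightarrow> (f ^^ m) x \<in> cunit_ball q"
  by (rule ball_mapD[OF ball_map_funpow[OF f]])

lemma recentre:
  "ball_map q (recentre m)" "recentre m 0 = (f ^^ m) z" "recentre m ((f ^^ m) z) = 0"
  "x \<in> cunit_ball q \<Longrightarrow> recentre m (recentre m x) = x"
  using orbit_in_ball[OF z, of m]
  by (simp_all add: recentre_def ball_map_ball_mob ball_mob_0 ball_mob_self ball_mob_involution)

text \<open>
  Cones are the holomorphic maps out of the direct system \<open>B \<rightarrow> B \<rightarrow> \<dots>\<close> with all arrows equal to \<open>f\<close>;
  through \<open>cone_factor\<close>, a limit cone plays the role of its hyperbolic direct limit.
\<close>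

definition cone :: "(nat \<Rightarrow> cvec \<Rightarrow> cvec) \<Rightarrow> bool"
  where "cone \<beta> \<longleftrightarrow> (\<forall>j. ball_map q (\<beta> j)) \<and> (\<forall>j. \<forall>x\<in>cunit_ball q. \<beta> (Suc j) (f x) = \<beta> j x)"

lemma cone_iterate:
  assumes "cone \<beta>" "x \<in> cunit_ball q"
  shows "\<beta> (j + n) ((f ^^ n) x) = \<beta> j x"
  using assms by (induction n) (auto simp: cone_def orbit_in_ball)

lemma cone_late:
  assumes "cone \<beta>" "x \<in> cunit_ball q" "j \<le> m"
  shows "\<beta> m ((f ^^ (m - j)) x) = \<beta> j x"
  using cone_iterate[OF assms(1,2), of j "m - j"] assms(3) by simp

text \<open>The exponent \<open>m k - j\<close> is a truncated difference; along a strictly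
  increasing \<open>m\<close> it is the true difference for all large \<open>k\<close>.\<close>

definition limit_cone :: "(nat \<Rightarrow> nat) \<Rightarrow> (nat \<Rightarrow> cvec \<Rightarrow> cvec) \<Rightarrow> bool"
  where "limit_cone m \<alpha> \<longleftrightarrow> cone \<alpha> \<and> \<alpha> 0 z = 0 \<and>
    (\<forall>j. \<forall>x\<in>cunit_ball q. cconv q (\<lambda>k. recentre (m k) ((f ^^ (m k - j)) x)) (\<alpha> j x))"

lemma limit_cone_subseq: "limit_cone m \<alpha> \<Longrightarrow> strict_mono r \<Longrightarrow> limit_cone (\<lambda>k. m (r k)) \<alpha>"
  unfolding limit_cone_def using cconv_subseq[of q "\<lambda>k. recentre (m k) ((f ^^ (m k - _)) _)"] by blast

text \<open>For large \<open>k\<close> the approximating maps send \<open>(f ^^ j) z\<close> exactly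
  to the origin, which keeps their limits inside the open ball. They also satisfy the cone relation
  exactly from some index on, so the limits inherit it.\<close>

lemma limit_cone_exists:
  assumes b: "strict_mono (b :: nat \<Rightarrow> nat)"
  obtains r \<alpha> where "strict_mono (r :: nat \<Rightarrow> nat)" "limit_cone (\<lambda>k. b (r k)) \<alpha>"
proof -
  define F where "F j k x = recentre (b k) ((f ^^ (b k - j)) x)" for j k x
  have F: "ball_map q (F j k)" for j k
    unfolding F_def by (rule ball_map_comp[OF ball_map_funpow[OF f] recentre(1)])
  obtain r G where r: "strict_mono (r :: nat \<Rightarrow> nat)"
    and "\<forall>j. \<forall>x\<in>cunit_ball q. G j x \<in> cspace q \<and> cconv q (\<lambda>k. F j (r k) x) (G j x)"
    by (rule ball_map_convergent_subsequence[of q F, OF F])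
  note G = this(2)[rule_format]
  have br: "strict_mono (\<lambda>k. b (r k))"
    using strict_mono_o[OF b r] by (simp add: o_def)
  have ev: "eventually (\<lambda>k. j \<le> b (r k)) sequentially" for j
    using eventually_ge_at_top[of j]
  proof eventually_elim
    case (elim k)
    then show ?case
      using seq_suble[OF br, of k] by simp
  qed
  have uniq: "G j x = y" if "x \<in> cunit_ball q" "y \<in> cspace q" "eventually (\<lambda>k. F j (r k) x = Y k) sequentially" "cconv q Y y" for j x y Y
  proof (rule cconv_unique[OF _ that(4)])
    show "cconv q Y (G j x)"
      by (rule cconv_eventually_eq[OF conjunct2[OF G[OF that(1)]] that(3)])
  qed (use G[OF that(1), of j] that(2) in simp_all)
  have zero: "G j ((f ^^ j) z) = 0" for j
  proof (rule uniq[OF orbit_in_ball[OF z]])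
    show "eventually (\<lambda>k. F j (r k) ((f ^^ j) z) = 0) sequentially"
      using ev[of j]
    proof eventually_elim
      case (elim k)
      then have "(f ^^ (b (r k) - j)) ((f ^^ j) z) = (f ^^ b (r k)) z"
        using funpow_add[of "b (r k) - j" j f] by (simp add: fun_eq_iff)
      then show ?case
        by (simp add: F_def recentre(3))
    qed
  qed simp_all
  have ball: "ball_map q (G j)" for j
  proof (rule ball_map_limit[OF F conjunct2[OF G] conjunct1[OF G] orbit_in_ball[OF z]])
    show "cnorm q (G j ((f ^^ j) z)) < 1"
      unfolding zero cnorm_zero by simp
  qed
  have "G (Suc j) (f x) = G j x" if x: "x \<in> cunit_ball q" for j x
  proof (rule uniq[OF ball_mapD[OF f x]])
    show "eventually (\<lambda>k. F (Suc j) (r k) (f x) = F j (r k) x) sequentially"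
      using ev[of "Suc j"]
    proof eventually_elim
      case (elim k)
      then have "b (r k) - j = Suc (b (r k) - Suc j)"
        by simp
      then show ?case
        unfolding F_def by (simp only: funpow_Suc_right o_apply)
    qed
  qed (use G[OF x] in blast)+
  then have "cone G"
    using ball unfolding cone_def by blast
  moreover have "G 0 z = 0"
    using zero[of 0] by simp
  ultimately have "limit_cone (\<lambda>k. b (r k)) G"
    using G unfolding limit_cone_def F_def by blast
  then show ?thesis
    using that r by blast
qed

text \<open>At the origin the maps \<open>F k\<close> have the constant value
  \<open>\<beta> 0 z\<close>, which keeps the limit \<open>g\<close> in the ball. Evaluated at
  points tending to \<open>\<alpha> j x\<close>, the involution cancels and the cone relation leaves
  \<open>\<beta> j x\<close>.\<close>

lemma cone_factor:
  assumes \<alpha>: "limit_cone m \<alpha>" and m: "strict_mono (m :: nat \<Rightarrow> nat)" and \<beta>: "cone \<beta>"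
  obtains r g where "strict_mono (r :: nat \<Rightarrow> nat)" "ball_map q g" "g 0 = \<beta> 0 z"
    "\<And>x. x \<in> cunit_ball q \<Longrightarrow> cconv q (\<lambda>k. \<beta> (m (r k)) (recentre (m (r k)) x)) (g x)"
    "\<And>j x. x \<in> cunit_ball q \<Longrightarrow> g (\<alpha> j x) = \<beta> j x"
proof -
  define F where "F k x = \<beta> (m k) (recentre (m k) x)" for k x
  have \<beta>b: "ball_map q (\<beta> j)" for j
    using \<beta> by (simp add: cone_def)
  have F: "ball_map q (F k)" for k
    unfolding F_def by (rule ball_map_comp[OF recentre(1) \<beta>b])
  obtain r G where r: "strict_mono (r :: nat \<Rightarrow> nat)"
    and "\<forall>j::nat. \<forall>x\<in>cunit_ball q. G j x \<in> cspace q \<and> cconv q (\<lambda>k. F (r k) x) (G j x)"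
    by (rule ball_map_convergent_subsequence[of q "\<lambda>j. F", OF F])
  note G = this(2)[rule_format]
  define g where "g = G 0"
  have g: "g x \<in> cspace q" "cconv q (\<lambda>k. F (r k) x) (g x)" if "x \<in> cunit_ball q" for x
    using G[OF that] by (simp_all add: g_def)
  have F0: "F k 0 = \<beta> 0 z" for k
    using cone_late[OF \<beta> z, of 0 "m k"] by (simp add: F_def recentre(2))
  have \<beta>0: "\<beta> 0 z \<in> cunit_ball q"
    by (rule ball_mapD[OF \<beta>b z])
  have g0: "g 0 = \<beta> 0 z"
    using cconv_unique[OF g(2)[of 0, unfolded F0] cconv_const] g(1)[of 0] cunit_ballD(1)[OF \<beta>0] by simp
  have gb: "ball_map q g"
    by (rule ball_map_limit[of q "\<lambda>k. F (r k)", OF F g(2) g(1) zero_in_cunit_ball])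
      (use g0 cunit_ballD(2)[OF \<beta>0] in simp_all)
  have mr: "strict_mono (\<lambda>k. m (r k))"
    using strict_mono_o[OF m r] by (simp add: o_def)
  have "g (\<alpha> j x) = \<beta> j x" if x: "x \<in> cunit_ball q" for j x
  proof -
    define X where "X k = recentre (m (r k)) ((f ^^ (m (r k) - j)) x)" for k
    have X: "X k \<in> cunit_ball q" for k
      unfolding X_def by (rule ball_mapD[OF recentre(1) orbit_in_ball[OF x]])
    have X\<alpha>: "cconv q X (\<alpha> j x)"
      using limit_cone_subseq[OF \<alpha> r] x unfolding limit_cone_def X_def by blast
    have \<alpha>x: "\<alpha> j x \<in> cunit_ball q"
      using \<alpha> x unfolding limit_cone_def cone_def by (blast intro: ball_mapD)
    have "cconv q (\<lambda>k. F (r k) (X k)) (g (\<alpha> j x))"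
      by (rule cconv_ball_map[OF F \<alpha>x X X\<alpha> g(2)[OF \<alpha>x]])
    moreover have "eventually (\<lambda>k. F (r k) (X k) = \<beta> j x) sequentially"
      using eventually_ge_at_top[of j]
    proof eventually_elim
      case (elim k)
      then have "j \<le> m (r k)"
        using seq_suble[OF mr, of k] by simp
      then show ?case
        unfolding F_def X_def recentre(4)[OF orbit_in_ball[OF x]] by (rule cone_late[OF \<beta> x])
    qed
    ultimately have "cconv q (\<lambda>k. \<beta> j x) (g (\<alpha> j x))"
      by (rule cconv_eventually_eq)
    then show ?thesis
      by (rule cconv_unique[OF _ cconv_const]) (use g(1)[OF \<alpha>x] cunit_ballD(1)[OF ball_mapD[OF \<beta>b x]] in auto)
  qed
  then show ?thesis
    using that[OF r gb g0] g(2) unfolding F_def by blast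
qed

text \<open>
  Here \<open>\<theta> \<circ> \<tau>^-n \<circ> l = \<alpha> n\<close>, so \<open>l\<close> is injective wherever \<open>\<alpha> n\<close> is; and \<open>\<alpha> n \<circ> recentre n\<close> tends to
  the identity along a subsequence.
\<close>

lemma inj_on_recentred_ball:
  assumes can: "canonical_kobayashi_semi_model q f (ball_mfd q) l \<tau>"
    and b: "strict_mono (b :: nat \<Rightarrow> nat)" and R: "R < 1"
  shows "\<exists>k. inj_on l {w \<in> cunit_ball q. cnorm q (recentre (b k) w) \<le> R}"
proof -
  let ?B = "cunit_ball q"
  obtain r1 \<alpha> where r1: "strict_mono (r1 :: nat \<Rightarrow> nat)" and lc1: "limit_cone (\<lambda>k. b (r1 k)) \<alpha>"
    by (rule limit_cone_exists[OF b])
  have cone\<alpha>: "cone \<alpha>" and \<alpha>0: "\<alpha> 0 z = 0"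
    using lc1 by (auto simp: limit_cone_def)
  have \<alpha>: "ball_map q (\<alpha> j)" and \<alpha>f: "\<And>x. x \<in> ?B \<Longrightarrow> \<alpha> (Suc j) (f x) = \<alpha> j x" for j
    using cone\<alpha> by (auto simp: cone_def)
  have b1: "strict_mono (\<lambda>k. b (r1 k))"
    using strict_mono_o[OF b r1] by (simp add: o_def)
  \<comment> \<open>The cone \<open>\<alpha>\<close> is factored through itself along a further
    subsequence, so \<open>\<rho>\<close> is both the limit of the maps \<open>F k\<close> below and
    the identity on every image of \<open>\<alpha>\<close>.\<close>
  obtain r2 \<rho> where r2: "strict_mono (r2 :: nat \<Rightarrow> nat)" and \<rho>: "ball_map q \<rho>" and \<rho>0: "\<rho> 0 = \<alpha> 0 z"
    and \<rho>lim: "\<And>x. x \<in> ?B \<Longrightarrow> cconv q (\<lambda>k. \<alpha> (b (r1 (r2 k))) (recentre (b (r1 (r2 k))) x)) (\<rho> x)"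
    and \<rho>\<alpha>: "\<And>j x. x \<in> ?B \<Longrightarrow> \<rho> (\<alpha> j x) = \<alpha> j x"
    by (rule cone_factor[OF lc1 b1 cone\<alpha>]) blast
  define m where "m k = b (r1 (r2 k))" for k
  have m: "strict_mono m"
    using strict_mono_o[OF b1 r2] by (simp add: o_def m_def[abs_def])
  have lc: "limit_cone m \<alpha>"
    using limit_cone_subseq[OF lc1 r2] by (simp add: m_def[abs_def])
  define F where "F k x = \<alpha> (m k) (recentre (m k) x)" for k x
  have F: "ball_map q (F k)" for k
    unfolding F_def by (rule ball_map_comp[OF recentre(1) \<alpha>])
  have Flim: "cconv q (\<lambda>k. F k x) (\<rho> x)" if "x \<in> ?B" for x
    using \<rho>lim[OF that] by (simp add: F_def m_def)

  \<comment> \<open>Shifting the direct system by one step in either direction gives two more cones;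
    the induced maps \<open>\<sigma>\<close> and \<open>\<sigma>'\<close> are mutually inverse on
    the images of \<open>\<alpha>\<close>.\<close>
  have cone_f: "cone (\<lambda>j x. \<alpha> j (f x))"
    unfolding cone_def using ball_map_comp[OF f \<alpha>] \<alpha>f ball_mapD[OF f] by simp
  obtain \<sigma> where \<sigma>: "ball_map q \<sigma>" "\<And>j x. x \<in> ?B \<Longrightarrow> \<sigma> (\<alpha> j x) = \<alpha> j (f x)"
    by (rule cone_factor[OF lc m cone_f]) blast
  have cone_Suc: "cone (\<lambda>j. \<alpha> (Suc j))"
    unfolding cone_def using \<alpha> \<alpha>f by simp
  obtain \<sigma>' where \<sigma>': "ball_map q \<sigma>'" "\<And>j x. x \<in> ?B \<Longrightarrow> \<sigma>' (\<alpha> j x) = \<alpha> (Suc j) x"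
    by (rule cone_factor[OF lc m cone_Suc]) blast

  define \<tau>' where "\<tau>' = inv_into ?B \<tau>"
  have sm: "holomorphic_map (ball_mfd q) (ball_mfd q) l" "automorphism (ball_mfd q) \<tau>"
    "\<And>x. x \<in> ?B \<Longrightarrow> l (f x) = \<tau> (l x)" "(\<Union>n. {x \<in> ?B. (\<tau> ^^ n) x \<in> l ` ?B}) = ?B"
    using can unfolding canonical_kobayashi_semi_model_def semi_model_def
    by (simp_all add: ball_mfd_eq)
  have l: "ball_map q l"
    by (rule holomorphic_map_imp_ball_map[OF sm(1)])
  have bij: "bij_betw \<tau> ?B ?B" and \<tau>: "ball_map q \<tau>" and \<tau>': "ball_map q \<tau>'"
    using sm(2) holomorphic_map_imp_ball_map unfolding biholomorphic_map_def \<tau>'_def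
    by (auto simp: ball_mfd_eq)
  have \<tau>\<tau>': "\<tau> (\<tau>' x) = x" and \<tau>'\<tau>: "\<tau>' (\<tau> x) = x" if "x \<in> ?B" for x
    using bij that by (auto simp: \<tau>'_def bij_betw_inv_into_right bij_betw_inv_into_left)
  define L where "L j x = (\<tau>' ^^ j) (l x)" for j x
  have L: "ball_map q (L j)" for j
    unfolding L_def by (rule ball_map_comp[OF l ball_map_funpow[OF \<tau>']])
  have "L (Suc j) (f x) = L j x" if "x \<in> ?B" for j x
    unfolding L_def funpow_Suc_right o_apply sm(3)[OF that] \<tau>'\<tau>[OF ball_mapD[OF l that]] ..
  then have coneL: "cone L"
    using L by (simp add: cone_def)
  have \<tau>L: "\<tau> (L (Suc j) x) = L j x" if "x \<in> ?B" for j x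
    using \<tau>\<tau>'[OF ball_mapD[OF L that], of j] by (simp add: L_def)
  \<comment> \<open>With \<open>\<tau>\<close> inverted, the covering condition of the semi-model
    says that the images of the maps \<open>L n\<close> exhaust the ball.\<close>
  have Lcover: "\<exists>n. \<exists>x\<in>?B. y = L n x" if y: "y \<in> ?B" for y
  proof -
    obtain n x where nx: "x \<in> ?B" "(\<tau> ^^ n) y = l x"
      using sm(4) y by blast
    have "(\<tau>' ^^ n) ((\<tau> ^^ n) y) = y"
    proof (induction n)
      case (Suc n)
      have "(\<tau> ^^ n) y \<in> ?B"
        by (rule ball_mapD[OF ball_map_funpow[OF \<tau>] y])
      then show ?case
        unfolding funpow_Suc_right[of n \<tau>'] using Suc \<tau>'\<tau> by simp
    qed simp
    then show ?thesis
      using nx by (metis L_def)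
  qed
  obtain g where g: "ball_map q g" "\<And>j x. x \<in> ?B \<Longrightarrow> g (\<alpha> j x) = L j x"
    by (rule cone_factor[OF lc m coneL]) blast

  obtain P where P: "frechet_at q q \<rho> ?B 0 P"
    using ball_map_imp_cholomorphic_on[OF \<rho>] zero_in_cunit_ball unfolding cholomorphic_on_frechet by blast
  \<comment> \<open>The eigenspace for the eigenvalue \<open>1\<close> of the derivative of
    \<open>\<rho>\<close> at the origin; by \<open>fixed_points_linear\<close> its slice is the
    fixed point set of \<open>\<rho>\<close>.\<close>
  define V where "V = {x \<in> cspace q. \<forall>i<q. (\<Sum>j<q. P i j * x j) = x i}"
  have subV: "cv.subspace V" "V \<subseteq> cspace q"
    unfolding cv.subspace_def V_def
    by (auto simp: distrib_left sum.distrib sum_distrib_left[symmetric] mult.left_commute)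
  have fixV: "\<rho> x = x \<longleftrightarrow> x \<in> V" if "x \<in> ?B" for x
  proof -
    have "\<rho> 0 = 0"
      by (simp only: \<rho>0 \<alpha>0)
    from fixed_points_linear[OF \<rho> this P] have "x \<in> {x \<in> ?B. \<rho> x = x} \<longleftrightarrow> x \<in> {x \<in> ?B. \<forall>i<q. (\<Sum>j<q. P i j * x j) = x i}"
      by (simp only:)
    then show ?thesis
      using that cunit_ballD(1)[OF that] unfolding V_def by blast
  qed
  have \<alpha>V: "\<alpha> j x \<in> V" if "x \<in> ?B" for j x
    using fixV[OF ball_mapD[OF \<alpha> that]] \<rho>\<alpha>[OF that] by blast
  have FV: "F k x \<in> V" if "x \<in> ?B" for k x
    unfolding F_def by (rule \<alpha>V[OF ball_mapD[OF recentre(1) that]])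
  \<comment> \<open>For some \<open>k\<close> the map \<open>F k\<close>, which sends the slice into
    \<open>V\<close>, is so close to the identity there that it hits \<open>y\<close>; its values
    are values of \<open>\<alpha> (m k)\<close>. The radius \<open>s\<close> halfway between the
    norm of \<open>y\<close> and \<open>1\<close> leaves the room for this.\<close>
  have \<alpha>cover: "\<exists>j. \<exists>x\<in>?B. y = \<alpha> j x" if y: "y \<in> V \<inter> ?B" for y
  proof -
    define s where "s = (1 + cnorm q y) / 2"
    have s: "cnorm q y < s" "s < 1"
      using cunit_ballD(2)[of y q] y by (auto simp: s_def)
    have sB: "x \<in> ?B" if "x \<in> V" "cnorm q x \<le> s" for x
      using that s subV(2) by (auto simp: cunit_ball_def)
    have ev1: "eventually (\<lambda>k. \<forall>x\<in>cspace q. cnorm q x \<le> s \<longrightarrow> cnorm q (F k x - \<rho> x) < s - cnorm q y) sequentially"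
      using s by (intro ball_map_uniform_limit[OF F \<rho> Flim]) auto
    have ev2: "eventually (\<lambda>k. \<forall>x\<in>cspace q. \<forall>x'\<in>cspace q. cnorm q x \<le> s \<longrightarrow> cnorm q x' \<le> s \<longrightarrow>
        cnorm q ((F k x' - \<rho> x') - (F k x - \<rho> x)) \<le> 1/2 * cnorm q (x' - x)) sequentially"
      using s by (intro ball_map_uniform_limit_Lipschitz[OF F \<rho> Flim]) auto
    from eventually_happens'[OF sequentially_bot eventually_conj[OF ev1 ev2]] obtain k where
      near: "\<forall>x\<in>cspace q. cnorm q x \<le> s \<longrightarrow> cnorm q (F k x - \<rho> x) < s - cnorm q y" and
      lip: "\<forall>x\<in>cspace q. \<forall>x'\<in>cspace q. cnorm q x \<le> s \<longrightarrow> cnorm q x' \<le> s \<longrightarrow>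
        cnorm q ((F k x' - \<rho> x') - (F k x - \<rho> x)) \<le> 1/2 * cnorm q (x' - x)"
      by (elim exE conjE)
    have \<rho>V: "\<rho> x = x" if "x \<in> V" "cnorm q x \<le> s" for x
      using fixV[OF sB[OF that]] that(1) by blast
    obtain x where x: "x \<in> V" "cnorm q x \<le> s" "F k x = y"
    proof (rule near_identity_hits[OF subV, where r = s and F = "F k" and y = y])
      fix X x assume X: "\<And>k. X k \<in> V" "\<And>k. cnorm q (X k) \<le> s" "x \<in> cspace q" "cconv q X x"
      have "cnorm q x \<le> s"
        using LIMSEQ_le_const2[OF cconv_cnorm[OF X(4)]] X(2) by blast
      then have xB: "x \<in> ?B"
        using X(3) s by (simp add: cunit_ball_def)
      \<comment> \<open>The closedness of \<open>V\<close> that is needed follows from the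
        continuity of \<open>\<rho>\<close>, whose fixed points describe \<open>V\<close> inside the
        ball.\<close>
      have "cconv q (\<lambda>k. \<rho> (X k)) (\<rho> x)"
        by (rule cconv_ball_map[OF \<rho> xB sB[OF X(1,2)] X(4) cconv_const])
      then have "cconv q X (\<rho> x)"
        by (simp only: \<rho>V[OF X(1,2)])
      then have "\<rho> x = x"
        by (rule cconv_unique[OF _ X(4) _ X(3)]) (use ball_mapD[OF \<rho> xB] cunit_ballD(1) in blast)
      then show "x \<in> V"
        using fixV[OF xB] by blast
    next
      fix x assume x: "x \<in> V" "cnorm q x \<le> s"
      show "F k x \<in> V"
        by (rule FV[OF sB[OF x]])
      show "cnorm q (F k x - x) \<le> s - cnorm q y"
        using near[rule_format, OF subsetD[OF subV(2) x(1)] x(2)] unfolding \<rho>V[OF x] by (rule less_imp_le)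
    next
      fix x x' assume x: "x \<in> V" "x' \<in> V" "cnorm q x \<le> s" "cnorm q x' \<le> s"
      show "cnorm q ((F k x' - x') - (F k x - x)) \<le> 1/2 * cnorm q (x' - x)"
        using lip[rule_format, OF subsetD[OF subV(2) x(1)] subsetD[OF subV(2) x(2)] x(3,4)]
        unfolding \<rho>V[OF x(1,3)] \<rho>V[OF x(2,4)] .
    qed (use y s in auto)
    then have "y = \<alpha> (m k) (recentre (m k) x)" "recentre (m k) x \<in> ?B"
      using ball_mapD[OF recentre(1) sB[OF x(1,2)]] by (simp_all add: F_def)
    then show ?thesis
      by blast
  qed

  have \<sigma>V: "\<sigma> y \<in> V" "\<sigma>' y \<in> V" "\<sigma> (\<sigma>' y) = y" "\<sigma>' (\<sigma> y) = y" "\<exists>n. \<exists>x\<in>?B. (\<sigma> ^^ n) y = \<alpha> 0 x"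
    if y: "y \<in> V \<inter> ?B" for y
  proof -
    obtain j x where x: "x \<in> ?B" "y = \<alpha> j x"
      using \<alpha>cover[OF y] by blast
    have fx: "f x \<in> ?B"
      by (rule ball_mapD[OF f x(1)])
    show "\<sigma> y \<in> V" "\<sigma>' y \<in> V" "\<sigma> (\<sigma>' y) = y" "\<sigma>' (\<sigma> y) = y"
      unfolding x(2) \<sigma>(2)[OF x(1)] \<sigma>'(2)[OF x(1)] \<sigma>'(2)[OF fx] \<alpha>f[OF x(1)]
      by (rule \<alpha>V[OF fx] \<alpha>V[OF x(1)] refl)+
    \<comment> \<open>\<open>\<sigma>\<close> lowers the index: it takes
      \<open>\<alpha> (Suc j) x\<close> to \<open>\<alpha> (Suc j) (f x)\<close>, which is
      \<open>\<alpha> j x\<close>.\<close>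
    have "(\<sigma> ^^ j) (\<alpha> j x) = \<alpha> 0 x"
    proof (induction j)
      case (Suc j)
      then show ?case
        unfolding funpow_Suc_right o_apply \<sigma>(2)[OF x(1)] \<alpha>f[OF x(1)] .
    qed simp
    then show "\<exists>n. \<exists>x\<in>?B. (\<sigma> ^^ n) y = \<alpha> 0 x"
      using x by blast
  qed
  obtain \<theta> where \<theta>: "ball_map q \<theta>" "\<And>x. x \<in> ?B \<Longrightarrow> \<theta> x \<in> V"
    "\<And>x. x \<in> ?B \<Longrightarrow> \<theta> (l x) = \<alpha> 0 x" "\<And>x. x \<in> ?B \<Longrightarrow> \<theta> (\<tau> x) = \<sigma> (\<theta> x)"
  proof (rule canonical_semi_model_slice[OF can subV \<alpha>[of 0] \<alpha>V \<sigma>(1) \<sigma>V(1) \<sigma>'(1) \<sigma>V(2-4)])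
    show "\<alpha> 0 (f x) = \<sigma> (\<alpha> 0 x)" if "x \<in> ?B" for x
      using \<sigma>(2)[OF that] by simp
  qed (use \<sigma>V(5) in blast)+
  \<comment> \<open>The intertwining relation gives the identity only after applying
    \<open>\<sigma>\<close>; since \<open>\<theta>\<close> takes values in the slice,
    \<open>\<sigma>'\<close> cancels it.\<close>
  have \<theta>L: "\<theta> (L j x) = \<alpha> j x" if x: "x \<in> ?B" for j x
  proof (induction j)
    case 0
    then show ?case
      using \<theta>(3)[OF x] by (simp add: L_def)
  next
    case (Suc j)
    have LB: "L (Suc j) x \<in> ?B"
      by (rule ball_mapD[OF L x])
    have "\<alpha> j x = \<sigma> (\<theta> (L (Suc j) x))"
      using Suc \<theta>(4)[OF LB] \<tau>L[OF x] by simp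
    then have "\<sigma>' (\<alpha> j x) = \<theta> (L (Suc j) x)"
      using \<sigma>V(4)[of "\<theta> (L (Suc j) x)"] \<theta>(2)[OF LB] ball_mapD[OF \<theta>(1) LB] by simp
    then show ?case
      using \<sigma>'(2)[OF x] by simp
  qed
  \<comment> \<open>Write \<open>y\<close> as \<open>L n x\<close>: then \<open>\<theta>\<close>
    gives \<open>\<alpha> n x\<close>, and \<open>g\<close> returns \<open>L n x\<close>.\<close>
  have "g (\<theta> y) = y" if "y \<in> ?B" for y
    using Lcover[OF that] \<theta>L g(2) by metis
  then have "V = cspace q"
    by (intro section_in_subspace_imp_full[OF \<theta>(1) g(1) _ V_def subV(1) \<theta>(2)])
  then have \<rho>id: "\<rho> x = x" if "x \<in> ?B" for x
    using fixV[OF that] cunit_ballD(1)[OF that] by blast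
  then have Fid: "cconv q (\<lambda>k. F k x) x" if "x \<in> ?B" for x
    using Flim[OF that] that by simp
  have "(0::real) < 1/2"
    by simp
  from eventually_happens'[OF sequentially_bot ball_map_uniform_limit_Lipschitz[OF F ball_map_id Fid R this]]
  obtain k where "\<forall>x\<in>cspace q. \<forall>y\<in>cspace q. cnorm q x \<le> R \<longrightarrow> cnorm q y \<le> R \<longrightarrow>
    cnorm q ((F k y - y) - (F k x - x)) \<le> 1/2 * cnorm q (y - x)" ..
  note k = this[rule_format]
  have "inj_on l {w \<in> ?B. cnorm q (recentre (m k) w) \<le> R}"
  proof (rule inj_onI)
    fix w w' assume "w \<in> {w \<in> ?B. cnorm q (recentre (m k) w) \<le> R}" "w' \<in> {w \<in> ?B. cnorm q (recentre (m k) w) \<le> R}"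
      and eq: "l w = l w'"
    then have w: "w \<in> ?B" "cnorm q (recentre (m k) w) \<le> R" "w' \<in> ?B" "cnorm q (recentre (m k) w') \<le> R"
      by auto
    define x where "x = recentre (m k) w"
    define x' where "x' = recentre (m k) w'"
    have x: "x \<in> cspace q" "x' \<in> cspace q"
      using ball_mapD[OF recentre(1) w(1)] ball_mapD[OF recentre(1) w(3)] cunit_ballD(1)
      unfolding x_def x'_def by blast+
    have "\<alpha> (m k) w = \<alpha> (m k) w'"
      using \<theta>L[OF w(1), of "m k"] \<theta>L[OF w(3), of "m k"] eq by (simp add: L_def)
    then have "F k x = F k x'"
      by (simp add: F_def x_def x'_def recentre(4) w)
    \<comment> \<open>If \<open>F k\<close> takes equal values at \<open>x\<close> and
      \<open>x'\<close>, its deviation from the identity varies by their full distance, which the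
      Lipschitz constant \<open>1/2\<close> permits only for \<open>x = x'\<close>.\<close>
    then have "(F k x' - x') - (F k x - x) = x - x'"
      by (simp add: fun_eq_iff)
    then have "cnorm q (x - x') \<le> 1/2 * cnorm q (x' - x)"
      using k[OF x w(2,4)[folded x_def x'_def]] by simp
    then have "cnorm q (x - x') = 0"
      using cnorm_nonneg[of q "x - x'"] unfolding cnorm_minus_commute[of q x' x] by linarith
    then have "x = x'"
      using cnorm_eq_0_iff[of "x - x'" q] x by simp
    then show "w = w'"
      using recentre(4)[OF w(1)] recentre(4)[OF w(3)] by (metis x_def x'_def)
  qed
  then show ?thesis
    unfolding m_def by blast
qed

end

section \<open>From subsequences of the orbit to all large indices\<close>

lemma cholomorphic_on_subset: "cholomorphic_on m n F S \<Longrightarrow> T \<subseteq> S \<Longrightarrow> cholomorphic_on m n F T"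
  unfolding cholomorphic_on_def by (meson image_mono order_trans subsetD)

theorem proposition1p4:
  fixes q :: nat and f l \<tau> :: "cvec \<Rightarrow> cvec"
  assumes "holomorphic_map (ball_mfd q) (ball_mfd q) f"
    and "map_type q f = q"
    and "canonical_kobayashi_semi_model q f (ball_mfd q) l \<tau>"
  shows "\<forall>R::real. R > 0 \<longrightarrow> (\<forall>z\<in>cunit_ball q. \<exists>N. \<forall>n\<ge>N.
           univalent_on q q l (kobayashi_ball q ((f ^^ n) z) R) \<and>
           univalent_on q q f (kobayashi_ball q ((f ^^ n) z) R))"
proof (intro allI impI ballI)
  fix R :: real and z assume z: "z \<in> cunit_ball q"
  let ?K = "\<lambda>n. kobayashi_ball q ((f ^^ n) z) R"
  have f: "ball_map q f"
    by (rule holomorphic_map_imp_ball_map[OF assms(1)])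
  have sm: "holomorphic_map (ball_mfd q) (ball_mfd q) l" "\<And>x. x \<in> cunit_ball q \<Longrightarrow> l (f x) = \<tau> (l x)"
    using assms(3) by (auto simp: canonical_kobayashi_semi_model_def semi_model_def)
  have l: "ball_map q l"
    by (rule holomorphic_map_imp_ball_map[OF sm(1)])
  have KB: "?K n \<subseteq> cunit_ball q" for n
    by (auto simp: kobayashi_ball_def)
  have uni: "univalent_on q q l (?K n) \<and> univalent_on q q f (?K n)" if inj: "inj_on l (?K n)" for n
  proof -
    have "inj_on f (?K n)"
    proof (rule inj_onI)
      fix x y assume xy: "x \<in> ?K n" "y \<in> ?K n" "f x = f y"
      have "l x = l y"
      proof -
        have "\<tau> (l x) = \<tau> (l y)"
          using sm(2) KB xy by (metis subsetD)
        moreover have "inj_on \<tau> (cunit_ball q)"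
          using assms(3) unfolding canonical_kobayashi_semi_model_def semi_model_def biholomorphic_map_def
          by (simp add: ball_mfd_eq bij_betw_def)
        ultimately show ?thesis
          using ball_mapD[OF l] KB xy by (meson inj_onD subsetD)
      qed
      then show "x = y"
        using inj xy by (simp add: inj_on_eq_iff)
    qed
    then show ?thesis
      using inj ball_map_imp_cholomorphic_on[OF f] ball_map_imp_cholomorphic_on[OF l] KB
      unfolding univalent_on_def by (blast intro: cholomorphic_on_subset)
  qed
  obtain r :: real where r: "r < 1" "\<And>c. 0 \<le> c \<Longrightarrow> c < 1 \<Longrightarrow> artanh c < R \<Longrightarrow> c \<le> r"
    using artanh_less_bound by blast
  \<comment> \<open>The Euclidean radius \<open>r\<close> is the same for every \<open>n\<close>,
    because recentring moves all the Kobayashi balls to the origin.\<close>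
  have sub: "?K n \<subseteq> {w \<in> cunit_ball q. cnorm q (recentre q f z n w) \<le> r}" for n
  proof
    fix w assume "w \<in> ?K n"
    then have w: "w \<in> cunit_ball q" "artanh (cnorm q (recentre q f z n w)) < R"
      using subsetD[OF kobayashi_ball_subset[OF orbit_in_ball[OF f z z]] \<open>w \<in> ?K n\<close>] by (auto simp: recentre_def[OF f z])
    then show "w \<in> {w \<in> cunit_ball q. cnorm q (recentre q f z n w) \<le> r}"
      using r(2)[of "cnorm q (recentre q f z n w)"] cunit_ballD(2)[OF ball_mapD[OF recentre(1)[OF f z]]] by auto
  qed
  \<comment> \<open>Failure for infinitely many \<open>n\<close> would give a strictly increasing
    sequence of bad indices, among which \<open>inj_on_recentred_ball\<close> finds a good
    one.\<close>
  have "\<exists>N. \<forall>n\<ge>N. inj_on l (?K n)"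
  proof (rule ccontr)
    assume "\<nexists>N. \<forall>n\<ge>N. inj_on l (?K n)"
    then have "infinite {n. \<not> inj_on l (?K n)}"
      unfolding infinite_nat_iff_unbounded_le by auto
    from infinite_enumerate[OF this] obtain b where b: "strict_mono (b :: nat \<Rightarrow> nat)" "\<And>k. \<not> inj_on l (?K (b k))"
      by auto
    obtain k where "inj_on l {w \<in> cunit_ball q. cnorm q (recentre q f z (b k) w) \<le> r}"
      using inj_on_recentred_ball[OF f z assms(3) b(1) r(1)] by blast
    then show False
      using b(2) inj_on_subset[OF _ sub] by blast
  qed
  then show "\<exists>N. \<forall>n\<ge>N. univalent_on q q l (?K n) \<and> univalent_on q q f (?K n)"
    using uni by blast
qed

end
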